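(* Let $n\ge 1$, $n_u\ge 1$, let $V\subset\mathbb{R}^n$ be open, let $\mathcal{U}=\mathbb{R}^{n_u}$ and $N=n+\frac{n(n+1)}{2}$. For $(f_0,f_1,\dots,f_{n_u})\in C^\infty(V,\mathbb{R}^{n\times(n_u+1)})$ let $$\mathfrak{f}=\Big\{ f_0+\sum_{i=1}^{n_u}u_i f_i \ :\ u\in\mathcal{U}\Big\}.$$ There exists a subset $\mathcal{O}_{\mathrm{Acc}}\subset C^\infty(V,\mathbb{R}^{n\times(n_u+1)})$, open and dense with respect to the Whitney topology, such that for every $(f_0,f_1,\dots,f_{n_u})\in\mathcal{O}_{\mathrm{Acc}}$ and every $m\in V$, $$\dim\left\{\begin{pmatrix} h(m)\\ Dh(m)+Dh(m)^\top\end{pmatrix} : h\in\mathrm{Lie}(\mathfrak{f})\right\}=N .$$ In addition, there exists a subset $\mathcal{O}_{\mathrm{Acc}_+}\subset C^\infty(V,\mathbb{R}^{n\times(n_u+1)})$, open and dense with respect to the Whitney topology, such that for every $(f_0,f_1,\dots,f_{n_u})\in\mathcal{O}_{\mathrm{Acc}_+}$ and every $m\in V$, $$\dim\left\{\begin{pmatrix} h(m)\\ Dh(m)+Dh(m)^\top\end{pmatrix} : h\in\mathcal{I}(\mathfrak{f})\right\}=N .$$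
   Context: Elements of $C^\infty(V,\mathbb{R}^{n\times(n_u+1)})$ are identified with $(n_u+1)$-tuples $(f_0,\dots,f_{n_u})$ of smooth vector fields $f_i:V\to\mathbb{R}^n$. $Dh(m)$ is the Jacobian matrix of $h$ at $m$; the Lie bracket is $[h_1,h_2]=Dh_2\,h_1-Dh_1\,h_2$. The displayed sets are linear subspaces of $\mathbb{R}^n\times\mathrm{Sym}(n)$, where $\mathrm{Sym}(n)$ is the space of real symmetric $n\times n$ matrices, which has dimension $N$ in total. For a family $\mathfrak{f}$ of smooth vector fields, $\mathrm{Lie}(\mathfrak{f})=\mathrm{span}\{[h_1,[\dots,[h_{k-1},h_k]\dots]]: k\ge1,\ h_i\in\mathfrak{f}\}$ is the (real) Lie algebra generated by $\mathfrak{f}$; $\mathcal{D}(\mathfrak{f})=\{[h_1,[\dots,[h_{k-1},h_k]\dots]]: k\ge 2,\ h_i\in\mathfrak{f}\}$; and the zero-time ideal is $\mathcal{I}(\mathfrak{f})=\mathrm{span}\{h_1-h_2,\ h_3 : h_1,h_2\in\mathfrak{f},\ h_3\in\mathcal{D}(\mathfrak{f})\}\subset\mathrm{Lie}(\mathfrak{f})$. Whitney topology on $C^\infty(V,\mathbb{R}^r)$: the topology generated by the sets $\{h\in C^\infty(V,\mathbb{R}^r): j^\ell(h)(V)\subset\mathcal{W}\}$, with $\ell\in\mathbb{N}$ and $\mathcal{W}$ an open subset of the $\ell$-jet bundle $J^\ell(V,\mathbb{R}^r)$, where $j^\ell(h):V\to J^\ell(V,\mathbb{R}^r)$ is the $\ell$-jet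 map of $h$. *)

theory Defs
  imports "HOL-Analysis.Analysis" "HOL-Library.Function_Algebras"
begin

text \<open>Pointwise scalar multiplication, so that \<^const>\<open>span\<close> applies to sets of vector fields.\<close>

instantiation "fun" :: (type, real_vector) real_vector
begin

definition scaleR_fun :: "real \<Rightarrow> ('a \<Rightarrow> 'b) \<Rightarrow> 'a \<Rightarrow> 'b"
  where "scaleR_fun c h = (\<lambda>x. c *\<^sub>R h x)"

instance
  by standard (simp_all add: scaleR_fun_def fun_eq_iff algebra_simps)

end


section \<open>Smooth maps, jets and the Whitney topology\<close>

text \<open>\<open>partials [i\<^sub>1, \<dots>, i\<^sub>k] h\<close> is \<open>\<partial>\<^bsub>i\<^sub>1\<^esub> (\<dots> (\<partial>\<^bsub>i\<^sub>k\<^esub> h))\<close>. It is only meaningful at interior points of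
  the domain of \<open>h\<close>; below it is only evaluated on open sets \<open>V\<close>.\<close>

primrec partials :: "'n list \<Rightarrow> (real^'n \<Rightarrow> 'b::real_normed_vector) \<Rightarrow> real^'n \<Rightarrow> 'b"
  where
    "partials [] h = h"
  | "partials (i # is) h = (\<lambda>x. frechet_derivative (partials is h) (at x) (axis i 1))"

text \<open>A map is smooth on an open set if it is differentiable there infinitely often, i.e. all its
  iterated partial derivatives are (Frechet) differentiable, hence also continuous.\<close>

definition smooth_on :: "(real^'n) set \<Rightarrow> (real^'n \<Rightarrow> 'b::real_normed_vector) \<Rightarrow> bool"
  where "smooth_on V h \<longleftrightarrow> (\<forall>is. \<forall>x\<in>V. partials is h differentiable (at x))"

text \<open>The space of smooth maps defined on \<open>V\<close>. Requiring the irrelevant values outside \<open>V\<close> to be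
  \<^const>\<open>undefined\<close> makes each map on \<open>V\<close> correspond to exactly one HOL function.\<close>

definition smooth_maps :: "(real^'n) set \<Rightarrow> (real^'n \<Rightarrow> 'b::real_normed_vector) set"
  where "smooth_maps V = {h \<in> extensional V. smooth_on V h}"

text \<open>The fibre of the \<open>l\<close>-jet bundle consists of the symmetric families of partial derivatives up to
  order \<open>l\<close>, indexed by lists of coordinate directions. It is topologised as a subspace of the
  product space \<^typ>\<open>'n list \<Rightarrow> 'b\<close>; as all but finitely many entries vanish,
  this is the usual topology of a finite-dimensional vector space.\<close>

definition jet_bundle ::
    "nat \<Rightarrow> (real^'n) set \<Rightarrow> ((real^'n) \<times> ('n list \<Rightarrow> 'b::real_normed_vector)) set"
  where "jet_bundle l V =
    {(x, p). x \<in> V \<and> (\<forall>is js. mset is = mset js \<longrightarrow> p is = p js) \<and> (\<forall>is. length is > l \<longrightarrow> p is = 0)}"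

definition jet ::
    "nat \<Rightarrow> (real^'n \<Rightarrow> 'b::real_normed_vector) \<Rightarrow> real^'n \<Rightarrow> (real^'n) \<times> ('n list \<Rightarrow> 'b)"
  where "jet l h x = (x, \<lambda>is. if length is \<le> l then partials is h x else 0)"

definition whitney_topology :: "(real^'n) set \<Rightarrow> (real^'n \<Rightarrow> 'b::euclidean_space) topology"
  where "whitney_topology V = topology_generated_by
    {{h \<in> smooth_maps V. jet l h ` V \<subseteq> W} | l W. openin (top_of_set (jet_bundle l V)) W}"

lemma topspace_whitney_topology:
  "topspace (whitney_topology V) = (smooth_maps V :: (real^'n \<Rightarrow> 'b::euclidean_space) set)"
proof -
  let ?W = "jet_bundle 0 V :: ((real^'n) \<times> ('n list \<Rightarrow> 'b)) set"
  have "smooth_maps V = {h \<in> smooth_maps V. jet 0 h ` V \<subseteq> ?W}"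
    by (auto simp: jet_def jet_bundle_def)
  moreover have "openin (top_of_set ?W) ?W"
    by simp
  ultimately have "smooth_maps V \<in>
      {{h \<in> smooth_maps V. jet l h ` V \<subseteq> (W :: ((real^'n) \<times> ('n list \<Rightarrow> 'b)) set)} | l W.
        openin (top_of_set (jet_bundle l V)) W}"
    by blast
  then show ?thesis
    unfolding whitney_topology_def topology_generated_by_topspace by blast
qed


section \<open>Lie algebras of vector fields\<close>

definition lie_bracket :: "(real^'n \<Rightarrow> real^'n) \<Rightarrow> (real^'n \<Rightarrow> real^'n) \<Rightarrow> real^'n \<Rightarrow> real^'n"
  where "lie_bracket h\<^sub>1 h\<^sub>2 =
    (\<lambda>m. jacobian h\<^sub>2 (at m) *v h\<^sub>1 m - jacobian h\<^sub>1 (at m) *v h\<^sub>2 m)"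

text \<open>\<open>nested_bracket [h\<^sub>1, \<dots>, h\<^sub>k] = [h\<^sub>1, [\<dots>, [h\<^bsub>k-1\<^esub>, h\<^sub>k] \<dots>]]\<close> for \<open>k \<ge> 1\<close>; the value on the empty
  list is never used.\<close>

fun nested_bracket :: "(real^'n \<Rightarrow> real^'n) list \<Rightarrow> real^'n \<Rightarrow> real^'n"
  where
    "nested_bracket [] = 0"
  | "nested_bracket [h] = h"
  | "nested_bracket (h # h' # hs) = lie_bracket h (nested_bracket (h' # hs))"

definition Lie :: "(real^'n \<Rightarrow> real^'n) set \<Rightarrow> (real^'n \<Rightarrow> real^'n) set"
  where "Lie F = span {nested_bracket hs | hs. length hs \<ge> 1 \<and> set hs \<subseteq> F}"

definition derived_brackets :: "(real^'n \<Rightarrow> real^'n) set \<Rightarrow> (real^'n \<Rightarrow> real^'n) set"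
  where "derived_brackets F = {nested_bracket hs | hs. length hs \<ge> 2 \<and> set hs \<subseteq> F}"

definition zero_time_ideal :: "(real^'n \<Rightarrow> real^'n) set \<Rightarrow> (real^'n \<Rightarrow> real^'n) set"
  where "zero_time_ideal F = span ({h\<^sub>1 - h\<^sub>2 | h\<^sub>1 h\<^sub>2. h\<^sub>1 \<in> F \<and> h\<^sub>2 \<in> F} \<union> derived_brackets F)"

text \<open>An \<open>n \<times> (n\<^sub>u + 1)\<close>-matrix-valued map \<open>f\<close> encodes the tuple \<open>(f\<^sub>0, \<dots>, f\<^bsub>n\<^sub>u\<^esub>)\<close> by its columns:
  column \<^const>\<open>None\<close> is the drift \<open>f\<^sub>0\<close>, column \<^term>\<open>Some i\<close> is the \<open>i\<close>-th controlled field.\<close>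

definition control_family ::
    "(real^'n \<Rightarrow> real^('u::finite) option^'n) \<Rightarrow> (real^'n \<Rightarrow> real^'n) set"
  where "control_family f =
    range (\<lambda>(u :: real^'u) x. column None (f x) + (\<Sum>i\<in>UNIV. u $ i *\<^sub>R column (Some i) (f x)))"

end

theory Submission
  imports Defs
begin

text \<open>One set serves both claims. Fix a control index \<open>i\<close> and put \<open>g = f\<^sub>0\<close>, \<open>w = f\<^sub>0 + f\<^sub>i\<close>; both belong to
  the control family, so the iterated brackets \<open>ad\<^sub>g\<^sup>k w\<close> and \<open>ad\<^sub>w\<^sup>k g\<close> with \<open>1 \<le> k \<le> K\<close> lie in the zero-time
  ideal. The good set consists of those \<open>f\<close> for which the 1-jets of these finitely many brackets span all of
  \<open>\<real>\<^sup>n \<times> \<real>\<^sup>n\<^sup>\<times>\<^sup>n\<close> at every point. The 1-jets are polynomials in the jets of \<open>f\<close>, so this is a Whitney open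
  condition.

  For density, first add a small multiple of a constant so that \<open>g\<close> and \<open>w\<close> have no common zero. Where
  \<open>g \<noteq> 0\<close>, replace \<open>w\<close> by \<open>w + \<delta> p\<close> with a polynomial field \<open>p\<close> and a fixed smooth \<open>\<delta>\<close>, positive exactly where
  \<open>g \<noteq> 0\<close> and small in the Whitney sense. The 1-jets at \<open>x\<close> fail to span only if some covector \<open>(\<lambda>, S) \<noteq> 0\<close>
  kills all \<open>K\<close> of them. For given \<open>(x, \<lambda>, S)\<close> these are \<open>K\<close> independent affine equations in the
  coefficients of \<open>p\<close>, while \<open>(x, \<lambda>, S)\<close> ranges over a space of dimension less than \<open>K\<close>; hence the bad
  coefficients form a null set. Since \<open>\<delta>\<close> is flat where \<open>g = 0\<close>, exchanging the roles of \<open>g\<close> and \<open>w\<close> in a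
  second perturbation keeps what has been achieved at the zeros of \<open>w\<close>.\<close>

section \<open>Calculus of smooth maps\<close>

text \<open>The obstacle is a zero \<open>x\<close> of \<open>g\<close>: there the 1-jet of every
  bracket of \<open>w\<close> under \<open>ad g\<close> depends on \<open>w\<close> only through its
  1-jet at \<open>x\<close>, which leaves n + n^2 parameters, too few for \<open>K\<close>
  independent equations. Zeros of a single field can be stable under perturbation, but common zeros
  of two fields cannot, being 2n equations in n unknowns; this is why both families of brackets are
  used. Where \<open>g x\<close> is nonzero, independence comes from fields divisible by the k-th
  power of \<open>g x \<bullet> (y - x)\<close>. Each bracket with \<open>g\<close> removes one such
  factor to leading order, so with a suitable extra factor of degree at most one the covector sees
  nothing before the k-th bracket and something nonzero at the k-th: the system is triangular. The
  count needs \<open>K\<close> to exceed 2n + n^2, the dimension of the triples of point, covector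
  and matrix. Full Jacobians are no harder to span than their symmetric parts and give the claim by
  symmetrisation. The scale \<open>\<delta>\<close> has to be fixed before the coefficients, because
  the null set to be avoided depends on it; smallness is therefore arranged uniformly for all
  coefficient vectors in the unit ball.\<close>

abbreviation pd :: "'n::finite \<Rightarrow> (real^'n \<Rightarrow> 'b::real_normed_vector) \<Rightarrow> real^'n \<Rightarrow> 'b"
  where "pd i h \<equiv> (\<lambda>x. frechet_derivative h (at x) (axis i 1))"

text \<open>Smoothness offers no order to induct on, so closure properties are proved at finite
  order by induction on \<open>k\<close>. The partials of length \<open>k\<close> are themselves
  differentiable, so order \<open>k\<close> here means \<open>k + 1\<close> times
  differentiable.\<close>

definition ck_on :: "nat \<Rightarrow> (real^'n) set \<Rightarrow> (real^'n \<Rightarrow> 'b::real_normed_vector) \<Rightarrow> bool"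
  where "ck_on k V h \<longleftrightarrow> (\<forall>is. length is \<le> k \<longrightarrow> (\<forall>x\<in>V. partials is h differentiable at x))"

lemma partials_append: "partials (is @ js) h = partials is (partials js h)"
  by (induction "is") auto

lemma partials_snoc: "partials (is @ [i]) h = partials is (pd i h)"
  by (simp add: partials_append)

lemma smooth_on_ck: "smooth_on V h \<longleftrightarrow> (\<forall>k. ck_on k V h)"
  unfolding smooth_on_def ck_on_def by blast

lemma ck_on_0: "ck_on 0 V h \<longleftrightarrow> (\<forall>x\<in>V. h differentiable at x)"
  by (simp add: ck_on_def)

text \<open>The list is split at its last entry, the derivative taken first, so that the remaining
  list acts on \<open>pd i h\<close>.\<close>

lemma ck_on_Suc: "ck_on (Suc k) V h \<longleftrightarrow> (\<forall>x\<in>V. h differentiable at x) \<and> (\<forall>i. ck_on k V (pd i h))"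
proof
  assume h: "ck_on (Suc k) V h"
  then have "ck_on k V (pd i h)" for i
    unfolding ck_on_def by (metis Suc_le_mono length_append_singleton partials_snoc)
  moreover have "\<forall>x\<in>V. h differentiable at x"
    using h unfolding ck_on_def by (metis le0 list.size(3) partials.simps(1))
  ultimately show "(\<forall>x\<in>V. h differentiable at x) \<and> (\<forall>i. ck_on k V (pd i h))" by blast
next
  assume h: "(\<forall>x\<in>V. h differentiable at x) \<and> (\<forall>i. ck_on k V (pd i h))"
  have "partials is h differentiable at x" if "length is \<le> Suc k" "x \<in> V" for "is" x
  proof (cases "is" rule: rev_cases)
    case Nil
    then show ?thesis using h that by simp
  next
    case (snoc js i)
    then show ?thesis
      using h that unfolding ck_on_def by (simp add: partials_snoc)
  qed
  then show "ck_on (Suc k) V h" unfolding ck_on_def by blast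
qed

lemma ck_on_mono: "ck_on k V h \<Longrightarrow> j \<le> k \<Longrightarrow> ck_on j V h"
  unfolding ck_on_def by auto

lemma smooth_on_step:
  "smooth_on V h \<longleftrightarrow> (\<forall>x\<in>V. h differentiable at x) \<and> (\<forall>i. smooth_on V (pd i h))"
proof -
  have "(\<forall>k. ck_on k V h) \<longleftrightarrow> (\<forall>k. ck_on (Suc k) V h)"
    using ck_on_mono by (metis le_add2 plus_1_eq_Suc)
  then show ?thesis
    unfolding smooth_on_ck ck_on_Suc by blast
qed

lemma smooth_on_subset: "smooth_on V h \<Longrightarrow> W \<subseteq> V \<Longrightarrow> smooth_on W h"
  unfolding smooth_on_def by blast

lemma smooth_on_differentiable: "smooth_on V h \<Longrightarrow> x \<in> V \<Longrightarrow> h differentiable at x"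
  using smooth_on_step by blast

lemma smooth_on_pd: "smooth_on V h \<Longrightarrow> smooth_on V (pd i h)"
  using smooth_on_step by blast

lemma smooth_on_partials: "smooth_on V h \<Longrightarrow> smooth_on V (partials is h)"
  by (induction "is") (auto intro: smooth_on_pd)

lemma frechet_derivative_cong_open:
  assumes "open V" "x \<in> V" "\<And>y. y \<in> V \<Longrightarrow> f y = g y"
  shows "frechet_derivative f (at x) = frechet_derivative g (at x)"
proof -
  have "(f has_derivative D) (at x) \<longleftrightarrow> (g has_derivative D) (at x)" for D
    using has_derivative_transform_within_open[of f D x UNIV V g]
      has_derivative_transform_within_open[of g D x UNIV V f] assms by auto
  then show ?thesis
    unfolding frechet_derivative_def by simp
qed

lemma differentiable_cong_open:
  assumes "open V" "x \<in> V" "\<And>y. y \<in> V \<Longrightarrow> f y = g y" "f differentiable at x"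
  shows "g differentiable at x"
  using assms has_derivative_transform_within_open[of f _ x UNIV V g]
  unfolding differentiable_def by blast

lemma partials_cong:
  assumes "open V" "\<And>y. y \<in> V \<Longrightarrow> f y = g y" "x \<in> V"
  shows "partials is f x = partials is g x"
  using assms(3)
proof (induction "is" arbitrary: x)
  case Nil
  then show ?case using assms by simp
next
  case (Cons i js)
  show ?case
    using frechet_derivative_cong_open[OF assms(1) Cons.prems Cons.IH] by simp
qed

lemma ck_on_cong:
  assumes "open V" "\<And>y. y \<in> V \<Longrightarrow> f y = g y" "ck_on k V f"
  shows "ck_on k V g"
  unfolding ck_on_def
proof (intro allI impI ballI)
  fix "is" :: "'a list" and x assume "length is \<le> k" "x \<in> V"
  then have "partials is f differentiable at x" using assms(3) unfolding ck_on_def by blast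
  then show "partials is g differentiable at x"
    by (rule differentiable_cong_open[OF assms(1) \<open>x \<in> V\<close> partials_cong[OF assms(1,2)], rotated 2]) auto
qed

lemma smooth_on_cong:
  assumes "open V" "\<And>y. y \<in> V \<Longrightarrow> f y = g y" "smooth_on V f"
  shows "smooth_on V g"
  using assms ck_on_cong unfolding smooth_on_ck by blast

lemma pd_eq: "(f has_derivative D) (at x) \<Longrightarrow> pd i f x = D (axis i 1)"
  by (metis frechet_derivative_at)

lemma differentiableD: "f differentiable at x \<Longrightarrow> (f has_derivative frechet_derivative f (at x)) (at x)"
  by (simp add: frechet_derivative_works)

lemma pd_const: "pd i (\<lambda>x. c) = (\<lambda>x. 0)"
  by (simp add: frechet_derivative_const)

lemma pd_add:
  "f differentiable at x \<Longrightarrow> g differentiable at x \<Longrightarrow> pd i (\<lambda>x. f x + g x) x = pd i f x + pd i g x"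
  by (drule differentiableD)+ (rule pd_eq, rule has_derivative_add)

lemma pd_bounded_linear:
  "bounded_linear L \<Longrightarrow> f differentiable at x \<Longrightarrow> pd i (\<lambda>x. L (f x)) x = L (pd i f x)"
  by (drule differentiableD) (rule pd_eq, rule bounded_linear.has_derivative)

lemma pd_bilinear:
  assumes "bounded_bilinear mul" "f differentiable at x" "g differentiable at x"
  shows "pd i (\<lambda>x. mul (f x) (g x)) x = mul (f x) (pd i g x) + mul (pd i f x) (g x)"
  using bounded_bilinear.FDERIV[OF assms(1) differentiableD[OF assms(2)] differentiableD[OF assms(3)]]
  by (rule pd_eq)

section \<open>Closure properties of smoothness\<close>

lemma ck_on_const: "ck_on k V (\<lambda>x. c)"
proof (induction k arbitrary: c)
  case (Suc k)
  then show ?case by (simp add: ck_on_Suc pd_const)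
qed (simp add: ck_on_0)

lemma ck_on_bounded_linear:
  assumes "open V" "bounded_linear L" "ck_on k V f"
  shows "ck_on k V (\<lambda>x. L (f x))"
  using assms(3)
proof (induction k arbitrary: f)
  case 0
  then show ?case
    unfolding ck_on_0 using assms(2) bounded_linear.has_derivative differentiable_def by metis
next
  case (Suc k)
  have d: "\<forall>x\<in>V. f differentiable at x" and s: "\<And>i. ck_on k V (pd i f)"
    using Suc.prems by (auto simp: ck_on_Suc)
  have "ck_on k V (pd i (\<lambda>x. L (f x)))" for i
    by (rule ck_on_cong[OF assms(1) _ Suc.IH[OF s[of i]]]) (simp add: d pd_bounded_linear[OF assms(2)])
  moreover have "\<forall>x\<in>V. (\<lambda>x. L (f x)) differentiable at x"
    using d assms(2) bounded_linear.has_derivative differentiable_def by metis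
  ultimately show ?case by (simp add: ck_on_Suc)
qed

lemma ck_on_add:
  assumes "open V" "ck_on k V f" "ck_on k V g"
  shows "ck_on k V (\<lambda>x. f x + g x)"
  using assms(2,3)
proof (induction k arbitrary: f g)
  case 0
  then show ?case by (auto simp: ck_on_0)
next
  case (Suc k)
  have d: "\<forall>x\<in>V. f differentiable at x" "\<forall>x\<in>V. g differentiable at x"
    and s: "\<And>i. ck_on k V (pd i f)" "\<And>i. ck_on k V (pd i g)"
    using Suc.prems by (auto simp: ck_on_Suc)
  have "ck_on k V (pd i (\<lambda>x. f x + g x))" for i
    by (rule ck_on_cong[OF assms(1) _ Suc.IH[OF s(1)[of i] s(2)[of i]]]) (simp add: d pd_add)
  then show ?case using d by (simp add: ck_on_Suc)
qed

lemma differentiable_bilinear: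
  assumes "bounded_bilinear mul" "f differentiable at x" "g differentiable at x"
  shows "(\<lambda>x. mul (f x) (g x)) differentiable at x"
  using bounded_bilinear.FDERIV[OF assms(1)] assms(2,3) unfolding differentiable_def by blast

lemma ck_on_bilinear:
  assumes "open V" "bounded_bilinear mul" "ck_on k V f" "ck_on k V g"
  shows "ck_on k V (\<lambda>x. mul (f x) (g x))"
  using assms(3,4)
proof (induction k arbitrary: f g)
  case 0
  then show ?case by (simp add: ck_on_0 differentiable_bilinear[OF assms(2)])
next
  case (Suc k)
  have d: "\<forall>x\<in>V. f differentiable at x" "\<forall>x\<in>V. g differentiable at x"
    and s: "\<And>i. ck_on k V (pd i f)" "\<And>i. ck_on k V (pd i g)"
    using Suc.prems by (auto simp: ck_on_Suc)
  \<comment> \<open>The product rule also contains \<open>f\<close> and \<open>g\<close>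
    undifferentiated, so both are needed at the lower order \<open>k\<close> as well.\<close>
  have "ck_on k V f" "ck_on k V g" using Suc.prems ck_on_mono le_SucI by blast+
  then have "ck_on k V (\<lambda>x. mul (f x) (pd i g x) + mul (pd i f x) (g x))" for i
    using ck_on_add[OF assms(1) Suc.IH Suc.IH] s by blast
  then have "ck_on k V (pd i (\<lambda>x. mul (f x) (g x)))" for i
    by (rule ck_on_cong[OF assms(1), rotated]) (simp add: d pd_bilinear[OF assms(2)])
  then show ?case by (simp add: ck_on_Suc d differentiable_bilinear[OF assms(2)])
qed

lemma smooth_on_const: "smooth_on V (\<lambda>x. c)"
  by (simp add: smooth_on_ck ck_on_const)

lemma smooth_on_bounded_linear:
  "open V \<Longrightarrow> bounded_linear L \<Longrightarrow> smooth_on V f \<Longrightarrow> smooth_on V (\<lambda>x. L (f x))"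
  by (simp add: smooth_on_ck ck_on_bounded_linear)

lemma smooth_on_add:
  "open V \<Longrightarrow> smooth_on V f \<Longrightarrow> smooth_on V g \<Longrightarrow> smooth_on V (\<lambda>x. f x + g x)"
  by (simp add: smooth_on_ck ck_on_add)

lemma smooth_on_bilinear:
  "open V \<Longrightarrow> bounded_bilinear mul \<Longrightarrow> smooth_on V f \<Longrightarrow> smooth_on V g
    \<Longrightarrow> smooth_on V (\<lambda>x. mul (f x) (g x))"
  by (simp add: smooth_on_ck ck_on_bilinear)

lemmas smooth_on_scaleR = smooth_on_bilinear[OF _ bounded_bilinear_scaleR]
lemmas smooth_on_mult = smooth_on_bilinear[OF _ bounded_bilinear_mult]
lemmas smooth_on_inner = smooth_on_bilinear[OF _ bounded_bilinear_inner]
lemmas smooth_on_vec_nth = smooth_on_bounded_linear[OF _ bounded_linear_vec_nth]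

lemma smooth_on_uminus: "open V \<Longrightarrow> smooth_on V f \<Longrightarrow> smooth_on V (\<lambda>x. - f x)"
  by (rule smooth_on_bounded_linear[OF _ bounded_linear_minus[OF bounded_linear_ident]])

lemma smooth_on_diff:
  "open V \<Longrightarrow> smooth_on V f \<Longrightarrow> smooth_on V g \<Longrightarrow> smooth_on V (\<lambda>x. f x - g x)"
  using smooth_on_add[of V f "\<lambda>x. - g x"] smooth_on_uminus[of V g] by simp

lemma smooth_on_sum:
  "open V \<Longrightarrow> (\<And>c. c \<in> C \<Longrightarrow> smooth_on V (f c)) \<Longrightarrow> smooth_on V (\<lambda>x. \<Sum>c\<in>C. f c x)"
  by (induction C rule: infinite_finite_induct) (auto intro: smooth_on_const smooth_on_add)

lemma smooth_on_prod:
  fixes f :: "'c \<Rightarrow> real^'n \<Rightarrow> real"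
  shows "open V \<Longrightarrow> (\<And>c. c \<in> C \<Longrightarrow> smooth_on V (f c)) \<Longrightarrow> smooth_on V (\<lambda>x. \<Prod>c\<in>C. f c x)"
  by (induction C rule: infinite_finite_induct) (auto intro: smooth_on_const smooth_on_mult)

lemma smooth_on_power:
  fixes f :: "real^'n \<Rightarrow> real"
  shows "open V \<Longrightarrow> smooth_on V f \<Longrightarrow> smooth_on V (\<lambda>x. f x ^ k)"
  by (induction k) (auto intro: smooth_on_const smooth_on_mult)

lemma bounded_linear_pd: "bounded_linear L \<Longrightarrow> pd i L = (\<lambda>x. L (axis i 1))"
  using pd_eq[OF bounded_linear_imp_has_derivative] by blast

lemma smooth_on_linear: "bounded_linear L \<Longrightarrow> smooth_on V L"
  by (subst smooth_on_step)
     (simp add: bounded_linear_pd smooth_on_const bounded_linear_imp_differentiable)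

lemma smooth_on_continuous: "smooth_on V f \<Longrightarrow> continuous_on V f"
  by (meson continuous_at_imp_continuous_on differentiable_imp_continuous_within smooth_on_differentiable)

lemma partials_bounded_linear:
  assumes "open V" "bounded_linear L" "smooth_on V f" "x \<in> V"
  shows "partials is (\<lambda>x. L (f x)) x = L (partials is f x)"
  using assms(4)
proof (induction "is" arbitrary: x)
  case (Cons i js)
  have "pd i (partials js (\<lambda>x. L (f x))) x = pd i (\<lambda>x. L (partials js f x)) x"
    using frechet_derivative_cong_open[OF assms(1) Cons.prems Cons.IH] by simp
  then show ?case
    using pd_bounded_linear[OF assms(2), of "partials js f" x i] Cons.prems
      smooth_on_differentiable[OF smooth_on_partials[OF assms(3)]] by simp
qed simp

lemma partials_add:
  assumes "open V" "smooth_on V f" "smooth_on V g" "x \<in> V"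
  shows "partials is (\<lambda>x. f x + g x) x = partials is f x + partials is g x"
  using assms(4)
proof (induction "is" arbitrary: x)
  case (Cons i js)
  have "pd i (partials js (\<lambda>x. f x + g x)) x = pd i (\<lambda>x. partials js f x + partials js g x) x"
    using frechet_derivative_cong_open[OF assms(1) Cons.prems Cons.IH] by simp
  then show ?case
    by (simp add: pd_add smooth_on_differentiable[OF smooth_on_partials[OF assms(2)] Cons.prems]
        smooth_on_differentiable[OF smooth_on_partials[OF assms(3)] Cons.prems])
qed simp

lemma partials_const_0: "partials is (\<lambda>x. 0) = (\<lambda>x. 0)"
  by (induction "is") (auto simp: pd_const)

lemma partials_sum:
  assumes "open V" "\<And>c. c \<in> C \<Longrightarrow> smooth_on V (f c)" "x \<in> V"
  shows "partials is (\<lambda>x. \<Sum>c\<in>C. f c x) x = (\<Sum>c\<in>C. partials is (f c) x)"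
  using assms(2)
proof (induction C rule: infinite_finite_induct)
  case (insert c C)
  then show ?case
    using partials_add[OF assms(1) _ smooth_on_sum[OF assms(1)] assms(3), of "f c" C f "is"] by simp
qed (simp_all add: partials_const_0)

lemma frechet_pd:
  assumes "h differentiable at x"
  shows "frechet_derivative h (at x) v = (\<Sum>i\<in>UNIV. v $ i *\<^sub>R pd i h x)"
proof -
  interpret linear "frechet_derivative h (at x)" using assms by (rule linear_frechet_derivative)
  have "frechet_derivative h (at x) v = frechet_derivative h (at x) (\<Sum>i\<in>UNIV. v $ i *\<^sub>R axis i 1)"
    by (simp add: basis_expansion flip: scalar_mult_eq_scaleR)
  then show ?thesis by (simp add: sum scale)
qed

section \<open>Symmetry of mixed partial derivatives, and iterated brackets\<close>

lemma has_real_derivative_pd: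
  fixes h :: "real^'n \<Rightarrow> real"
  assumes "h differentiable at (y + t *\<^sub>R axis i 1)"
  shows "((\<lambda>t. h (y + t *\<^sub>R axis i 1)) has_real_derivative pd i h (y + t *\<^sub>R axis i 1)) (at t)"
proof -
  have "((\<lambda>t. y + t *\<^sub>R axis i 1) has_derivative (\<lambda>t. t *\<^sub>R axis i 1)) (at t)"
    by (auto intro!: derivative_eq_intros)
  from has_derivative_compose[OF this differentiableD[OF assms]]
  have "((\<lambda>t. h (y + t *\<^sub>R axis i 1)) has_derivative
      (\<lambda>s. frechet_derivative h (at (y + t *\<^sub>R axis i 1)) (s *\<^sub>R axis i 1))) (at t)" .
  then show ?thesis
    unfolding has_field_derivative_def
    by (simp add: linear_cmul[OF linear_frechet_derivative[OF assms]] mult.commute[of _ "pd i h _"])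
qed

text \<open>The mean value theorem is used twice: in direction \<open>i\<close> for the increment of
  \<open>h\<close> over a step in direction \<open>j\<close>, then in direction \<open>j\<close> for
  \<open>pd i h\<close>.\<close>

lemma second_difference_mean_value:
  fixes h :: "real^'n \<Rightarrow> real"
  assumes "smooth_on V h" "cball x (2 * s) \<subseteq> V" "s > 0"
  obtains p where "p \<in> cball x (2 * s)"
    "h (x + s *\<^sub>R axis i 1 + s *\<^sub>R axis j 1) - h (x + s *\<^sub>R axis i 1) - h (x + s *\<^sub>R axis j 1) + h x
      = s\<^sup>2 * pd j (pd i h) p"
proof -
  have in_ball: "x + u *\<^sub>R axis i 1 + t *\<^sub>R axis j 1 \<in> cball x (2 * s)"
    if "0 \<le> u" "u \<le> s" "0 \<le> t" "t \<le> s" for u t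
  proof -
    have "norm (u *\<^sub>R axis i 1 + t *\<^sub>R axis j 1 :: real^'n) \<le> u + t"
      using norm_triangle_ineq[of "u *\<^sub>R axis i 1 :: real^'n" "t *\<^sub>R axis j 1"] that by simp
    also have "\<dots> \<le> 2 * s" using that by simp
    finally have "dist (x + (u *\<^sub>R axis i 1 + t *\<^sub>R axis j 1)) x \<le> 2 * s"
      by (simp add: dist_norm)
    then show ?thesis by (simp add: dist_commute add.assoc)
  qed
  have d: "h differentiable at y" "pd i h differentiable at y" if "y \<in> cball x (2 * s)" for y
    using that assms smooth_on_differentiable smooth_on_pd by blast+
  have s0: "x + s *\<^sub>R axis j 1 + u *\<^sub>R axis i 1 \<in> cball x (2 * s)"
    "x + u *\<^sub>R axis i 1 \<in> cball x (2 * s)" if "0 \<le> u" "u \<le> s" for u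
    using in_ball[of u s] in_ball[of u 0] that assms(3) by (simp_all add: ac_simps)
  have "\<exists>u>0. u < s \<and>
    (h (x + s *\<^sub>R axis j 1 + s *\<^sub>R axis i 1) - h (x + s *\<^sub>R axis i 1))
      - (h (x + s *\<^sub>R axis j 1 + 0 *\<^sub>R axis i 1) - h (x + 0 *\<^sub>R axis i 1))
    = (s - 0) * (pd i h (x + s *\<^sub>R axis j 1 + u *\<^sub>R axis i 1) - pd i h (x + u *\<^sub>R axis i 1))"
    by (rule MVT2[OF assms(3)]) (intro derivative_intros has_real_derivative_pd d s0)
  then obtain u where u: "0 < u" "u < s" and eq1:
    "h (x + s *\<^sub>R axis j 1 + s *\<^sub>R axis i 1) - h (x + s *\<^sub>R axis i 1)
      - (h (x + s *\<^sub>R axis j 1) - h x)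
    = s * (pd i h (x + s *\<^sub>R axis j 1 + u *\<^sub>R axis i 1) - pd i h (x + u *\<^sub>R axis i 1))"
    by auto
  have "\<exists>t>0. t < s \<and>
    pd i h ((x + u *\<^sub>R axis i 1) + s *\<^sub>R axis j 1) - pd i h ((x + u *\<^sub>R axis i 1) + 0 *\<^sub>R axis j 1)
    = (s - 0) * pd j (pd i h) ((x + u *\<^sub>R axis i 1) + t *\<^sub>R axis j 1)"
    by (rule MVT2[OF assms(3)]) (intro has_real_derivative_pd d in_ball; use u in simp)
  then obtain t where t: "0 < t" "t < s" and eq2:
    "pd i h (x + u *\<^sub>R axis i 1 + s *\<^sub>R axis j 1) - pd i h (x + u *\<^sub>R axis i 1)
    = s * pd j (pd i h) (x + u *\<^sub>R axis i 1 + t *\<^sub>R axis j 1)"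
    by auto
  show ?thesis
  proof (rule that[OF in_ball[of u t]])
    show "h (x + s *\<^sub>R axis i 1 + s *\<^sub>R axis j 1) - h (x + s *\<^sub>R axis i 1) - h (x + s *\<^sub>R axis j 1) + h x
      = s\<^sup>2 * pd j (pd i h) (x + u *\<^sub>R axis i 1 + t *\<^sub>R axis j 1)"
      using eq1 eq2 by (simp add: power2_eq_square ac_simps)
  qed (use u t in auto)
qed

text \<open>The second difference is symmetric in \<open>i\<close> and \<open>j\<close>. Hence one
  mixed partial at a point \<open>p\<close> equals the other at a point \<open>q\<close>, both as
  close to \<open>x\<close> as desired, and continuity forces equality at \<open>x\<close>.\<close>

lemma pd_commute_real:
  fixes h :: "real^'n \<Rightarrow> real"
  assumes "open V" "smooth_on V h" "x \<in> V"
  shows "pd i (pd j h) x = pd j (pd i h) x"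
proof (rule ccontr)
  define A where "A = pd i (pd j h)"
  define B where "B = pd j (pd i h)"
  assume "pd i (pd j h) x \<noteq> pd j (pd i h) x"
  then have e: "\<bar>A x - B x\<bar> / 2 > 0" by (simp add: A_def B_def)
  have "smooth_on V A" "smooth_on V B"
    unfolding A_def B_def using assms(2) smooth_on_pd by blast+
  then have "continuous (at x) A" "continuous (at x) B"
    using assms(1,3) smooth_on_continuous continuous_on_eq_continuous_at by blast+
  then obtain d1 d2 where d: "d1 > 0" "d2 > 0"
    "\<And>y. dist y x < d1 \<Longrightarrow> dist (A y) (A x) < \<bar>A x - B x\<bar> / 2"
    "\<And>y. dist y x < d2 \<Longrightarrow> dist (B y) (B x) < \<bar>A x - B x\<bar> / 2"
    unfolding continuous_at_eps_delta using e by blast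
  obtain r where r: "r > 0" "cball x r \<subseteq> V"
    using assms(1,3) open_contains_cball by blast
  define s where "s = min r (min d1 d2) / 3"
  have s: "s > 0" "2 * s < r" "2 * s < d1" "2 * s < d2" using r d by (auto simp: s_def)
  then have sub: "cball x (2 * s) \<subseteq> V" using r by force
  obtain p where p: "p \<in> cball x (2 * s)"
    "h (x + s *\<^sub>R axis i 1 + s *\<^sub>R axis j 1) - h (x + s *\<^sub>R axis i 1) - h (x + s *\<^sub>R axis j 1) + h x
      = s\<^sup>2 * B p"
    unfolding B_def by (rule second_difference_mean_value[OF assms(2) sub s(1), of i j])
  obtain q where q: "q \<in> cball x (2 * s)"
    "h (x + s *\<^sub>R axis j 1 + s *\<^sub>R axis i 1) - h (x + s *\<^sub>R axis j 1) - h (x + s *\<^sub>R axis i 1) + h x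
      = s\<^sup>2 * A q"
    unfolding A_def by (rule second_difference_mean_value[OF assms(2) sub s(1), of j i])
  have c: "x + s *\<^sub>R axis j 1 + s *\<^sub>R axis i 1 = x + s *\<^sub>R axis i 1 + s *\<^sub>R axis j 1"
    by simp
  have "s\<^sup>2 * B p = s\<^sup>2 * A q"
    using p(2) q(2)[unfolded c] by linarith
  then have "B p = A q" using s by simp
  then have "\<bar>A x - B x\<bar> \<le> \<bar>A q - A x\<bar> + \<bar>B p - B x\<bar>" by simp
  moreover have near: "dist p x < d2" "dist q x < d1"
    using p(1) q(1) s by (auto simp: dist_commute)
  ultimately show False
    using add_strict_mono[OF d(3)[OF near(2)] d(4)[OF near(1)]] by (simp add: dist_real_def)
qed

lemma pd_commute:
  fixes h :: "real^'n \<Rightarrow> 'b::euclidean_space"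
  assumes "open V" "smooth_on V h" "x \<in> V"
  shows "pd i (pd j h) x = pd j (pd i h) x"
proof (rule euclidean_eqI)
  fix b :: 'b
  have l: "bounded_linear (\<lambda>y. y \<bullet> b)" by (rule bounded_linear_inner_left)
  have "pd i (pd j (\<lambda>y. h y \<bullet> b)) x = pd j (pd i (\<lambda>y. h y \<bullet> b)) x"
    by (rule pd_commute_real[OF assms(1) smooth_on_bounded_linear[OF assms(1) l assms(2)] assms(3)])
  then show "pd i (pd j h) x \<bullet> b = pd j (pd i h) x \<bullet> b"
    using partials_bounded_linear[OF assms(1) l assms(2,3), of "[i, j]"]
      partials_bounded_linear[OF assms(1) l assms(2,3), of "[j, i]"] by simp
qed

lemma partials_move:
  fixes h :: "real^'n \<Rightarrow> 'b::euclidean_space"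
  assumes "open V" "smooth_on V h" "x \<in> V"
  shows "partials (ys @ i # zs) h x = partials (i # ys @ zs) h x"
  using assms(3)
proof (induction ys arbitrary: x)
  case (Cons y ys)
  have "partials ((y # ys) @ i # zs) h x = pd y (partials (i # ys @ zs) h) x"
    using frechet_derivative_cong_open[OF assms(1) Cons.prems Cons.IH] by simp
  also have "\<dots> = pd i (partials (y # ys @ zs) h) x"
    using pd_commute[OF assms(1) smooth_on_partials[OF assms(2)] Cons.prems] by simp
  finally show ?case by simp
qed simp

lemma partials_perm:
  fixes h :: "real^'n \<Rightarrow> 'b::euclidean_space"
  assumes "open V" "smooth_on V h" "x \<in> V" "mset is = mset js"
  shows "partials is h x = partials js h x"
  using assms(3,4)
proof (induction "is" arbitrary: js x)
  case (Cons i "is")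
  then obtain ys zs where js: "js = ys @ i # zs"
    by (metis list.set_intros(1) set_mset_mset split_list)
  then have "mset is = mset (ys @ zs)" using Cons.prems by simp
  then have "partials is h y = partials (ys @ zs) h y" if "y \<in> V" for y
    using Cons.IH that by blast
  then have "pd i (partials is h) x = pd i (partials (ys @ zs) h) x"
    using frechet_derivative_cong_open[OF assms(1) Cons.prems(1), of "partials is h" "partials (ys @ zs) h"]
    by simp
  then show ?case
    using partials_move[OF assms(1,2) Cons.prems(1)] js by simp
qed simp

text \<open>The fibres of \<open>jet_bundle\<close> consist of symmetric families only, so this is
  where Schwarz's theorem enters.\<close>

lemma jet_in_bundle:
  fixes h :: "real^'n \<Rightarrow> 'b::euclidean_space"
  assumes "open V" "smooth_on V h" "x \<in> V"
  shows "jet l h x \<in> jet_bundle l V"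
proof -
  have "(if length is \<le> l then partials is h x else 0) = (if length js \<le> l then partials js h x else 0)"
    if "mset is = mset js" for "is" js
    using partials_perm[OF assms that] mset_eq_length[OF that] by simp
  then show ?thesis
    unfolding jet_def jet_bundle_def using assms(3) by fastforce
qed

section \<open>Iterated brackets and their 1-jets\<close>

definition ad :: "(real^'n \<Rightarrow> real^'n) \<Rightarrow> nat \<Rightarrow> (real^'n \<Rightarrow> real^'n) \<Rightarrow> real^'n \<Rightarrow> real^'n"
  where "ad g k w = (lie_bracket g ^^ k) w"

text \<open>The Jacobian is kept in full. Spanning all 1-jets is stronger than the claim, and
  symmetrisation is applied only once, in the final dimension count.\<close>

definition jet1 :: "(real^'n \<Rightarrow> real^'n) \<Rightarrow> real^'n \<Rightarrow> (real^'n) \<times> (real^'n^'n)"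
  where "jet1 h x = (h x, jacobian h (at x))"

lemma ad_0 [simp]: "ad g 0 w = w" and ad_Suc [simp]: "ad g (Suc k) w = lie_bracket g (ad g k w)"
  by (simp_all add: ad_def)

lemma jacobian_nth: "jacobian h (at x) $ c $ j = pd j h x $ c"
  by (simp add: jacobian_def matrix_def)

lemma jacobian_mult:
  "h differentiable at x \<Longrightarrow> jacobian h (at x) *v v = (\<Sum>j\<in>UNIV. v $ j *\<^sub>R pd j h x)"
  by (simp add: jacobian_def matrix_works linear_frechet_derivative frechet_pd)

lemma lie_bracket_eq:
  assumes "g differentiable at x" "w differentiable at x"
  shows "lie_bracket g w x = (\<Sum>j\<in>UNIV. g x $ j *\<^sub>R pd j w x - w x $ j *\<^sub>R pd j g x)"
  unfolding lie_bracket_def using assms by (simp add: jacobian_mult sum_subtractf)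

lemma smooth_on_lie_bracket:
  assumes "open V" "smooth_on V g" "smooth_on V w"
  shows "smooth_on V (lie_bracket g w)"
proof (rule smooth_on_cong[OF assms(1)])
  show "smooth_on V (\<lambda>x. \<Sum>j\<in>UNIV. g x $ j *\<^sub>R pd j w x - w x $ j *\<^sub>R pd j g x)"
    using assms
    by (intro smooth_on_sum smooth_on_diff smooth_on_scaleR smooth_on_vec_nth smooth_on_pd) auto
qed (simp add: lie_bracket_eq smooth_on_differentiable[OF assms(2)] smooth_on_differentiable[OF assms(3)])

lemma smooth_on_ad: "open V \<Longrightarrow> smooth_on V g \<Longrightarrow> smooth_on V w \<Longrightarrow> smooth_on V (ad g k w)"
  by (induction k) (auto intro: smooth_on_lie_bracket)

lemma lie_bracket_cong:
  assumes "open V" "x \<in> V" "\<And>y. y \<in> V \<Longrightarrow> g y = g' y" "\<And>y. y \<in> V \<Longrightarrow> w y = w' y"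
  shows "lie_bracket g w x = lie_bracket g' w' x"
  unfolding lie_bracket_def jacobian_def
  using frechet_derivative_cong_open[OF assms(1,2), of g g']
    frechet_derivative_cong_open[OF assms(1,2), of w w'] assms by simp

lemma ad_cong:
  assumes "open V" "\<And>y. y \<in> V \<Longrightarrow> g y = g' y" "\<And>y. y \<in> V \<Longrightarrow> w y = w' y" "x \<in> V"
  shows "ad g k w x = ad g' k w' x"
  using assms(4)
proof (induction k arbitrary: x)
  case (Suc k)
  then show ?case using lie_bracket_cong[OF assms(1) _ assms(2)] by simp
qed (use assms in simp)

lemma jet1_cong:
  assumes "open V" "\<And>y. y \<in> V \<Longrightarrow> w y = w' y" "x \<in> V"
  shows "jet1 w x = jet1 w' x"
  unfolding jet1_def jacobian_def
  using frechet_derivative_cong_open[OF assms(1,3), of w w'] assms by simp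

section \<open>Differential polynomials\<close>

text \<open>These operators are closed under differentiation, hence express all components of
  iterated brackets and of their Jacobians, and they factor continuously through a jet of finite
  order. The first property feeds the second into openness.\<close>

inductive dpoly :: "((real^'n \<Rightarrow> 'b::euclidean_space) \<Rightarrow> real^'n \<Rightarrow> real) \<Rightarrow> bool"
  where
    dpoly_const: "dpoly (\<lambda>f x. c)"
  | dpoly_partials: "dpoly (\<lambda>f x. partials is f x \<bullet> e)"
  | dpoly_add: "dpoly D \<Longrightarrow> dpoly E \<Longrightarrow> dpoly (\<lambda>f x. D f x + E f x)"
  | dpoly_mult: "dpoly D \<Longrightarrow> dpoly E \<Longrightarrow> dpoly (\<lambda>f x. D f x * E f x)"

lemma dpoly_diff:
  assumes "dpoly D" "dpoly E" shows "dpoly (\<lambda>f x. D f x - E f x)"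
  using dpoly_add[OF assms(1) dpoly_mult[OF dpoly_const[of "-1"] assms(2)]] by simp

lemma dpoly_sum:
  assumes "finite C" "\<And>c. c \<in> C \<Longrightarrow> dpoly (E c)" shows "dpoly (\<lambda>f x. \<Sum>c\<in>C. E c f x)"
  using assms by (induction C rule: finite_induct) (auto intro: dpoly_const dpoly_add)

lemma smooth_on_dpoly:
  assumes "dpoly E" "open V" "smooth_on V f"
  shows "smooth_on V (E f)"
  using assms
proof (induction rule: dpoly.induct)
  case (dpoly_partials "is" e)
  then show ?case
    by (intro smooth_on_bounded_linear[OF _ bounded_linear_inner_left] smooth_on_partials)
qed (auto intro: smooth_on_const smooth_on_add smooth_on_mult)

lemma dpoly_pd:
  fixes E :: "(real^'n \<Rightarrow> 'b::euclidean_space) \<Rightarrow> real^'n \<Rightarrow> real"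
  assumes "dpoly E"
  shows "\<exists>E'. dpoly E' \<and> (\<forall>V f x. open V \<longrightarrow> smooth_on V f \<longrightarrow> x \<in> V \<longrightarrow> pd i (E f) x = E' f x)"
  using assms
proof (induction rule: dpoly.induct)
  case (dpoly_const c)
  show ?case
    by (rule exI[of _ "\<lambda>f x. 0"]) (simp add: dpoly.dpoly_const pd_const)
next
  case (dpoly_partials "is" e)
  show ?case
    using dpoly.dpoly_partials[of "i # is" e]
    by (intro exI[of _ "\<lambda>f x. partials (i # is) f x \<bullet> e"])
       (auto intro!: pd_bounded_linear bounded_linear_inner_left smooth_on_differentiable[OF smooth_on_partials])
next
  case (dpoly_add D E)
  then obtain D' E' where *: "dpoly D'" "dpoly E'"
    "\<And>V f x. open V \<Longrightarrow> smooth_on V f \<Longrightarrow> x \<in> V \<Longrightarrow> pd i (D f) x = D' f x"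
    "\<And>V f x. open V \<Longrightarrow> smooth_on V f \<Longrightarrow> x \<in> V \<Longrightarrow> pd i (E f) x = E' f x" by blast
  have "pd i (\<lambda>x. D f x + E f x) x = D' f x + E' f x" if "open V" "smooth_on V f" "x \<in> V" for V f x
    using pd_add[of "D f" x "E f" i] smooth_on_differentiable[OF smooth_on_dpoly[OF _ that(1,2)] that(3)]
      dpoly_add.hyps *(3,4)[OF that] by simp
  then show ?case
    using dpoly.dpoly_add[OF *(1,2)] by (intro exI[of _ "\<lambda>f x. D' f x + E' f x"]) blast
next
  case (dpoly_mult D E)
  then obtain D' E' where *: "dpoly D'" "dpoly E'"
    "\<And>V f x. open V \<Longrightarrow> smooth_on V f \<Longrightarrow> x \<in> V \<Longrightarrow> pd i (D f) x = D' f x"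
    "\<And>V f x. open V \<Longrightarrow> smooth_on V f \<Longrightarrow> x \<in> V \<Longrightarrow> pd i (E f) x = E' f x" by blast
  have "pd i (\<lambda>x. D f x * E f x) x = D f x * E' f x + D' f x * E f x"
    if "open V" "smooth_on V f" "x \<in> V" for V f x
    using pd_bilinear[OF bounded_bilinear_mult, of "D f" x "E f" i]
      smooth_on_differentiable[OF smooth_on_dpoly[OF _ that(1,2)] that(3)]
      dpoly_mult.hyps *(3,4)[OF that] by simp
  then show ?case
    using dpoly.dpoly_add[OF dpoly.dpoly_mult[OF dpoly_mult.hyps(1) *(2)] dpoly.dpoly_mult[OF *(1) dpoly_mult.hyps(2)]]
    by (intro exI[of _ "\<lambda>f x. D f x * E' f x + D' f x * E f x"]) blast
qed

text \<open>The factorisation is stated for all large \<open>l\<close>, so that finitely many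
  operators can share one jet order.\<close>

lemma dpoly_jet:
  assumes "dpoly E"
  shows "\<forall>\<^sub>F l in sequentially. \<exists>Q. continuous_on UNIV Q \<and> (\<forall>f x. E f x = Q (snd (jet l f x)))"
  using assms
proof (induction rule: dpoly.induct)
  case (dpoly_const c)
  have "\<exists>Q. continuous_on UNIV Q \<and> (\<forall>f x. c = Q (snd (jet l f x)))" for l
    by (rule exI[of _ "\<lambda>p. c"]) simp
  then show ?case by (intro always_eventually allI)
next
  case (dpoly_partials "is" e)
  have "\<exists>Q. continuous_on UNIV Q \<and> (\<forall>f x. partials is f x \<bullet> e = Q (snd (jet l f x)))"
    if "l \<ge> length is" for l
    using that
    by (intro exI[of _ "\<lambda>p. p is \<bullet> e"])
       (auto simp: jet_def intro!: continuous_on_inner continuous_on_const continuous_on_product_coordinates)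
  then show ?case unfolding eventually_sequentially by blast
next
  case (dpoly_add D E)
  from dpoly_add.IH show ?case
  proof eventually_elim
    case (elim l)
    then obtain P Q where *: "continuous_on UNIV P" "continuous_on UNIV Q"
      "\<And>f x. D f x = P (snd (jet l f x))" "\<And>f x. E f x = Q (snd (jet l f x))" by metis
    then show ?case
      by (intro exI[of _ "\<lambda>p. P p + Q p"]) (auto intro: continuous_on_add)
  qed
next
  case (dpoly_mult D E)
  from dpoly_mult.IH show ?case
  proof eventually_elim
    case (elim l)
    then obtain P Q where *: "continuous_on UNIV P" "continuous_on UNIV Q"
      "\<And>f x. D f x = P (snd (jet l f x))" "\<And>f x. E f x = Q (snd (jet l f x))" by metis
    then show ?case
      by (intro exI[of _ "\<lambda>p. P p * Q p"]) (auto intro: continuous_on_mult)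
  qed
qed

text \<open>Agreement with a differential polynomial is demanded only on open sets where
  \<open>f\<close> is smooth, because the expansion of a bracket by product rules needs
  differentiability.\<close>

definition is_dpoly ::
    "((real^'n \<Rightarrow> 'b::euclidean_space) \<Rightarrow> real^'n \<Rightarrow> 'c::euclidean_space) \<Rightarrow> bool"
  where "is_dpoly H \<longleftrightarrow> (\<forall>e. \<exists>E. dpoly E \<and>
    (\<forall>V f x. open V \<longrightarrow> smooth_on V f \<longrightarrow> x \<in> V \<longrightarrow> H f x \<bullet> e = E f x))"

lemma is_dpolyI:
  assumes "\<And>b. b \<in> Basis \<Longrightarrow> \<exists>E. dpoly E \<and>
    (\<forall>V f x. open V \<longrightarrow> smooth_on V f \<longrightarrow> x \<in> V \<longrightarrow> H f x \<bullet> b = E f x)"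
  shows "is_dpoly H"
  unfolding is_dpoly_def
proof
  fix e
  obtain E where E: "\<And>b. b \<in> Basis \<Longrightarrow> dpoly (E b)"
    "\<And>b V f x. b \<in> Basis \<Longrightarrow> open V \<Longrightarrow> smooth_on V f \<Longrightarrow> x \<in> V \<Longrightarrow> H f x \<bullet> b = E b f x"
    using assms by metis
  have "dpoly (\<lambda>f x. \<Sum>b\<in>Basis. E b f x * (e \<bullet> b))"
    using E(1) by (intro dpoly_sum dpoly_mult dpoly_const) auto
  moreover have "H f x \<bullet> e = (\<Sum>b\<in>Basis. E b f x * (e \<bullet> b))"
    if "open V" "smooth_on V f" "x \<in> V" for V f x
    using E(2)[OF _ that] by (subst euclidean_inner) simp
  ultimately show "\<exists>E. dpoly E \<and> (\<forall>V f x. open V \<longrightarrow> smooth_on V f \<longrightarrow> x \<in> V \<longrightarrow> H f x \<bullet> e = E f x)"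
    by blast
qed

lemma is_dpoly_lie_bracket:
  fixes G H :: "(real^'n \<Rightarrow> 'b::euclidean_space) \<Rightarrow> real^'n \<Rightarrow> real^'n"
  assumes "is_dpoly G" "is_dpoly H"
    and smooth: "\<And>V f. open V \<Longrightarrow> smooth_on V f \<Longrightarrow> smooth_on V (G f)"
      "\<And>V f. open V \<Longrightarrow> smooth_on V f \<Longrightarrow> smooth_on V (H f)"
  shows "is_dpoly (\<lambda>f. lie_bracket (G f) (H f))"
proof (rule is_dpolyI)
  have comp: "\<exists>E. dpoly E \<and> (\<forall>V f x. open V \<longrightarrow> smooth_on V f \<longrightarrow> x \<in> V \<longrightarrow> F f x \<bullet> e = E f x)"
    if "is_dpoly F" for F :: "(real^'n \<Rightarrow> 'b) \<Rightarrow> real^'n \<Rightarrow> real^'n" and e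
    using that unfolding is_dpoly_def by blast
  have comp_pd: "\<exists>E. dpoly E \<and> (\<forall>V f x. open V \<longrightarrow> smooth_on V f \<longrightarrow> x \<in> V \<longrightarrow> pd j (F f) x \<bullet> e = E f x)"
    if F: "is_dpoly F" "\<And>V f. open V \<Longrightarrow> smooth_on V f \<Longrightarrow> smooth_on V (F f)"
    for F :: "(real^'n \<Rightarrow> 'b) \<Rightarrow> real^'n \<Rightarrow> real^'n" and j e
  proof -
    obtain E where E: "dpoly E"
      "\<And>V f x. open V \<Longrightarrow> smooth_on V f \<Longrightarrow> x \<in> V \<Longrightarrow> F f x \<bullet> e = E f x"
      using comp[OF F(1)] by blast
    obtain E' where E': "dpoly E'"
      "\<And>V f x. open V \<Longrightarrow> smooth_on V f \<Longrightarrow> x \<in> V \<Longrightarrow> pd j (E f) x = E' f x"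
      using dpoly_pd[OF E(1)] by blast
    have "pd j (F f) x \<bullet> e = E' f x" if V: "open V" "smooth_on V f" "x \<in> V" for V f x
    proof -
      have "pd j (F f) x \<bullet> e = pd j (\<lambda>y. F f y \<bullet> e) x"
        using pd_bounded_linear[OF bounded_linear_inner_left smooth_on_differentiable[OF F(2)[OF V(1,2)] V(3)]]
        by simp
      also have "\<dots> = pd j (E f) x"
        using frechet_derivative_cong_open[OF V(1,3), of "\<lambda>y. F f y \<bullet> e" "E f"] E(2)[OF V(1,2)] by simp
      finally show ?thesis using E'(2)[OF V] by simp
    qed
    then show ?thesis using E'(1) by blast
  qed
  fix e :: "real^'n" assume "e \<in> Basis"
  have "\<exists>E. \<forall>j. dpoly (E j) \<and> (\<forall>V f x. open V \<longrightarrow> smooth_on V f \<longrightarrow> x \<in> V \<longrightarrow> G f x \<bullet> axis j 1 = E j f x)"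
    by (intro choice allI comp[OF assms(1)])
  then obtain G0 where G0: "\<And>j. dpoly (G0 j)"
    "\<And>j V f x. open V \<Longrightarrow> smooth_on V f \<Longrightarrow> x \<in> V \<Longrightarrow> G f x \<bullet> axis j 1 = G0 j f x" by blast
  have "\<exists>E. \<forall>j. dpoly (E j) \<and> (\<forall>V f x. open V \<longrightarrow> smooth_on V f \<longrightarrow> x \<in> V \<longrightarrow> H f x \<bullet> axis j 1 = E j f x)"
    by (intro choice allI comp[OF assms(2)])
  then obtain H0 where H0: "\<And>j. dpoly (H0 j)"
    "\<And>j V f x. open V \<Longrightarrow> smooth_on V f \<Longrightarrow> x \<in> V \<Longrightarrow> H f x \<bullet> axis j 1 = H0 j f x" by blast
  have "\<exists>E. \<forall>j. dpoly (E j) \<and> (\<forall>V f x. open V \<longrightarrow> smooth_on V f \<longrightarrow> x \<in> V \<longrightarrow> pd j (G f) x \<bullet> e = E j f x)"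
    by (intro choice allI comp_pd[OF assms(1) smooth(1)])
  then obtain G1 where G1: "\<And>j. dpoly (G1 j)"
    "\<And>j V f x. open V \<Longrightarrow> smooth_on V f \<Longrightarrow> x \<in> V \<Longrightarrow> pd j (G f) x \<bullet> e = G1 j f x" by blast
  have "\<exists>E. \<forall>j. dpoly (E j) \<and> (\<forall>V f x. open V \<longrightarrow> smooth_on V f \<longrightarrow> x \<in> V \<longrightarrow> pd j (H f) x \<bullet> e = E j f x)"
    by (intro choice allI comp_pd[OF assms(2) smooth(2)])
  then obtain H1 where H1: "\<And>j. dpoly (H1 j)"
    "\<And>j V f x. open V \<Longrightarrow> smooth_on V f \<Longrightarrow> x \<in> V \<Longrightarrow> pd j (H f) x \<bullet> e = H1 j f x" by blast
  have "dpoly (\<lambda>f x. \<Sum>j\<in>UNIV. G0 j f x * H1 j f x - H0 j f x * G1 j f x)"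
    by (intro dpoly_sum dpoly_diff dpoly_mult G0 G1 H0 H1) simp
  moreover have "lie_bracket (G f) (H f) x \<bullet> e = (\<Sum>j\<in>UNIV. G0 j f x * H1 j f x - H0 j f x * G1 j f x)"
    if V: "open V" "smooth_on V f" "x \<in> V" for V f x
    using lie_bracket_eq[OF smooth_on_differentiable[OF smooth(1)[OF V(1,2)] V(3)]
        smooth_on_differentiable[OF smooth(2)[OF V(1,2)] V(3)]]
      G0(2)[OF V] H0(2)[OF V] G1(2)[OF V] H1(2)[OF V]
    by (simp add: inner_sum_left inner_diff_left inner_axis)
  ultimately show "\<exists>E. dpoly E \<and> (\<forall>V f x. open V \<longrightarrow> smooth_on V f \<longrightarrow> x \<in> V \<longrightarrow>
      lie_bracket (G f) (H f) x \<bullet> e = E f x)" by blast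
qed

lemma is_dpoly_ad:
  fixes G H :: "(real^'n \<Rightarrow> 'b::euclidean_space) \<Rightarrow> real^'n \<Rightarrow> real^'n"
  assumes "is_dpoly G" "is_dpoly H"
    and "\<And>V f. open V \<Longrightarrow> smooth_on V f \<Longrightarrow> smooth_on V (G f)"
      "\<And>V f. open V \<Longrightarrow> smooth_on V f \<Longrightarrow> smooth_on V (H f)"
  shows "is_dpoly (\<lambda>f. ad (G f) k (H f))"
  using assms(2-)
proof (induction k)
  case (Suc k)
  then show ?case
    using is_dpoly_lie_bracket[OF assms(1) Suc.IH[OF assms(2,3,4)] assms(3) smooth_on_ad] assms(3,4) by simp
qed simp

lemma is_dpoly_bounded_linear:
  assumes "bounded_linear L"
  shows "is_dpoly (\<lambda>f x. L (f x))"
proof (rule is_dpolyI)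
  fix e
  \<comment> \<open>The adjoint moves \<open>L\<close> onto the test vector, so that each component
    is a single generator with empty derivative list.\<close>
  have "L y \<bullet> e = y \<bullet> adjoint L e" for y
    using adjoint_works[OF bounded_linear.linear[OF assms]] by simp
  then show "\<exists>E. dpoly E \<and> (\<forall>V f x. open V \<longrightarrow> smooth_on V f \<longrightarrow> x \<in> V \<longrightarrow> L (f x) \<bullet> e = E f x)"
    using dpoly_partials[of "[]" "adjoint L e"] by auto
qed

lemma is_dpoly_jet1:
  fixes H :: "(real^'n \<Rightarrow> 'b::euclidean_space) \<Rightarrow> real^'n \<Rightarrow> real^'n"
  assumes "is_dpoly H" "\<And>V f. open V \<Longrightarrow> smooth_on V f \<Longrightarrow> smooth_on V (H f)"
  shows "is_dpoly (\<lambda>f. jet1 (H f))"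
proof (rule is_dpolyI)
  fix e :: "(real^'n) \<times> (real^'n^'n)" assume "e \<in> Basis"
  have comp: "\<exists>E. dpoly E \<and> (\<forall>V f x. open V \<longrightarrow> smooth_on V f \<longrightarrow> x \<in> V \<longrightarrow> H f x \<bullet> e = E f x)" for e
    using assms(1) unfolding is_dpoly_def by blast
  consider (val) b where "e = (b, 0)" | (der) c j where "e = (0, axis c (axis j 1))"
    using \<open>e \<in> Basis\<close> by (auto simp: Basis_prod_def Basis_vec_def)
  then show "\<exists>E. dpoly E \<and> (\<forall>V f x. open V \<longrightarrow> smooth_on V f \<longrightarrow> x \<in> V \<longrightarrow> jet1 (H f) x \<bullet> e = E f x)"
  proof cases
    case val
    then show ?thesis using comp[of b] by (simp add: jet1_def)
  next
    case der
    obtain E where E: "dpoly E"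
      "\<And>V f x. open V \<Longrightarrow> smooth_on V f \<Longrightarrow> x \<in> V \<Longrightarrow> H f x \<bullet> axis c 1 = E f x"
      using comp by blast
    obtain E' where E': "dpoly E'"
      "\<And>V f x. open V \<Longrightarrow> smooth_on V f \<Longrightarrow> x \<in> V \<Longrightarrow> pd j (E f) x = E' f x"
      using dpoly_pd[OF E(1)] by blast
    have "jet1 (H f) x \<bullet> e = E' f x" if V: "open V" "smooth_on V f" "x \<in> V" for V f x
    proof -
      have "jet1 (H f) x \<bullet> e = pd j (H f) x $ c"
        using der by (simp add: jet1_def inner_axis jacobian_nth)
      also have "\<dots> = pd j (\<lambda>y. H f y $ c) x"
        using pd_bounded_linear[OF bounded_linear_vec_nth smooth_on_differentiable[OF assms(2)[OF V(1,2)] V(3)]]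
        by simp
      also have "\<dots> = pd j (E f) x"
        using frechet_derivative_cong_open[OF V(1,3), of "\<lambda>y. H f y $ c" "E f"] E(2)[OF V(1,2)]
        by (simp add: inner_axis)
      finally show ?thesis using E'(2)[OF V] by simp
    qed
    then show ?thesis using E'(1) by blast
  qed
qed

lemma is_dpoly_jet:
  fixes H :: "(real^'n \<Rightarrow> 'b::euclidean_space) \<Rightarrow> real^'n \<Rightarrow> 'c::euclidean_space"
  assumes "is_dpoly H"
  shows "\<forall>\<^sub>F l in sequentially. \<exists>Q. continuous_on UNIV Q \<and>
    (\<forall>V f x. open V \<longrightarrow> smooth_on V f \<longrightarrow> x \<in> V \<longrightarrow> H f x = Q (snd (jet l f x)))"
proof -
  obtain E where E: "\<And>b. dpoly (E b)"
    "\<And>b V f x. open V \<Longrightarrow> smooth_on V f \<Longrightarrow> x \<in> V \<Longrightarrow> H f x \<bullet> b = E b f x"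
    using assms unfolding is_dpoly_def by metis
  have "\<forall>\<^sub>F l in sequentially. \<forall>b\<in>Basis. \<exists>Q. continuous_on UNIV Q \<and> (\<forall>f x. E b f x = Q (snd (jet l f x)))"
    by (intro eventually_ball_finite) (auto intro: dpoly_jet E(1))
  then show ?thesis
  proof eventually_elim
    case (elim l)
    then obtain Q where Q: "\<And>b. b \<in> Basis \<Longrightarrow> continuous_on UNIV (Q b)"
      "\<And>b f x. b \<in> Basis \<Longrightarrow> E b f x = Q b (snd (jet l f x))" by metis
    have "continuous_on UNIV (\<lambda>p. \<Sum>b\<in>Basis. Q b p *\<^sub>R b)"
      using Q(1) by (intro continuous_on_sum continuous_on_scaleR continuous_on_const) auto
    moreover have "H f x = (\<Sum>b\<in>Basis. Q b (snd (jet l f x)) *\<^sub>R b)"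
      if "open V" "smooth_on V f" "x \<in> V" for V f x
      using E(2)[OF that] Q(2) euclidean_representation[of "H f x"] by simp
    ultimately show ?case by blast
  qed
qed

section \<open>Spanning as an open condition\<close>

lemma span_eq_UNIV_iff:
  fixes v :: "'k \<Rightarrow> 'e::euclidean_space"
  shows "span (range v) = UNIV \<longleftrightarrow> (\<forall>u\<in>sphere 0 1. \<exists>k. v k \<bullet> u \<noteq> 0)"
proof
  assume s: "span (range v) = UNIV"
  show "\<forall>u\<in>sphere 0 1. \<exists>k. v k \<bullet> u \<noteq> 0"
  proof (rule ccontr)
    assume "\<not> ?thesis"
    then obtain u where u: "norm u = 1" "\<And>k. v k \<bullet> u = 0" by auto
    have "orthogonal u y" if "y \<in> span (range v)" for y
      using orthogonal_to_span[OF that] u(2) by (auto simp: orthogonal_def inner_commute)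
    then have "u \<bullet> u = 0" using s by (auto simp: orthogonal_def)
    then show False using u(1) by simp
  qed
next
  assume r: "\<forall>u\<in>sphere 0 1. \<exists>k. v k \<bullet> u \<noteq> 0"
  show "span (range v) = UNIV"
  proof (rule ccontr)
    assume "span (range v) \<noteq> UNIV"
    then obtain a where a: "a \<noteq> 0" "\<And>y. y \<in> span (range v) \<Longrightarrow> a \<bullet> y = 0"
      using span_not_univ_subset_hyperplane[of "range v"] by blast
    then have "a \<bullet> v k = 0" for k
      by (simp add: span_base)
    then have "v k \<bullet> (a /\<^sub>R norm a) = 0" for k
      by (simp add: inner_commute[of "v k"])
    moreover have "a /\<^sub>R norm a \<in> sphere 0 1" using a(1) by simp
    ultimately show False using r by blast
  qed
qed

text \<open>A family fails to span iff some unit vector is orthogonal to all of it. The failing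
  families are thus the projection of a closed set along the compact unit sphere, and such a
  projection is closed.\<close>

lemma open_spanning:
  "open {A :: 'e::euclidean_space^'k. span (range (($) A)) = UNIV}"
proof -
  have "closed {z :: 'e \<times> ('e^'k). \<forall>k. snd z $ k \<bullet> fst z = 0}"
    by (intro closed_Collect_all closed_Collect_eq continuous_intros)
  then have "closed {A :: 'e^'k. \<exists>u. u \<in> sphere 0 1 \<and> (u, A) \<in> {z. \<forall>k. snd z $ k \<bullet> fst z = 0}}"
    by (intro closed_compact_projection) simp_all
  moreover have "{A :: 'e^'k. span (range (($) A)) = UNIV} =
      - {A. \<exists>u. u \<in> sphere 0 1 \<and> (u, A) \<in> {z. \<forall>k. snd z $ k \<bullet> fst z = 0}}"
    by (auto simp: span_eq_UNIV_iff)
  ultimately show ?thesis by (simp add: open_Compl)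
qed

section \<open>Openness and neighbourhoods in the Whitney topology\<close>

definition drift :: "(real^'n \<Rightarrow> real^('u::finite) option^'n) \<Rightarrow> real^'n \<Rightarrow> real^'n"
  where "drift f = (\<lambda>x. column None (f x))"

definition shifted :: "'u \<Rightarrow> (real^'n \<Rightarrow> real^('u::finite) option^'n) \<Rightarrow> real^'n \<Rightarrow> real^'n"
  where "shifted i f = (\<lambda>x. column None (f x) + column (Some i) (f x))"

definition bracket_jets ::
    "(real^'n \<Rightarrow> real^'n) \<Rightarrow> (real^'n \<Rightarrow> real^'n) \<Rightarrow> nat \<Rightarrow> real^'n \<Rightarrow> ((real^'n) \<times> (real^'n^'n)) set"
  where "bracket_jets g w K x = (\<lambda>k. jet1 (ad g k w) x) ` {1..K}"

definition spanning :: "'u \<Rightarrow> nat \<Rightarrow> (real^'n \<Rightarrow> real^('u::finite) option^'n) \<Rightarrow> real^'n \<Rightarrow> bool"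
  where "spanning i K f x \<longleftrightarrow>
    span (bracket_jets (drift f) (shifted i f) K x \<union> bracket_jets (shifted i f) (drift f) K x) = UNIV"

lemma bounded_linear_column: "bounded_linear (\<lambda>A. column j A :: real^'n)"
  unfolding column_def linear_conv_bounded_linear[symmetric]
  by (rule linearI) (simp_all add: vec_eq_iff)

lemma bounded_linear_shifted: "bounded_linear (\<lambda>A. column None A + column (Some i) A :: real^'n)"
  by (intro bounded_linear_add bounded_linear_column)

lemma smooth_on_drift: "open V \<Longrightarrow> smooth_on V f \<Longrightarrow> smooth_on V (drift f)"
  unfolding drift_def by (rule smooth_on_bounded_linear[OF _ bounded_linear_column])

lemma smooth_on_shifted: "open V \<Longrightarrow> smooth_on V f \<Longrightarrow> smooth_on V (shifted i f)"
  unfolding shifted_def by (rule smooth_on_bounded_linear[OF _ bounded_linear_shifted])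

lemma is_dpoly_drift: "is_dpoly drift"
  using is_dpoly_bounded_linear[OF bounded_linear_column[of None]] by (simp add: drift_def[abs_def])

lemma is_dpoly_shifted: "is_dpoly (shifted i)"
  using is_dpoly_bounded_linear[OF bounded_linear_shifted[of i]] by (simp add: shifted_def[abs_def])

text \<open>The number of brackets is the cardinality of a type, so that the 1-jets of both families
  form one vector indexed by \<open>'k \<times> bool\<close>. This vector is a continuous function
  of a jet of \<open>f\<close>, and \<open>open_spanning\<close> pulls back along it.\<close>

lemma openin_whitney_spanning:
  fixes V :: "(real^'n) set" and i :: "'u::finite"
  assumes "open V"
  shows "openin (whitney_topology V) {f \<in> smooth_maps V. \<forall>x\<in>V. spanning i CARD('k::finite) f x}"
proof -
  obtain e :: "'k \<Rightarrow> nat" where e: "bij_betw e UNIV {1..CARD('k)}"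
    using finite_same_card_bij[of "UNIV :: 'k set" "{1..CARD('k)}"] by auto
  define v where "v z f = (if snd z then jet1 (ad (drift f) (e (fst z)) (shifted i f))
    else jet1 (ad (shifted i f) (e (fst z)) (drift f)))"
    for z :: "'k \<times> bool" and f :: "real^'n \<Rightarrow> real^'u option^'n"
  have spanning_v: "spanning i CARD('k) f x \<longleftrightarrow> span (range (\<lambda>z. v z f x)) = UNIV" for f x
  proof -
    have "range (\<lambda>z. v z f x) = (\<lambda>k. jet1 (ad (drift f) k (shifted i f)) x) ` range e
        \<union> (\<lambda>k. jet1 (ad (shifted i f) k (drift f)) x) ` range e"
      unfolding v_def by (auto simp: image_def)
    then show ?thesis
      using e by (simp add: spanning_def bracket_jets_def bij_betw_def)
  qed
  have dp: "is_dpoly (v z)" for z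
  proof (cases "snd z")
    case True
    then have "v z = (\<lambda>f. jet1 (ad (drift f) (e (fst z)) (shifted i f)))" by (simp add: v_def fun_eq_iff)
    then show ?thesis
      by (simp add: is_dpoly_jet1 is_dpoly_ad is_dpoly_drift is_dpoly_shifted smooth_on_drift
          smooth_on_shifted smooth_on_ad)
  next
    case False
    then have "v z = (\<lambda>f. jet1 (ad (shifted i f) (e (fst z)) (drift f)))" by (simp add: v_def fun_eq_iff)
    then show ?thesis
      by (simp add: is_dpoly_jet1 is_dpoly_ad is_dpoly_drift is_dpoly_shifted smooth_on_drift
          smooth_on_shifted smooth_on_ad)
  qed
  have "\<forall>\<^sub>F l in sequentially. \<forall>z\<in>UNIV. \<exists>Q. continuous_on UNIV Q \<and>
      (\<forall>V f x. open V \<longrightarrow> smooth_on V f \<longrightarrow> x \<in> V \<longrightarrow> v z f x = Q (snd (jet l f x)))"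
    by (rule eventually_ball_finite[OF finite_class.finite_UNIV]) (intro ballI is_dpoly_jet dp)
  then obtain l where "\<forall>z. \<exists>Q. continuous_on UNIV Q \<and>
      (\<forall>V f x. open V \<longrightarrow> smooth_on V f \<longrightarrow> x \<in> V \<longrightarrow> v z f x = Q (snd (jet l f x)))"
    unfolding eventually_sequentially by blast
  from choice[OF this] obtain Q where Q: "\<And>z. continuous_on UNIV (Q z)"
      "\<And>z V f x. open V \<Longrightarrow> smooth_on V f \<Longrightarrow> x \<in> V \<Longrightarrow> v z f x = Q z (snd (jet l f x))"
    by blast
  define W where "W = {y \<in> jet_bundle l V. span (range (\<lambda>z. Q z (snd y))) = UNIV}"
  have "continuous_on UNIV (\<lambda>y :: (real^'n) \<times> ('n list \<Rightarrow> real^'u option^'n). \<chi> z. Q z (snd y))"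
    by (rule continuous_on_vec_lambda)
      (rule continuous_on_compose2[OF Q(1) continuous_on_snd[OF continuous_on_id] subset_UNIV])
  then have "open ((\<lambda>y :: (real^'n) \<times> ('n list \<Rightarrow> real^'u option^'n). \<chi> z. Q z (snd y)) -`
      {A :: ((real^'n) \<times> (real^'n^'n))^('k \<times> bool). span (range (($) A)) = UNIV})"
    by (rule open_vimage[OF open_spanning])
  moreover have "W = jet_bundle l V \<inter> ((\<lambda>y. \<chi> z. Q z (snd y)) -`
      {A :: ((real^'n) \<times> (real^'n^'n))^('k \<times> bool). span (range (($) A)) = UNIV})"
    by (simp add: W_def vec_lambda_inverse Int_def vimage_def)
  ultimately have "openin (top_of_set (jet_bundle l V)) W"
    by (simp add: openin_open_Int)
  then have "openin (whitney_topology V) {h \<in> smooth_maps V. jet l h ` V \<subseteq> W}"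
    unfolding whitney_topology_def openin_topology_generated_by_iff
    by (intro generate_topology_on.Basis) blast
  moreover have "jet l f x \<in> W \<longleftrightarrow> spanning i CARD('k) f x" if "f \<in> smooth_maps V" "x \<in> V" for f x
  proof -
    have f: "smooth_on V f" using that(1) by (simp add: smooth_maps_def)
    have eq: "(\<lambda>z. v z f x) = (\<lambda>z. Q z (snd (jet l f x)))"
      using Q(2)[OF assms f that(2)] by blast
    show ?thesis
      unfolding W_def spanning_v eq using jet_in_bundle[OF assms f that(2), of l] by blast
  qed
  then have "{h \<in> smooth_maps V. jet l h ` V \<subseteq> W}
      = {f \<in> smooth_maps V. \<forall>x\<in>V. spanning i CARD('k) f x}"
    by blast
  ultimately show ?thesis by simp
qed

text \<open>Lower bounds of this kind replace continuous positive functions, as they arise from \<open>Sup\<close> without any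
  regularity.\<close>

definition loc_pos :: "(real^'n) set \<Rightarrow> (real^'n \<Rightarrow> real) \<Rightarrow> bool"
  where "loc_pos V \<eta> \<longleftrightarrow> (\<forall>x\<in>V. \<exists>r>0. \<exists>e>0. ball x r \<subseteq> V \<and> (\<forall>y\<in>ball x r. e \<le> \<eta> y))"

lemma loc_pos_pos: "loc_pos V \<eta> \<Longrightarrow> x \<in> V \<Longrightarrow> 0 < \<eta> x"
  unfolding loc_pos_def by (meson centre_in_ball less_le_trans)

lemma loc_pos_min:
  assumes "loc_pos V \<eta>" "loc_pos V \<zeta>"
  shows "loc_pos V (\<lambda>x. min (\<eta> x) (\<zeta> x))"
  unfolding loc_pos_def
proof
  fix x assume "x \<in> V"
  obtain r e where *: "r > 0" "e > 0" "ball x r \<subseteq> V" "\<forall>y\<in>ball x r. e \<le> \<eta> y"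
    using assms(1) \<open>x \<in> V\<close> unfolding loc_pos_def by blast
  moreover obtain s d where "s > 0" "d > 0" "\<forall>y\<in>ball x s. d \<le> \<zeta> y"
    using assms(2) \<open>x \<in> V\<close> unfolding loc_pos_def by blast
  ultimately show "\<exists>r>0. \<exists>e>0. ball x r \<subseteq> V \<and> (\<forall>y\<in>ball x r. e \<le> min (\<eta> y) (\<zeta> y))"
    by (intro exI[of _ "min r s"] conjI exI[of _ "min e d"]) (auto simp: min_le_iff_disj)
qed

lemma loc_pos_cmult:
  assumes "loc_pos V \<eta>" "c > 0"
  shows "loc_pos V (\<lambda>x. \<eta> x * c)"
  unfolding loc_pos_def
proof
  fix x assume "x \<in> V"
  then obtain r e where *: "r > 0" "e > 0" "ball x r \<subseteq> V" "\<forall>y\<in>ball x r. e \<le> \<eta> y"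
    using assms(1) unfolding loc_pos_def by blast
  then show "\<exists>r>0. \<exists>e>0. ball x r \<subseteq> V \<and> (\<forall>y\<in>ball x r. e \<le> \<eta> y * c)"
    using assms(2) by (intro exI[of _ r] conjI exI[of _ "e * c"]) auto
qed

lemma open_fun_contains_box:
  fixes U :: "('i \<Rightarrow> 'b::metric_space) set"
  assumes "open U" "p \<in> U"
  shows "\<exists>I e. finite I \<and> e > 0 \<and> (\<forall>q. (\<forall>i\<in>I. dist (q i) (p i) < e) \<longrightarrow> q \<in> U)"
proof -
  obtain X where X: "p \<in> (\<Pi>\<^sub>E i\<in>UNIV. X i)" "\<And>i. open (X i)" "finite {i. X i \<noteq> UNIV}"
    "(\<Pi>\<^sub>E i\<in>UNIV. X i) \<subseteq> U"
    using product_topology_open_contains_basis[of "\<lambda>i. euclidean" UNIV U p] assms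
    by (auto simp: open_fun_def)
  have "\<exists>e>0. ball (p i) e \<subseteq> X i" for i
    using X(1) X(2)[of i] open_contains_ball[of "X i"] by (auto simp: PiE_def)
  then obtain d where d: "\<And>i. d i > 0" "\<And>i. ball (p i) (d i) \<subseteq> X i" by metis
  define I where "I = {i. X i \<noteq> UNIV}"
  define e where "e = Min (insert 1 (d ` I))"
  have fin: "finite (insert 1 (d ` I))" using X(3) by (simp add: I_def)
  show ?thesis
  proof (intro exI conjI allI impI)
    show "finite I" using X(3) by (simp add: I_def)
    show "e > 0" using fin d(1) by (auto simp: e_def Min_gr_iff)
    fix q assume q: "\<forall>i\<in>I. dist (q i) (p i) < e"
    have "q i \<in> X i" for i
    proof (cases "i \<in> I")
      case True
      then have "e \<le> d i" unfolding e_def using fin by (intro Min_le) auto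
      then have "q i \<in> ball (p i) (d i)" using q True by (auto simp: dist_commute intro: less_le_trans)
      then show ?thesis using d(2) by blast
    qed (simp add: I_def)
    then show "q \<in> U" using X(4) by (auto simp: PiE_def)
  qed
qed

text \<open>A neighbourhood of a jet constrains finitely many entries up to some \<open>d\<close>.
  Half of \<open>d\<close> absorbs the variation of the partials of \<open>f\<close> over a small
  ball, and the other half remains as a tolerance valid at every point of that ball. Entries beyond
  order \<open>l\<close> vanish on both sides.\<close>

lemma jet_nbhd:
  fixes f :: "real^'n \<Rightarrow> 'b::euclidean_space"
  assumes "open V" "smooth_on V f" "openin (top_of_set (jet_bundle l V)) W" "jet l f x \<in> W" "x \<in> V"
  obtains r e where "r > 0" "0 < e" "e \<le> 1" "ball x r \<subseteq> V"
    "\<And>y p. y \<in> ball x r \<Longrightarrow> (y, p) \<in> jet_bundle l V \<Longrightarrow>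
      (\<And>is. length is \<le> l \<Longrightarrow> norm (p is - partials is f y) < e) \<Longrightarrow> (y, p) \<in> W"
proof -
  obtain U where U: "open U" "W = jet_bundle l V \<inter> U"
    using assms(3) by (auto simp: openin_open)
  define p0 where "p0 = snd (jet l f x)"
  have "(x, p0) \<in> U" using assms(4) U by (simp add: p0_def jet_def)
  then obtain A B where AB: "open A" "open B" "x \<in> A" "p0 \<in> B" "A \<times> B \<subseteq> U"
    using U(1) by (auto elim: open_prod_elim)
  obtain I d where I: "finite I" "d > 0" "\<forall>q. (\<forall>is\<in>I. dist (q is) (p0 is) < d) \<longrightarrow> q \<in> B"
    using open_fun_contains_box[OF AB(2,4)] by blast
  have "\<forall>\<^sub>F y in nhds x. dist (partials is f y) (partials is f x) < d / 2" for "is"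
  proof -
    have "isCont (partials is f) x"
      using smooth_on_continuous[OF smooth_on_partials[OF assms(2)]] assms(1,5)
        continuous_on_eq_continuous_at by blast
    then have "(partials is f \<longlongrightarrow> partials is f x) (nhds x)"
      by (simp add: isCont_def tendsto_at_iff_tendsto_nhds)
    then show ?thesis using I(2) by (intro tendstoD) simp_all
  qed
  then have "\<forall>\<^sub>F y in nhds x. \<forall>is\<in>I. dist (partials is f y) (partials is f x) < d / 2"
    by (intro eventually_ball_finite I(1)) blast
  moreover have "\<forall>\<^sub>F y in nhds x. y \<in> A \<inter> V"
    using AB assms by (intro eventually_nhds_in_open) auto
  ultimately have "\<forall>\<^sub>F y in nhds x. y \<in> A \<inter> V \<and> (\<forall>is\<in>I. dist (partials is f y) (partials is f x) < d / 2)"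
    by eventually_elim blast
  then obtain r where r: "r > 0" "\<And>y. y \<in> ball x r \<Longrightarrow> y \<in> A" "\<And>y. y \<in> ball x r \<Longrightarrow> y \<in> V"
    "\<And>y is. y \<in> ball x r \<Longrightarrow> is \<in> I \<Longrightarrow> dist (partials is f y) (partials is f x) < d / 2"
    unfolding eventually_nhds_metric mem_ball dist_commute[of x] by blast
  show ?thesis
  proof
    show "r > 0" "0 < min 1 (d / 2)" "min 1 (d / 2) \<le> 1" using r(1) I(2) by simp_all
    show "ball x r \<subseteq> V" using r(3) by blast
    fix y p assume y: "y \<in> ball x r" "(y, p) \<in> jet_bundle l V"
      and close: "\<And>is. length is \<le> l \<Longrightarrow> norm (p is - partials is f y) < min 1 (d / 2)"
    have "dist (p is) (p0 is) < d" if "is \<in> I" for "is"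
    proof (cases "length is \<le> l")
      case True
      then have "dist (p is) (partials is f y) < d / 2"
        using close[OF True] by (simp add: dist_norm)
      then have "dist (p is) (partials is f x) < d"
        using r(4)[OF y(1) that] dist_triangle[of "p is" "partials is f x" "partials is f y"] by linarith
      then show ?thesis using True by (simp add: p0_def jet_def)
    next
      case False
      moreover have "\<forall>is. length is > l \<longrightarrow> p is = 0"
        using y(2) unfolding jet_bundle_def mem_Collect_eq prod.case by (elim conjE)
      ultimately have "p is = 0" by (simp add: not_le)
      then show ?thesis using \<open>\<not> length is \<le> l\<close> I(2) by (simp add: p0_def jet_def)
    qed
    then have "p \<in> B" using I(3) by blast
    then show "(y, p) \<in> W" using U(2) y(2) AB(5) r(2)[OF y(1)] by blast
  qed
qed

text \<open>Only the generating sets need work; intersections take the larger order and the smaller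
  tolerance. For a generating set, \<open>\<eta>\<close> is built from the supremum of all
  admissible tolerances over a point, and \<open>jet_nbhd\<close> bounds this supremum from below
  locally.\<close>

lemma whitney_nbhd:
  fixes f :: "real^'n \<Rightarrow> 'b::euclidean_space"
  assumes "open V" "f \<in> smooth_maps V" "openin (whitney_topology V) T" "f \<in> T"
  obtains L \<eta> where "loc_pos V \<eta>"
    "\<And>h. h \<in> smooth_maps V \<Longrightarrow>
      (\<And>x is. x \<in> V \<Longrightarrow> length is \<le> L \<Longrightarrow> norm (partials is h x - partials is f x) < \<eta> x) \<Longrightarrow> h \<in> T"
proof -
  have "\<exists>L \<eta>. loc_pos V \<eta> \<and> (\<forall>h. h \<in> smooth_maps V \<longrightarrow>
      (\<forall>x is. x \<in> V \<longrightarrow> length is \<le> L \<longrightarrow> norm (partials is h x - partials is f x) < \<eta> x) \<longrightarrow> h \<in> T)"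
    using assms(3,4) unfolding whitney_topology_def openin_topology_generated_by_iff
  proof (induction rule: generate_topology_on.induct)
    case (Int a b)
    then obtain L1 \<eta>1 L2 \<eta>2 where *: "loc_pos V \<eta>1" "loc_pos V \<eta>2"
      "\<forall>h. h \<in> smooth_maps V \<longrightarrow> (\<forall>x is. x \<in> V \<longrightarrow> length is \<le> L1 \<longrightarrow> norm (partials is h x - partials is f x) < \<eta>1 x) \<longrightarrow> h \<in> a"
      "\<forall>h. h \<in> smooth_maps V \<longrightarrow> (\<forall>x is. x \<in> V \<longrightarrow> length is \<le> L2 \<longrightarrow> norm (partials is h x - partials is f x) < \<eta>2 x) \<longrightarrow> h \<in> b"
      by auto
    show ?case
      using *(3,4)
      by (intro exI[of _ "max L1 L2"] exI[of _ "\<lambda>x. min (\<eta>1 x) (\<eta>2 x)"] conjI loc_pos_min *(1,2)) simp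
  next
    case (UN K)
    then obtain k where k: "k \<in> K" "f \<in> k" by blast
    show ?case
      using UN.IH[OF k] by (elim ex_forward conj_forward all_forward imp_forward) (use k(1) in auto)
  next
    case (Basis s)
    then obtain l W where W: "s = {h \<in> smooth_maps V. jet l h ` V \<subseteq> W}"
      "openin (top_of_set (jet_bundle l V)) W" by blast
    have f: "smooth_on V f" using assms(2) by (simp add: smooth_maps_def)
    define R where "R y e \<longleftrightarrow> (\<forall>p. (y, p) \<in> jet_bundle l V \<longrightarrow>
      (\<forall>is. length is \<le> l \<longrightarrow> norm (p is - partials is f y) < e) \<longrightarrow> (y, p) \<in> W)" for y e
    \<comment> \<open>The cap by 1 keeps the supremum finite when \<open>W\<close> contains the
      whole fibre over \<open>y\<close>.\<close>
    define \<eta> where "\<eta> y = Sup {e. e \<le> 1 \<and> R y e}" for y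
    have bdd: "bdd_above {e. e \<le> 1 \<and> R y e}" for y by (rule bdd_aboveI[of _ 1]) simp
    have "loc_pos V \<eta>"
      unfolding loc_pos_def
    proof
      fix x assume x: "x \<in> V"
      then have "jet l f x \<in> W" using Basis W by blast
      then obtain r e where "r > 0" "0 < e" "e \<le> 1" "ball x r \<subseteq> V" "\<And>y. y \<in> ball x r \<Longrightarrow> R y e"
        using jet_nbhd[OF assms(1) f W(2) _ x, of thesis] unfolding R_def by blast
      then show "\<exists>r>0. \<exists>e>0. ball x r \<subseteq> V \<and> (\<forall>y\<in>ball x r. e \<le> \<eta> y)"
        unfolding \<eta>_def by (intro exI[of _ r] exI[of _ e] conjI ballI cSup_upper bdd) auto
    qed
    \<comment> \<open>The supremum need not be admissible itself; half of it lies strictly below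
      some admissible \<open>e\<close>.\<close>
    moreover have "h \<in> s" if h: "h \<in> smooth_maps V"
      "\<And>x is. x \<in> V \<Longrightarrow> length is \<le> l \<Longrightarrow> norm (partials is h x - partials is f x) < \<eta> x * (1/2)" for h
    proof -
      have "jet l h x \<in> W" if x: "x \<in> V" for x
      proof -
        have pos: "\<eta> x > 0" using loc_pos_pos[OF \<open>loc_pos V \<eta>\<close> x] .
        then have "\<eta> x / 2 < Sup {e. e \<le> 1 \<and> R x e}" by (simp add: \<eta>_def)
        \<comment> \<open>The tolerance 0 is always admissible, vacuously: no norm is below 0, and
          the empty list already provides a constraint.\<close>
        moreover have "{e. e \<le> 1 \<and> R x e} \<noteq> {}"
        proof -
          have "R x 0" unfolding R_def by (metis le0 list.size(3) norm_not_less_zero)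
          then show ?thesis by (metis (mono_tags, lifting) empty_iff mem_Collect_eq zero_le_one)
        qed
        ultimately obtain e where e: "\<eta> x / 2 < e" "R x e"
          using less_cSupE by blast
        have "(x, snd (jet l h x)) \<in> jet_bundle l V"
          using jet_in_bundle[OF assms(1) _ x, of h l] h(1) by (simp add: smooth_maps_def jet_def)
        moreover have "norm (snd (jet l h x) is - partials is f x) < e" if "length is \<le> l" for "is"
          using h(2)[OF x that] e(1) that by (simp add: jet_def)
        ultimately have "(x, snd (jet l h x)) \<in> W" using e(2) unfolding R_def by blast
        then show ?thesis by (simp add: jet_def)
      qed
      then show ?thesis using h(1) W(1) by blast
    qed
    ultimately show ?case
      using loc_pos_cmult[of V \<eta> "1/2"]
      by (intro exI[of _ l] exI[of _ "\<lambda>x. \<eta> x * (1/2)"]) simp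
  qed simp
  then show ?thesis using that by blast
qed

section \<open>Negligible sets of parameters\<close>

lemma differentiable_sum':
  "(\<And>i. i \<in> I \<Longrightarrow> f i differentiable F) \<Longrightarrow> (\<lambda>x. \<Sum>i\<in>I. f i x) differentiable F"
  by (induction I rule: infinite_finite_induct) auto

lemma differentiable_prod':
  fixes f :: "'i \<Rightarrow> 'a::real_normed_vector \<Rightarrow> real"
  shows "(\<And>i. i \<in> I \<Longrightarrow> f i differentiable (at x within S)) \<Longrightarrow>
    (\<lambda>x. \<Prod>i\<in>I. f i x) differentiable (at x within S)"
  by (induction I rule: infinite_finite_induct) auto

lemma differentiable_det:
  fixes M :: "'a::real_normed_vector \<Rightarrow> real^'k^'k"
  assumes "\<And>i j. (\<lambda>x. M x $ i $ j) differentiable (at x within S)"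
  shows "(\<lambda>x. det (M x)) differentiable (at x within S)"
  unfolding det_def
  by (intro differentiable_sum' differentiable_mult differentiable_prod' differentiable_const assms)

lemma differentiable_vecI:
  fixes f :: "'a::real_normed_vector \<Rightarrow> 'b::euclidean_space^'k"
  assumes "\<And>i. (\<lambda>x. f x $ i) differentiable (at x within S)"
  shows "f differentiable (at x within S)"
proof (subst differentiable_componentwise_within, rule ballI)
  fix e :: "'b^'k" assume "e \<in> Basis"
  then obtain i b where "e = axis i b" by (auto simp: Basis_vec_def)
  then have "(\<lambda>x. f x \<bullet> e) = (\<lambda>x. f x $ i \<bullet> b)" by (simp add: inner_axis)
  then show "(\<lambda>x. f x \<bullet> e) differentiable at x within S"
    using differentiable_inner[OF assms[of i] differentiable_const[of b]] by simp
qed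

lemma differentiable_apply_linear:
  fixes A :: "'x::real_normed_vector \<Rightarrow> 'e::euclidean_space \<Rightarrow> 'b::real_normed_vector"
  assumes "\<And>\<theta>. (\<lambda>x. A x \<theta>) differentiable (at x within S)" "\<And>x. linear (A x)"
    and "\<eta> differentiable (at x within S)"
  shows "(\<lambda>x. A x (\<eta> x)) differentiable (at x within S)"
proof -
  have "A x (\<eta> x) = (\<Sum>e\<in>Basis. (\<eta> x \<bullet> e) *\<^sub>R A x e)" for x
  proof -
    have "A x (\<eta> x) = A x (\<Sum>e\<in>Basis. (\<eta> x \<bullet> e) *\<^sub>R e)" by (simp add: euclidean_representation)
    then show ?thesis by (simp add: linear_sum[OF assms(2)] linear_cmul[OF assms(2)])
  qed
  then show ?thesis
    by (simp del: euclidean_representation)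
       (intro differentiable_sum' differentiable_scaleR assms differentiable_inner differentiable_const)
qed

text \<open>The parameters solving \<open>A \<xi> \<theta> + b \<xi> = 0\<close> are a smooth image of \<open>(\<xi>, \<theta> modulo span v)\<close>. As the
  dimension of \<open>\<xi>\<close> is below \<open>CARD('k)\<close>, \<open>\<xi>\<close> can be stored in the freed \<open>v\<close>-coordinates, so that the source becomes
  a proper subspace of the parameter space itself.\<close>

lemma negligible_zero_parameters_local:
  fixes A :: "'x::euclidean_space \<Rightarrow> 'e::euclidean_space \<Rightarrow> real^'k" and v :: "'k \<Rightarrow> 'e"
  assumes "DIM('x) < CARD('k)" and lin: "\<And>\<xi>. linear (A \<xi>)"
    and dA: "\<And>\<xi> \<theta>. \<xi> \<in> U \<Longrightarrow> (\<lambda>\<xi>. A \<xi> \<theta>) differentiable (at \<xi>)"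
    and db: "\<And>\<xi>. \<xi> \<in> U \<Longrightarrow> b differentiable (at \<xi>)"
    and det: "\<And>\<xi>. \<xi> \<in> U \<Longrightarrow> det (\<chi> i j. A \<xi> (v j) $ i) \<noteq> 0"
  shows "negligible {\<theta>. \<exists>\<xi>\<in>U. A \<xi> \<theta> + b \<xi> = 0}"
proof (cases "U = {}")
  case False
  define M where "M \<xi> = (\<chi> i j. A \<xi> (v j) $ i)" for \<xi>
  define w where "w t = (\<Sum>j\<in>UNIV. t $ j *\<^sub>R v j)" for t :: "real^'k"
  have lin_w: "linear w"
    unfolding w_def by (rule linearI) (simp_all add: sum.distrib scaleR_left_distrib scaleR_sum_right)
  have A_w: "A \<xi> (w t) = M \<xi> *v t" for \<xi> t
    unfolding w_def M_def
    by (simp add: linear_sum[OF lin] linear_cmul[OF lin] vec_eq_iff matrix_vector_mult_def mult.commute)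
  obtain \<xi>1 where \<xi>1: "\<xi>1 \<in> U" using False by blast
  have "inj w"
  proof (rule injI)
    fix s t assume "w s = w t"
    then have "M \<xi>1 *v s = M \<xi>1 *v t" using A_w by metis
    then show "s = t"
      using det[OF \<xi>1] by (metis M_def invertible_det_nz inj_matrix_vector_mult injD)
  qed
  \<comment> \<open>\<open>P\<close> reads off the coordinates along \<open>v\<close> of a
    parameter; \<open>\<theta> - w (P \<theta>)\<close> is the part that remains free.\<close>
  then obtain P where P: "linear P" "P \<circ> w = id"
    using linear_injective_left_inverse[OF lin_w] by blast
  have P_w: "P (w t) = t" for t using P(2) by (simp add: fun_eq_iff)
  obtain \<iota> :: "'x \<Rightarrow> real^'k" where \<iota>: "linear \<iota>" "\<And>x. norm (\<iota> x) = norm x"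
    using isometry_subset_subspace[of "UNIV :: 'x set" "UNIV :: (real^'k) set"] assms(1) by auto
  have "inj \<iota>"
    using \<iota> by (metis linear_injective_0 norm_eq_zero)
  then obtain \<kappa> where \<kappa>: "linear \<kappa>" "\<kappa> \<circ> \<iota> = id"
    using linear_injective_left_inverse[OF \<iota>(1)] by blast
  have \<kappa>_\<iota>: "\<kappa> (\<iota> x) = x" for x using \<kappa>(2) by (simp add: fun_eq_iff)
  \<comment> \<open>Parameters whose \<open>v\<close>-coordinates encode some \<open>\<xi>\<close>
    through the embedding \<open>\<iota>\<close>. The subspace is proper because
    \<open>\<iota>\<close> cannot be onto.\<close>
  define H where "H = P -` range \<iota>"
  have "subspace H"
    unfolding H_def by (intro linear_subspace_vimage P(1) linear_subspace_image[OF \<iota>(1)]) auto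
  moreover have "H \<noteq> UNIV"
  proof
    assume "H = UNIV"
    then have "range \<iota> = UNIV" unfolding H_def using P_w by (metis UNIV_I UNIV_eq_I vimageE)
    then have "dim (range \<iota>) = CARD('k)" by simp
    moreover have "dim (range \<iota>) \<le> DIM('x)" using dim_image_le[OF \<iota>(1), of UNIV] by simp
    ultimately show False using assms(1) by simp
  qed
  ultimately have "dim H < DIM('e)"
    by (metis dim_eq_full dim_subset_UNIV le_neq_implies_less span_eq_iff)
  then have negl: "negligible H" by (rule negligible_lowdim)
  define c where "c \<zeta> = A (\<kappa> (P \<zeta>)) (\<zeta> - w (P \<zeta>)) + b (\<kappa> (P \<zeta>))" for \<zeta>
  \<comment> \<open>Cramer's rule for the solution of \<open>M \<xi> *v s = - c\<close>, with
    \<open>\<xi>\<close> decoded from \<open>\<zeta>\<close>: an explicit formula, visibly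
    differentiable wherever the determinant is nonzero. \<open>\<Phi>\<close> then replaces the
    stored coordinates by this solution.\<close>
  define s where "s \<zeta> = (\<chi> k. det (\<chi> i j. if j = k then (- c \<zeta>) $ i else M (\<kappa> (P \<zeta>)) $ i $ j)
    / det (M (\<kappa> (P \<zeta>))))" for \<zeta>
  define \<Phi> where "\<Phi> \<zeta> = \<zeta> - w (P \<zeta>) + w (s \<zeta>)" for \<zeta>
  define D where "D = {\<zeta> \<in> H. \<kappa> (P \<zeta>) \<in> U}"
  have "\<Phi> differentiable (at \<zeta> within D)" if "\<zeta> \<in> D" for \<zeta>
  proof -
    have U: "\<kappa> (P \<zeta>) \<in> U" using that by (simp add: D_def)
    have bl: "bounded_linear P" "bounded_linear w" "bounded_linear \<kappa>"
      using P(1) lin_w \<kappa>(1) by (simp_all add: linear_conv_bounded_linear)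
    have dP: "P differentiable (at \<zeta> within D)"
      using bl bounded_linear_imp_differentiable by blast
    have dw: "(\<lambda>\<zeta>. w (g \<zeta>)) differentiable (at \<zeta> within D)" if "g differentiable (at \<zeta> within D)" for g
      using that bounded_linear.has_derivative[OF bl(2)] unfolding differentiable_def by blast
    have d\<xi>: "(\<lambda>\<zeta>. \<kappa> (P \<zeta>)) differentiable (at \<zeta> within D)"
      using dP bounded_linear.has_derivative[OF bl(3)] unfolding differentiable_def by blast
    have comp: "(\<lambda>\<zeta>. g (\<kappa> (P \<zeta>))) differentiable (at \<zeta> within D)"
      if "g differentiable (at (\<kappa> (P \<zeta>)))" for g :: "'x \<Rightarrow> real^'k"
      using that d\<xi> has_derivative_compose unfolding differentiable_def by blast
    have dA': "(\<lambda>\<zeta>. A (\<kappa> (P \<zeta>)) \<theta>) differentiable (at \<zeta> within D)" for \<theta>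
      by (rule comp[OF dA[OF U]])
    have nth: "(\<lambda>\<zeta>. g \<zeta> $ i) differentiable (at \<zeta> within D)"
      if "g differentiable (at \<zeta> within D)" for g :: "'e \<Rightarrow> real^'k" and i
      using that bounded_linear.has_derivative[OF bounded_linear_vec_nth] unfolding differentiable_def by blast
    have dM: "(\<lambda>\<zeta>. M (\<kappa> (P \<zeta>)) $ i $ j) differentiable (at \<zeta> within D)" for i j
      unfolding M_def by (simp add: nth dA')
    have d\<eta>: "(\<lambda>\<zeta>. \<zeta> - w (P \<zeta>)) differentiable (at \<zeta> within D)"
      by (rule differentiable_diff[OF differentiable_ident dw[OF dP]])
    have "(\<lambda>\<zeta>. A (\<kappa> (P \<zeta>)) (\<zeta> - w (P \<zeta>))) differentiable (at \<zeta> within D)"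
      by (rule differentiable_apply_linear[OF dA' lin d\<eta>])
    then have dc: "c differentiable (at \<zeta> within D)"
      unfolding c_def[abs_def] by (rule differentiable_add[OF _ comp[OF db[OF U]]])
    have ds: "s differentiable (at \<zeta> within D)"
    proof (rule differentiable_vecI)
      fix k
      have "(\<lambda>\<zeta>. (if j = k then (- c \<zeta>) $ i else M (\<kappa> (P \<zeta>)) $ i $ j)) differentiable (at \<zeta> within D)" for i j
        using nth[OF differentiable_minus[OF dc]] dM by (cases "j = k") simp_all
      moreover have "det (M (\<kappa> (P \<zeta>))) \<noteq> 0" using det[OF U] by (simp add: M_def)
      ultimately show "(\<lambda>\<zeta>. s \<zeta> $ k) differentiable at \<zeta> within D"
        unfolding s_def by (simp add: differentiable_det differentiable_divide dM)
    qed
    show ?thesis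
      unfolding \<Phi>_def[abs_def] by (rule differentiable_add[OF d\<eta> dw[OF ds]])
  qed
  then have "\<Phi> differentiable_on D" by (simp add: differentiable_on_def)
  moreover have "negligible D"
    using negl by (rule negligible_subset) (simp add: D_def)
  ultimately have "negligible (\<Phi> ` D)"
    by (intro negligible_differentiable_image_negligible[OF order_refl])
  moreover have "\<theta> \<in> \<Phi> ` D" if "\<xi> \<in> U" "A \<xi> \<theta> + b \<xi> = 0" for \<theta> \<xi>
  proof
    \<comment> \<open>The preimage of \<open>\<theta>\<close> keeps its free part and carries
      \<open>\<xi>\<close> in place of its \<open>v\<close>-coordinates, which the equation
      recovers.\<close>
    define \<zeta> where "\<zeta> = \<theta> - w (P \<theta>) + w (\<iota> \<xi>)"
    have P\<zeta>: "P \<zeta> = \<iota> \<xi>"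
      by (simp add: \<zeta>_def linear_add[OF P(1)] linear_diff[OF P(1)] P_w)
    then show "\<zeta> \<in> D" using that(1) by (simp add: D_def H_def \<kappa>_\<iota>)
    have "c \<zeta> = A \<xi> (\<theta> - w (P \<theta>)) + b \<xi>"
      unfolding c_def P\<zeta> \<kappa>_\<iota> by (simp add: \<zeta>_def)
    also have "\<dots> = - (M \<xi> *v P \<theta>)"
      using that(2) by (simp add: linear_diff[OF lin] A_w algebra_simps eq_neg_iff_add_eq_0)
    finally have "M \<xi> *v P \<theta> = - c \<zeta>" by simp
    then have "P \<theta> = s \<zeta>"
      using cramer[of "M \<xi>" "P \<theta>" "- c \<zeta>"] det[OF that(1), folded M_def]
      unfolding s_def P\<zeta> \<kappa>_\<iota> by blast
    then show "\<theta> = \<Phi> \<zeta>"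
      unfolding \<Phi>_def P\<zeta> by (simp add: \<zeta>_def)
  qed
  ultimately show ?thesis
    by (elim negligible_subset) blast
qed simp

text \<open>At each \<open>\<xi>\<close>, preimages of the standard basis form a tuple
  \<open>v\<close> whose matrix is the identity, and the same \<open>v\<close> keeps a nonzero
  determinant nearby. By Lindelof countably many tuples cover \<open>U\<close>, and a countable
  union of null sets is null.\<close>

lemma negligible_zero_parameters:
  fixes A :: "'x::euclidean_space \<Rightarrow> 'e::euclidean_space \<Rightarrow> real^'k"
  assumes "DIM('x) < CARD('k)" and lin: "\<And>\<xi>. linear (A \<xi>)" and "open U"
    and dA: "\<And>\<xi> \<theta>. \<xi> \<in> U \<Longrightarrow> (\<lambda>\<xi>. A \<xi> \<theta>) differentiable (at \<xi>)"
    and db: "\<And>\<xi>. \<xi> \<in> U \<Longrightarrow> b differentiable (at \<xi>)"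
    and surj: "\<And>\<xi>. \<xi> \<in> U \<Longrightarrow> surj (A \<xi>)"
  shows "negligible {\<theta>. \<exists>\<xi>\<in>U. A \<xi> \<theta> + b \<xi> = 0}"
proof -
  define G where "G v = {\<xi> \<in> U. det (\<chi> i j. A \<xi> (v j) $ i) \<noteq> 0}" for v :: "'k \<Rightarrow> 'e"
  have "open (G v)" for v :: "'k \<Rightarrow> 'e"
  proof -
    have "(\<lambda>\<xi>. det (\<chi> i j. A \<xi> (v j) $ i)) differentiable (at \<xi>)" if "\<xi> \<in> U" for \<xi>
    proof (rule differentiable_det)
      fix i j
      show "(\<lambda>\<xi>. (\<chi> i j. A \<xi> (v j) $ i) $ i $ j) differentiable at \<xi>"
        using dA[OF that] bounded_linear.has_derivative[OF bounded_linear_vec_nth]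
        unfolding differentiable_def by simp blast
    qed
    then have "continuous_on U (\<lambda>\<xi>. det (\<chi> i j. A \<xi> (v j) $ i))"
      by (meson continuous_at_imp_continuous_on differentiable_imp_continuous_within)
    then have "open ((\<lambda>\<xi>. det (\<chi> i j. A \<xi> (v j) $ i)) -` (- {0}) \<inter> U)"
      by (rule iffD1[OF continuous_on_open_vimage[OF \<open>open U\<close>], rule_format,
            OF _ open_Compl[OF closed_singleton]])
    moreover have "(\<lambda>\<xi>. det (\<chi> i j. A \<xi> (v j) $ i)) -` (- {0}) \<inter> U = G v"
      by (auto simp: G_def)
    ultimately show ?thesis by simp
  qed
  then have "open S" if "S \<in> range G" for S using that by blast
  then obtain \<F> where \<F>: "\<F> \<subseteq> range G" "countable \<F>" "\<Union>\<F> = \<Union>(range G)"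
    by (rule Lindelof)
  have "negligible (\<Union>S\<in>\<F>. {\<theta>. \<exists>\<xi>\<in>S. A \<xi> \<theta> + b \<xi> = 0})"
  proof (rule negligible_countable_Union)
    show "countable ((\<lambda>S. {\<theta>. \<exists>\<xi>\<in>S. A \<xi> \<theta> + b \<xi> = 0}) ` \<F>)" using \<F>(2) by simp
    fix N assume "N \<in> (\<lambda>S. {\<theta>. \<exists>\<xi>\<in>S. A \<xi> \<theta> + b \<xi> = 0}) ` \<F>"
    then obtain S where S: "S \<in> \<F>" "N = {\<theta>. \<exists>\<xi>\<in>S. A \<xi> \<theta> + b \<xi> = 0}" by blast
    then obtain v where "S = G v" using \<F>(1) by blast
    then have "N = {\<theta>. \<exists>\<xi>\<in>G v. A \<xi> \<theta> + b \<xi> = 0}" using S(2) by simp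
    moreover have "negligible {\<theta>. \<exists>\<xi>\<in>G v. A \<xi> \<theta> + b \<xi> = 0}"
      by (rule negligible_zero_parameters_local[where v = v]) (simp_all add: G_def assms)
    ultimately show "negligible N" by simp
  qed
  moreover have "\<xi> \<in> \<Union>\<F>" if \<xi>: "\<xi> \<in> U" for \<xi>
  proof -
    define v where "v j = inv (A \<xi>) (axis j 1)" for j
    have v: "A \<xi> (v j) = axis j 1" for j
      unfolding v_def by (rule surj_f_inv_f[OF surj[OF \<xi>]])
    have "(\<chi> i j. A \<xi> (v j) $ i) = mat 1"
      by (simp add: v vec_eq_iff mat_def axis_def)
    then have "\<xi> \<in> G v" using \<xi> by (simp add: G_def)
    then show ?thesis using \<F>(3) by blast
  qed
  ultimately show ?thesis
    by (elim negligible_subset) blast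
qed

section \<open>Vanishing orders of iterated brackets\<close>

text \<open>For smooth \<open>h\<close> this says that its components lie in the r-th power of the
  maximal ideal of germs at \<open>x\<close>; order 0 imposes nothing.\<close>

definition vanishes :: "nat \<Rightarrow> real^'n \<Rightarrow> (real^'n \<Rightarrow> 'b::real_normed_vector) \<Rightarrow> bool"
  where "vanishes r x h \<longleftrightarrow> (\<forall>is. length is < r \<longrightarrow> partials is h x = 0)"

lemma vanishes_0 [simp]: "vanishes 0 x h"
  by (simp add: vanishes_def)

lemma vanishes_mono: "vanishes r x h \<Longrightarrow> s \<le> r \<Longrightarrow> vanishes s x h"
  unfolding vanishes_def by auto

lemma vanishes_Suc: "vanishes (Suc r) x h \<longleftrightarrow> h x = 0 \<and> (\<forall>i. vanishes r x (pd i h))"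
proof
  assume h: "vanishes (Suc r) x h"
  have "h x = 0" using h unfolding vanishes_def by (auto dest: spec[of _ "[]"])
  moreover have "partials is (pd i h) x = 0" if "length is < r" for "is" i
    using h that unfolding vanishes_def by (auto dest: spec[of _ "is @ [i]"] simp: partials_snoc)
  ultimately show "h x = 0 \<and> (\<forall>i. vanishes r x (pd i h))" unfolding vanishes_def by blast
next
  assume h: "h x = 0 \<and> (\<forall>i. vanishes r x (pd i h))"
  have "partials is h x = 0" if "length is < Suc r" for "is"
  proof (cases "is" rule: rev_cases)
    case (snoc js i)
    then show ?thesis using h that unfolding vanishes_def by (simp add: partials_snoc)
  qed (use h in simp)
  then show "vanishes (Suc r) x h" unfolding vanishes_def by blast
qed

lemma vanishes_value: "vanishes r x h \<Longrightarrow> 0 < r \<Longrightarrow> h x = 0"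
  by (cases r) (auto simp: vanishes_Suc)

lemma vanishes_pd: "vanishes r x h \<Longrightarrow> vanishes (r - 1) x (pd i h)"
  by (cases r) (auto simp: vanishes_Suc)

lemma vanishes_cong:
  assumes "open V" "x \<in> V" "\<And>y. y \<in> V \<Longrightarrow> f y = g y" "vanishes r x f"
  shows "vanishes r x g"
  using assms(4) partials_cong[OF assms(1,3,2)] unfolding vanishes_def by simp

lemma vanishes_add:
  assumes "open V" "x \<in> V" "smooth_on V f" "smooth_on V g" "vanishes r x f" "vanishes r x g"
  shows "vanishes r x (\<lambda>y. f y + g y)"
  using assms(5,6) unfolding vanishes_def by (simp add: partials_add[OF assms(1,3,4,2)])

lemma vanishes_uminus:
  assumes "open V" "x \<in> V" "smooth_on V f" "vanishes r x f"
  shows "vanishes r x (\<lambda>y. - f y)"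
  using assms(4) partials_bounded_linear[OF assms(1) bounded_linear_minus[OF bounded_linear_ident] assms(3,2)]
  unfolding vanishes_def by simp

lemma vanishes_diff:
  assumes "open V" "x \<in> V" "smooth_on V f" "smooth_on V g" "vanishes r x f" "vanishes r x g"
  shows "vanishes r x (\<lambda>y. f y - g y)"
  using vanishes_add[OF assms(1-3) smooth_on_uminus[OF assms(1,4)] assms(5) vanishes_uminus[OF assms(1,2,4,6)]]
  by simp

lemma vanishes_sum:
  assumes "open V" "x \<in> V" "\<And>c. c \<in> C \<Longrightarrow> smooth_on V (f c)" "\<And>c. c \<in> C \<Longrightarrow> vanishes r x (f c)"
  shows "vanishes r x (\<lambda>y. \<Sum>c\<in>C. f c y)"
  using assms(4) unfolding vanishes_def by (simp add: partials_sum[OF assms(1,3,2)])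

text \<open>Orders add up: every derivative of the product lowers the order of one factor only. The
  inequality \<open>n \<le> r + s\<close>, rather than an equation, survives the truncated
  subtraction when a factor already has order 0.\<close>

lemma vanishes_bilinear:
  assumes "open V" "x \<in> V" "bounded_bilinear mul" "smooth_on V f" "smooth_on V g"
    and "vanishes r x f" "vanishes s x g" "n \<le> r + s"
  shows "vanishes n x (\<lambda>y. mul (f y) (g y))"
  using assms(4-)
proof (induction n arbitrary: r s f g)
  case (Suc n)
  have "mul (f x) (g x) = 0"
  proof (cases "r = 0")
    case True
    then have "g x = 0" using Suc.prems(4,5) vanishes_value[of s x g] by simp
    then show ?thesis by (simp add: bounded_bilinear.zero_right[OF assms(3)])
  next
    case False
    then have "f x = 0" using Suc.prems(3) vanishes_value[of r x f] by simp
    then show ?thesis by (simp add: bounded_bilinear.zero_left[OF assms(3)])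
  qed
  moreover have "vanishes n x (pd i (\<lambda>y. mul (f y) (g y)))" for i
  proof (rule vanishes_cong[OF assms(1,2)])
    fix y assume y: "y \<in> V"
    show "mul (f y) (pd i g y) + mul (pd i f y) (g y) = pd i (\<lambda>y. mul (f y) (g y)) y"
      using pd_bilinear[OF assms(3) smooth_on_differentiable[OF Suc.prems(1) y]
          smooth_on_differentiable[OF Suc.prems(2) y]] by simp
  next
    have "vanishes n x (\<lambda>y. mul (f y) (pd i g y))"
      using Suc.prems(5) by (intro Suc.IH[OF Suc.prems(1) smooth_on_pd[OF Suc.prems(2)]
            Suc.prems(3) vanishes_pd[OF Suc.prems(4)]]) simp
    moreover have "vanishes n x (\<lambda>y. mul (pd i f y) (g y))"
      using Suc.prems(5) by (intro Suc.IH[OF smooth_on_pd[OF Suc.prems(1)] Suc.prems(2)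
            vanishes_pd[OF Suc.prems(3)] Suc.prems(4)]) simp
    ultimately show "vanishes n x (\<lambda>y. mul (f y) (pd i g y) + mul (pd i f y) (g y))"
      by (intro vanishes_add[OF assms(1,2)] smooth_on_bilinear[OF assms(1,3)] smooth_on_pd Suc.prems)
  qed
  ultimately show ?case by (simp add: vanishes_Suc)
qed simp

lemma vanishes_power:
  fixes f :: "real^'n \<Rightarrow> real"
  assumes "open V" "x \<in> V" "smooth_on V f" "f x = 0"
  shows "vanishes d x (\<lambda>y. f y ^ d)"
proof (induction d)
  case (Suc d)
  have "vanishes 1 x f" using assms(4) by (simp add: vanishes_Suc)
  then have "vanishes (Suc d) x (\<lambda>y. f y * f y ^ d)"
    by (rule vanishes_bilinear[OF assms(1,2) bounded_bilinear_mult assms(3)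
          smooth_on_power[OF assms(1,3)] _ Suc]) simp
  then show ?case by simp
qed simp

definition dir_deriv :: "(real^'n \<Rightarrow> real^'n) \<Rightarrow> (real^'n \<Rightarrow> real) \<Rightarrow> real^'n \<Rightarrow> real"
  where "dir_deriv g \<phi> = (\<lambda>x. \<Sum>j\<in>UNIV. g x $ j * pd j \<phi> x)"

lemma smooth_on_dir_deriv: "open V \<Longrightarrow> smooth_on V g \<Longrightarrow> smooth_on V \<phi> \<Longrightarrow> smooth_on V (dir_deriv g \<phi>)"
  unfolding dir_deriv_def by (intro smooth_on_sum smooth_on_mult smooth_on_vec_nth smooth_on_pd)

lemma lie_bracket_add:
  assumes "g differentiable at x" "u differentiable at x" "w differentiable at x"
  shows "lie_bracket g (\<lambda>y. u y + w y) x = lie_bracket g u x + lie_bracket g w x"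
proof -
  have "(\<lambda>y. u y + w y) differentiable at x" using assms by simp
  then show ?thesis
    using assms by (simp add: lie_bracket_eq pd_add algebra_simps sum.distrib sum_subtractf)
qed

lemma lie_bracket_scaleR:
  assumes "g differentiable at x" "\<phi> differentiable at x" "u differentiable at x"
  shows "lie_bracket g (\<lambda>y. \<phi> y *\<^sub>R u y) x = dir_deriv g \<phi> x *\<^sub>R u x + \<phi> x *\<^sub>R lie_bracket g u x"
proof -
  have "(\<lambda>y. \<phi> y *\<^sub>R u y) differentiable at x" using assms by simp
  then show ?thesis
    using assms
    by (simp add: lie_bracket_eq pd_bilinear[OF bounded_bilinear_scaleR] dir_deriv_def
        scaleR_sum_left scaleR_sum_right algebra_simps sum.distrib sum_subtractf)
qed

lemma dir_deriv_power:
  assumes "\<phi> differentiable at x"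
  shows "dir_deriv g (\<lambda>y. \<phi> y ^ Suc d) x = real (Suc d) * dir_deriv g \<phi> x * \<phi> x ^ d"
proof -
  have "((\<lambda>y. \<phi> y ^ Suc d) has_derivative
      (\<lambda>h. real (Suc d) * frechet_derivative \<phi> (at x) h * \<phi> x ^ d)) (at x)"
    using has_derivative_power[OF differentiableD[OF assms], of "Suc d"] by simp
  then have "pd i (\<lambda>y. \<phi> y ^ Suc d) x = real (Suc d) * pd i \<phi> x * \<phi> x ^ d" for i
    by (rule pd_eq)
  then show ?thesis
    unfolding dir_deriv_def by (simp add: sum_distrib_left sum_distrib_right mult_ac)
qed

lemma vanishes_lie_bracket:
  assumes "open V" "x \<in> V" "smooth_on V g" "smooth_on V w" "vanishes r x w"
  shows "vanishes (r - 1) x (lie_bracket g w)"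
proof (rule vanishes_cong[OF assms(1,2)])
  show "(\<Sum>j\<in>UNIV. g y $ j *\<^sub>R pd j w y - w y $ j *\<^sub>R pd j g y) = lie_bracket g w y" if "y \<in> V" for y
    using lie_bracket_eq[OF smooth_on_differentiable[OF assms(3) that]
        smooth_on_differentiable[OF assms(4) that]] by simp
  have nth: "vanishes r x (\<lambda>y. w y $ j)" for j
    using assms(5) partials_bounded_linear[OF assms(1) bounded_linear_vec_nth assms(4,2)]
    unfolding vanishes_def by simp
  have "vanishes (r - 1) x (\<lambda>y. g y $ j *\<^sub>R pd j w y - w y $ j *\<^sub>R pd j g y)" for j
    by (intro vanishes_diff[OF assms(1,2)] smooth_on_scaleR smooth_on_vec_nth smooth_on_pd assms
        vanishes_bilinear[OF assms(1,2) bounded_bilinear_scaleR _ _ vanishes_0 vanishes_pd[OF assms(5)]]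
        vanishes_bilinear[OF assms(1,2) bounded_bilinear_scaleR _ _ nth vanishes_0]) simp_all
  then show "vanishes (r - 1) x (\<lambda>y. \<Sum>j\<in>UNIV. g y $ j *\<^sub>R pd j w y - w y $ j *\<^sub>R pd j g y)"
    by (intro vanishes_sum[OF assms(1,2)] smooth_on_diff smooth_on_scaleR smooth_on_vec_nth smooth_on_pd assms)
qed

text \<open>Bracketing with \<open>g\<close> lowers the vanishing order of \<open>\<phi>\<^sup>m \<Psi>\<close> by one, and to leading order it only
  differentiates the factors \<open>\<phi>\<close>.\<close>

lemma ad_leading_term:
  assumes "open V" "x \<in> V" "smooth_on V g" "smooth_on V \<phi>" "smooth_on V \<Psi>"
    and "\<phi> x = 0" "vanishes s x \<Psi>" "vanishes s x (lie_bracket g \<Psi>)" "j \<le> m"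
  shows "\<exists>c>0. \<exists>R. smooth_on V R \<and> vanishes (m - j + s + 1) x R \<and>
    (\<forall>y\<in>V. ad g j (\<lambda>y. \<phi> y ^ m *\<^sub>R \<Psi> y) y = \<phi> y ^ (m - j) *\<^sub>R (c * dir_deriv g \<phi> y ^ j) *\<^sub>R \<Psi> y + R y)"
  using assms(9)
proof (induction j)
  case 0
  show ?case
    by (intro exI[of _ 1] conjI exI[of _ "\<lambda>y. 0"]) (simp_all add: smooth_on_const vanishes_def partials_const_0)
next
  case (Suc j)
  define d where "d = m - Suc j"
  have d: "m - j = Suc d" using Suc.prems by (simp add: d_def)
  define W where "W = (\<lambda>y. \<phi> y ^ m *\<^sub>R \<Psi> y)"
  obtain c R where IH: "c > 0" "smooth_on V R" "vanishes (Suc d + s + 1) x R"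
    "\<And>y. y \<in> V \<Longrightarrow> ad g j W y = \<phi> y ^ Suc d *\<^sub>R (c * dir_deriv g \<phi> y ^ j) *\<^sub>R \<Psi> y + R y"
    using Suc.IH Suc.prems unfolding d W_def by (meson Suc_leD)
  define a where "a = (\<lambda>y. c * dir_deriv g \<phi> y ^ j)"
  define \<Theta> where "\<Theta> = (\<lambda>y. a y *\<^sub>R \<Psi> y)"
  note dd = smooth_on_dir_deriv[OF assms(1,3)]
  have sa: "smooth_on V a"
    unfolding a_def by (intro smooth_on_mult smooth_on_const smooth_on_power dd assms)
  have s\<Theta>: "smooth_on V \<Theta>" unfolding \<Theta>_def by (intro smooth_on_scaleR sa assms)
  have sp: "smooth_on V (\<lambda>y. \<phi> y ^ Suc d)" by (intro smooth_on_power assms)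
  have sb: "smooth_on V (lie_bracket g \<Theta>)" "smooth_on V (lie_bracket g R)" "smooth_on V (lie_bracket g \<Psi>)"
    by (intro smooth_on_lie_bracket assms s\<Theta> IH)+
  \<comment> \<open>Both summands have order \<open>d + s + 1\<close>: the power of
    \<open>\<phi>\<close> contributes \<open>d + 1\<close> and the bracket with
    \<open>\<Theta>\<close> contributes \<open>s\<close>, while bracketing lowers the order
    \<open>d + s + 2\<close> of \<open>R\<close> by one.\<close>
  define R' where "R' = (\<lambda>y. \<phi> y ^ Suc d *\<^sub>R lie_bracket g \<Theta> y + lie_bracket g R y)"
  have "smooth_on V R'"
    unfolding R'_def by (intro smooth_on_add smooth_on_scaleR sp sb assms)
  moreover have "vanishes (d + s + 1) x R'"
  proof -
    \<comment> \<open>The assumption on \<open>lie_bracket g \<Psi>\<close> is used here: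
      multiplying \<open>\<Psi>\<close> by the function \<open>a\<close> does not let the bracket
      drop below order \<open>s\<close>.\<close>
    have "vanishes s x (lie_bracket g \<Theta>)"
    proof (rule vanishes_cong[OF assms(1,2)])
      show "dir_deriv g a y *\<^sub>R \<Psi> y + a y *\<^sub>R lie_bracket g \<Psi> y = lie_bracket g \<Theta> y" if "y \<in> V" for y
        unfolding \<Theta>_def
        using lie_bracket_scaleR[OF smooth_on_differentiable[OF assms(3) that]
            smooth_on_differentiable[OF sa that] smooth_on_differentiable[OF assms(5) that]] by simp
      show "vanishes s x (\<lambda>y. dir_deriv g a y *\<^sub>R \<Psi> y + a y *\<^sub>R lie_bracket g \<Psi> y)"
        by (intro vanishes_add[OF assms(1,2)] smooth_on_scaleR dd sa sb assms
            vanishes_bilinear[OF assms(1,2) bounded_bilinear_scaleR _ _ vanishes_0 assms(7)]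
            vanishes_bilinear[OF assms(1,2) bounded_bilinear_scaleR _ _ vanishes_0 assms(8)]) simp_all
    qed
    then have "vanishes (d + s + 1) x (\<lambda>y. \<phi> y ^ Suc d *\<^sub>R lie_bracket g \<Theta> y)"
      by (rule vanishes_bilinear[OF assms(1,2) bounded_bilinear_scaleR sp sb(1)
            vanishes_power[OF assms(1,2,4,6)]]) simp
    moreover have "vanishes (d + s + 1) x (lie_bracket g R)"
      using vanishes_lie_bracket[OF assms(1-3) IH(2,3)] by simp
    ultimately show ?thesis
      unfolding R'_def by (intro vanishes_add[OF assms(1,2)] smooth_on_scaleR sp sb assms)
  qed
  moreover have "ad g (Suc j) W y
      = \<phi> y ^ d *\<^sub>R (c * real (Suc d) * dir_deriv g \<phi> y ^ Suc j) *\<^sub>R \<Psi> y + R' y" if y: "y \<in> V" for y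
  proof -
    note diff = smooth_on_differentiable[OF _ y]
    have "ad g (Suc j) W y = lie_bracket g (\<lambda>y. \<phi> y ^ Suc d *\<^sub>R \<Theta> y + R y) y"
      using lie_bracket_cong[OF assms(1) y, of g g "ad g j W"] IH(4) by (simp add: \<Theta>_def a_def)
    also have "\<dots> = lie_bracket g (\<lambda>y. \<phi> y ^ Suc d *\<^sub>R \<Theta> y) y + lie_bracket g R y"
      by (intro lie_bracket_add diff assms IH smooth_on_scaleR sp s\<Theta>)
    also have "lie_bracket g (\<lambda>y. \<phi> y ^ Suc d *\<^sub>R \<Theta> y) y
        = dir_deriv g (\<lambda>y. \<phi> y ^ Suc d) y *\<^sub>R \<Theta> y + \<phi> y ^ Suc d *\<^sub>R lie_bracket g \<Theta> y"
      by (intro lie_bracket_scaleR diff assms sp s\<Theta>)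
    also have "dir_deriv g (\<lambda>y. \<phi> y ^ Suc d) y = real (Suc d) * dir_deriv g \<phi> y * \<phi> y ^ d"
      by (intro dir_deriv_power diff assms)
    finally show ?thesis by (simp add: R'_def \<Theta>_def a_def mult_ac)
  qed
  ultimately show ?case
    unfolding W_def[symmetric] d_def[symmetric] using IH(1)
    by (intro exI[of _ "c * real (Suc d)"] conjI exI[of _ R']) auto
qed

lemma jet1_add:
  assumes "f differentiable at x" "h differentiable at x"
  shows "jet1 (\<lambda>y. f y + h y) x = jet1 f x + jet1 h x"
  unfolding jet1_def by (simp add: vec_eq_iff jacobian_nth pd_add[OF assms])

lemma jet1_scaleR:
  assumes "f differentiable at x"
  shows "jet1 (\<lambda>y. c *\<^sub>R f y) x = c *\<^sub>R jet1 f x"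
  unfolding jet1_def
  by (simp add: vec_eq_iff jacobian_nth pd_bounded_linear[OF bounded_linear_scaleR_right assms])

lemma jet1_vanishes:
  assumes "vanishes 2 x h"
  shows "jet1 h x = 0"
  using assms unfolding jet1_def
  by (simp add: numeral_2_eq_2 vanishes_Suc vec_eq_iff jacobian_nth prod_eq_iff)

text \<open>The affine factor is zero at \<open>x\<close>, so the value vanishes and the Jacobian is
  the rank-one matrix with entries \<open>\<Theta> x $ i * c $ j\<close>. Pairing it with
  \<open>S\<close> gives the right-hand side.\<close>

lemma inner_jet1_affine:
  assumes "\<Theta> differentiable at x"
  shows "(l, S) \<bullet> jet1 (\<lambda>y. (c \<bullet> (y - x)) *\<^sub>R \<Theta> y) x = \<Theta> x \<bullet> (S *v c)"
proof -
  have "((\<lambda>y. c \<bullet> (y - x)) has_derivative (\<lambda>h. c \<bullet> h)) (at x)"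
    by (auto intro!: derivative_eq_intros)
  then have "(\<lambda>y. c \<bullet> (y - x)) differentiable at x" "pd j (\<lambda>y. c \<bullet> (y - x)) x = c $ j" for j
    using pd_eq[of "\<lambda>y. c \<bullet> (y - x)" "\<lambda>h. c \<bullet> h" x j]
    by (auto simp: differentiable_def inner_axis)
  then have "pd j (\<lambda>y. (c \<bullet> (y - x)) *\<^sub>R \<Theta> y) x = c $ j *\<^sub>R \<Theta> x" for j
    using pd_bilinear[OF bounded_bilinear_scaleR _ assms, of "\<lambda>y. c \<bullet> (y - x)" j] by simp
  then show ?thesis
    by (simp add: jet1_def inner_vec_def jacobian_nth matrix_vector_mult_def sum_distrib_left mult_ac)
qed

text \<open>For \<open>v = (l, S)\<close> the direction \<open>b\<close> and the affine factor are \<open>b = l\<close> and \<open>1\<close> if \<open>S = 0\<close>, and otherwise \<open>b = S c\<close>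
  and \<open>c \<bullet> (y - x)\<close>, where \<open>c = g x\<close> if \<open>S (g x) \<noteq> 0\<close>, and else \<open>c\<close> is orthogonal to \<open>g x\<close> with \<open>S c \<noteq> 0\<close>.\<close>

lemma exists_separating_perturbation:
  assumes "open V" "x \<in> V" "smooth_on V g" "smooth_on V \<delta>" "g x \<noteq> 0" "\<delta> x \<noteq> 0" "v \<noteq> 0"
  shows "\<exists>c r b. \<forall>k. (\<forall>j<k. v \<bullet> jet1 (ad g j (\<lambda>y. \<delta> y *\<^sub>R ((g x \<bullet> (y - x)) ^ k * (c \<bullet> y + r)) *\<^sub>R b)) x = 0) \<and>
    v \<bullet> jet1 (ad g k (\<lambda>y. \<delta> y *\<^sub>R ((g x \<bullet> (y - x)) ^ k * (c \<bullet> y + r)) *\<^sub>R b)) x \<noteq> 0"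
proof -
  obtain l S where v: "v = (l, S)" by (cases v)
  define \<phi> where "\<phi> = (\<lambda>y. g x \<bullet> (y - x))"
  have s_aff: "smooth_on V (\<lambda>y. c \<bullet> (y - x))" for c
    by (intro smooth_on_inner smooth_on_diff smooth_on_const smooth_on_linear bounded_linear_ident assms)
  have s\<phi>: "smooth_on V \<phi>" "\<phi> x = 0" by (simp_all add: \<phi>_def s_aff)
  have pd_aff: "pd j (\<lambda>y. c \<bullet> (y - x)) y = c $ j" for c j y
  proof -
    have "((\<lambda>y. c \<bullet> (y - x)) has_derivative (\<lambda>h. c \<bullet> h)) (at y)"
      by (auto intro!: derivative_eq_intros)
    from pd_eq[OF this, of j] show ?thesis by (simp add: inner_axis)
  qed
  have dd_aff: "dir_deriv g (\<lambda>y. c \<bullet> (y - x)) x = g x \<bullet> c" for c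
    unfolding dir_deriv_def pd_aff by (simp add: inner_vec_def)
  then have dd\<phi>: "dir_deriv g \<phi> x > 0" using assms(5) by (simp add: \<phi>_def)
  have s\<delta>b: "smooth_on V (\<lambda>y. \<delta> y *\<^sub>R b)" for b :: "real^'n"
    by (intro smooth_on_scaleR smooth_on_const assms)
  note diff = smooth_on_differentiable[OF _ assms(2)]
  show ?thesis
  proof (cases "S = 0")
    case True
    \<comment> \<open>With \<open>S = 0\<close> only values matter, so order 1 is enough to be
      invisible and the leading term is used with \<open>s = 0\<close>.\<close>
    define \<Psi> where "\<Psi> = (\<lambda>y. \<delta> y *\<^sub>R l)"
    have "l \<noteq> 0" using assms(7) True v by (simp add: zero_prod_def)
    have val: "v \<bullet> jet1 h x = l \<bullet> h x" for h
      using True v by (simp add: jet1_def)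
    have lead: "\<exists>c>0. ad g j (\<lambda>y. \<phi> y ^ k *\<^sub>R \<Psi> y) x = \<phi> x ^ (k - j) *\<^sub>R (c * dir_deriv g \<phi> x ^ j) *\<^sub>R \<Psi> x"
      if "j \<le> k" for j k
    proof -
      have "smooth_on V \<Psi>" unfolding \<Psi>_def by (rule s\<delta>b)
      from ad_leading_term[OF assms(1-3) s\<phi>(1) this s\<phi>(2) vanishes_0 vanishes_0 that]
      obtain c R where *: "c > 0" "vanishes (k - j + 0 + 1) x R"
        "\<forall>y\<in>V. ad g j (\<lambda>y. \<phi> y ^ k *\<^sub>R \<Psi> y) y = \<phi> y ^ (k - j) *\<^sub>R (c * dir_deriv g \<phi> y ^ j) *\<^sub>R \<Psi> y + R y"
        by blast
      then have "R x = 0" using vanishes_value[OF *(2)] by simp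
      then show ?thesis using *(1,3) assms(2) by auto
    qed
    have "\<forall>k. (\<forall>j<k. v \<bullet> jet1 (ad g j (\<lambda>y. \<phi> y ^ k *\<^sub>R \<Psi> y)) x = 0) \<and>
        v \<bullet> jet1 (ad g k (\<lambda>y. \<phi> y ^ k *\<^sub>R \<Psi> y)) x \<noteq> 0"
    proof (intro allI conjI impI)
      fix k j :: nat assume "j < k"
      then show "v \<bullet> jet1 (ad g j (\<lambda>y. \<phi> y ^ k *\<^sub>R \<Psi> y)) x = 0"
        using lead[of j k] s\<phi>(2) by (auto simp: val)
    next
      fix k
      show "v \<bullet> jet1 (ad g k (\<lambda>y. \<phi> y ^ k *\<^sub>R \<Psi> y)) x \<noteq> 0"
        using lead[of k k] dd\<phi> \<open>l \<noteq> 0\<close> assms(6) by (auto simp: val \<Psi>_def)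
    qed
    then show ?thesis
      by (intro exI[of _ 0] exI[of _ 1] exI[of _ l]) (simp add: \<phi>_def \<Psi>_def mult.commute)
  next
    case False
    \<comment> \<open>The affine factor contributes one order, \<open>m + s = 1\<close>, in one of
      two ways: for \<open>c = g x\<close> it is a further factor \<open>\<phi>\<close>
      (\<open>m = 1\<close>), and for \<open>c\<close> orthogonal to \<open>g x\<close> it is part
      of \<open>\<Psi>\<close> (\<open>s = 1\<close>).\<close>
    have main: "\<forall>k. (\<forall>j<k. v \<bullet> jet1 (ad g j (\<lambda>y. \<delta> y *\<^sub>R (\<phi> y ^ k * (c \<bullet> (y - x))) *\<^sub>R b)) x = 0) \<and>
        v \<bullet> jet1 (ad g k (\<lambda>y. \<delta> y *\<^sub>R (\<phi> y ^ k * (c \<bullet> (y - x))) *\<^sub>R b)) x \<noteq> 0"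
      if b: "b = S *v c" "b \<noteq> 0"
        and ms: "\<And>k. (\<lambda>y. \<delta> y *\<^sub>R (\<phi> y ^ k * (c \<bullet> (y - x))) *\<^sub>R b) = (\<lambda>y. \<phi> y ^ (k + m) *\<^sub>R \<Psi> y)"
          "\<And>y. \<phi> y ^ m *\<^sub>R \<Psi> y = (c \<bullet> (y - x)) *\<^sub>R \<delta> y *\<^sub>R b"
          "m + s = 1" "smooth_on V \<Psi>" "vanishes s x \<Psi>" "vanishes s x (lie_bracket g \<Psi>)"
      for b c \<Psi> m s
    proof (intro allI conjI impI)
      have lead: "\<exists>a>0. \<exists>R. smooth_on V R \<and> vanishes (k + m - j + s + 1) x R \<and>
        (\<forall>y\<in>V. ad g j (\<lambda>y. \<phi> y ^ (k + m) *\<^sub>R \<Psi> y) y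
          = \<phi> y ^ (k + m - j) *\<^sub>R (a * dir_deriv g \<phi> y ^ j) *\<^sub>R \<Psi> y + R y)"
        if "j \<le> k" for j k
        by (rule ad_leading_term) (use that in \<open>simp_all add: assms s\<phi> ms\<close>)
      fix k j :: nat assume "j < k"
      then obtain a R where R: "smooth_on V R" "vanishes (k + m - j + s + 1) x R" and
        eq: "\<forall>y\<in>V. ad g j (\<lambda>y. \<phi> y ^ (k + m) *\<^sub>R \<Psi> y) y
          = \<phi> y ^ (k + m - j) *\<^sub>R (a * dir_deriv g \<phi> y ^ j) *\<^sub>R \<Psi> y + R y"
        using lead[of j k] less_imp_le by blast
      have sa: "smooth_on V (\<lambda>y. (a * dir_deriv g \<phi> y ^ j) *\<^sub>R \<Psi> y)"
        by (intro smooth_on_scaleR smooth_on_mult smooth_on_const smooth_on_power smooth_on_dir_deriv assms s\<phi> ms)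
      have "vanishes s x (\<lambda>y. (a * dir_deriv g \<phi> y ^ j) *\<^sub>R \<Psi> y)"
        by (rule vanishes_bilinear[OF assms(1,2) bounded_bilinear_scaleR _ ms(4) vanishes_0 ms(5)])
          (intro smooth_on_mult smooth_on_const smooth_on_power smooth_on_dir_deriv assms s\<phi>, simp)
      \<comment> \<open>The order is at least \<open>(k - j) + (m + s)\<close>, hence at least 2 for
        \<open>j < k\<close>; this is exactly what makes a 1-jet vanish.\<close>
      then have "vanishes 2 x (\<lambda>y. \<phi> y ^ (k + m - j) *\<^sub>R (a * dir_deriv g \<phi> y ^ j) *\<^sub>R \<Psi> y)"
        by (rule vanishes_bilinear[OF assms(1,2) bounded_bilinear_scaleR
              smooth_on_power[OF assms(1) s\<phi>(1)] sa vanishes_power[OF assms(1,2) s\<phi>]])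
          (use \<open>j < k\<close> ms(3) in simp)
      then have "vanishes 2 x (\<lambda>y. \<phi> y ^ (k + m - j) *\<^sub>R (a * dir_deriv g \<phi> y ^ j) *\<^sub>R \<Psi> y + R y)"
        using \<open>j < k\<close> ms(3) vanishes_mono[OF R(2), of 2]
        by (intro vanishes_add[OF assms(1,2)] smooth_on_scaleR[OF assms(1)] smooth_on_power sa s\<phi> assms R(1)) simp_all
      then have "vanishes 2 x (ad g j (\<lambda>y. \<phi> y ^ (k + m) *\<^sub>R \<Psi> y))"
        by (rule vanishes_cong[OF assms(1,2), rotated]) (simp only: eq)
      then show "v \<bullet> jet1 (ad g j (\<lambda>y. \<delta> y *\<^sub>R (\<phi> y ^ k * (c \<bullet> (y - x))) *\<^sub>R b)) x = 0"
        unfolding ms(1) by (simp add: jet1_vanishes)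
    next
      fix k
      have "\<exists>a>0. \<exists>R. smooth_on V R \<and> vanishes (k + m - k + s + 1) x R \<and>
        (\<forall>y\<in>V. ad g k (\<lambda>y. \<phi> y ^ (k + m) *\<^sub>R \<Psi> y) y
          = \<phi> y ^ (k + m - k) *\<^sub>R (a * dir_deriv g \<phi> y ^ k) *\<^sub>R \<Psi> y + R y)"
        by (rule ad_leading_term) (simp_all add: assms s\<phi> ms)
      then obtain a R where *: "a > 0" "smooth_on V R" "vanishes (k + m - k + s + 1) x R"
        "\<forall>y\<in>V. ad g k (\<lambda>y. \<phi> y ^ (k + m) *\<^sub>R \<Psi> y) y
          = \<phi> y ^ (k + m - k) *\<^sub>R (a * dir_deriv g \<phi> y ^ k) *\<^sub>R \<Psi> y + R y"
        by blast
      \<comment> \<open>For the k-th bracket the factors \<open>\<phi> ^ k\<close> are used up. What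
        remains is the affine factor times a nonzero field, and the remainder is invisible to the
        1-jet.\<close>
      have "vanishes 2 x R" using vanishes_mono[OF *(3), of 2] ms(3) by simp
      define \<Theta> where "\<Theta> = (\<lambda>y. (a * dir_deriv g \<phi> y ^ k) *\<^sub>R \<delta> y *\<^sub>R b)"
      have s\<Theta>: "smooth_on V \<Theta>"
        unfolding \<Theta>_def
        by (intro smooth_on_scaleR smooth_on_mult smooth_on_const smooth_on_power smooth_on_dir_deriv assms s\<phi>)
      have eq: "ad g k (\<lambda>y. \<phi> y ^ (k + m) *\<^sub>R \<Psi> y) y = (c \<bullet> (y - x)) *\<^sub>R \<Theta> y + R y" if "y \<in> V" for y
      proof -
        have "\<phi> y ^ m *\<^sub>R (a * dir_deriv g \<phi> y ^ k) *\<^sub>R \<Psi> y = (a * dir_deriv g \<phi> y ^ k) *\<^sub>R \<phi> y ^ m *\<^sub>R \<Psi> y"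
          by (rule scaleR_left_commute)
        also have "\<dots> = (c \<bullet> (y - x)) *\<^sub>R \<Theta> y"
          unfolding ms(2) \<Theta>_def by (rule scaleR_left_commute)
        finally show ?thesis using *(4) that by simp
      qed
      have "jet1 (ad g k (\<lambda>y. \<phi> y ^ (k + m) *\<^sub>R \<Psi> y)) x = jet1 (\<lambda>y. (c \<bullet> (y - x)) *\<^sub>R \<Theta> y + R y) x"
        by (rule jet1_cong[OF assms(1) eq assms(2)])
      also have "\<dots> = jet1 (\<lambda>y. (c \<bullet> (y - x)) *\<^sub>R \<Theta> y) x"
        using jet1_add[OF diff[OF smooth_on_scaleR[OF assms(1) s_aff s\<Theta>]] diff[OF *(2)]] jet1_vanishes[OF \<open>vanishes 2 x R\<close>]
        by simp
      finally have "v \<bullet> jet1 (ad g k (\<lambda>y. \<phi> y ^ (k + m) *\<^sub>R \<Psi> y)) x = \<Theta> x \<bullet> (S *v c)"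
        using inner_jet1_affine[OF diff[OF s\<Theta>]] v by simp
      also have "\<dots> = a * dir_deriv g \<phi> x ^ k * \<delta> x * (b \<bullet> b)"
        by (simp add: \<Theta>_def b(1))
      also have "\<dots> \<noteq> 0" using *(1) dd\<phi> assms(6) b(2) by simp
      finally show "v \<bullet> jet1 (ad g k (\<lambda>y. \<delta> y *\<^sub>R (\<phi> y ^ k * (c \<bullet> (y - x))) *\<^sub>R b)) x \<noteq> 0"
        unfolding ms(1) .
    qed
    have "\<exists>c b. \<forall>k. (\<forall>j<k. v \<bullet> jet1 (ad g j (\<lambda>y. \<delta> y *\<^sub>R (\<phi> y ^ k * (c \<bullet> (y - x))) *\<^sub>R b)) x = 0) \<and>
        v \<bullet> jet1 (ad g k (\<lambda>y. \<delta> y *\<^sub>R (\<phi> y ^ k * (c \<bullet> (y - x))) *\<^sub>R b)) x \<noteq> 0"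
    proof (cases "S *v g x = 0")
      case False
      define b where "b = S *v g x"
      define \<Psi> where "\<Psi> = (\<lambda>y. \<delta> y *\<^sub>R b)"
      have "\<delta> y *\<^sub>R (\<phi> y ^ k * (g x \<bullet> (y - x))) *\<^sub>R b = \<phi> y ^ (k + 1) *\<^sub>R \<Psi> y" for k y
        unfolding \<phi>_def \<Psi>_def scaleR_scaleR power_add power_one_right by (simp only: mult_ac)
      moreover have "\<phi> y ^ 1 *\<^sub>R \<Psi> y = (g x \<bullet> (y - x)) *\<^sub>R \<delta> y *\<^sub>R b" for y
        unfolding \<phi>_def \<Psi>_def by simp
      moreover have "b \<noteq> 0" "smooth_on V \<Psi>" using False s\<delta>b by (simp_all add: b_def \<Psi>_def)
      ultimately have "\<forall>k. (\<forall>j<k. v \<bullet> jet1 (ad g j (\<lambda>y. \<delta> y *\<^sub>R (\<phi> y ^ k * (g x \<bullet> (y - x))) *\<^sub>R b)) x = 0) \<and>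
        v \<bullet> jet1 (ad g k (\<lambda>y. \<delta> y *\<^sub>R (\<phi> y ^ k * (g x \<bullet> (y - x))) *\<^sub>R b)) x \<noteq> 0"
        using b_def by (intro main[of b "g x" 1 \<Psi> 0]) simp_all
      then show ?thesis by blast
    next
      case True
      obtain c0 where c0: "S *v c0 \<noteq> 0"
        using \<open>S \<noteq> 0\<close> by (metis matrix_eq matrix_vector_mult_0)
      \<comment> \<open>Projecting \<open>c0\<close> off \<open>g x\<close> leaves
        \<open>S *v c0\<close> unchanged, as \<open>S\<close> kills \<open>g x\<close>, and makes
        the affine factor constant to first order along \<open>g\<close>, so that
        \<open>lie_bracket g \<Psi>\<close> vanishes at \<open>x\<close> too.\<close>
      define c where "c = c0 - ((g x \<bullet> c0) / (g x \<bullet> g x)) *\<^sub>R g x"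
      have Sc: "S *v c = S *v c0"
        by (simp add: c_def matrix_vector_mult_diff_distrib matrix_vector_mult_scaleR True)
      have gc: "g x \<bullet> c = 0"
        using assms(5) by (simp add: c_def inner_diff_right)
      define \<Psi> where "\<Psi> = (\<lambda>y. (c \<bullet> (y - x)) *\<^sub>R \<delta> y *\<^sub>R (S *v c))"
      have "lie_bracket g \<Psi> x = 0"
        unfolding \<Psi>_def lie_bracket_scaleR[OF diff[OF assms(3)] diff[OF s_aff] diff[OF s\<delta>b]]
        using gc by (simp add: dd_aff)
      then have "vanishes 1 x (lie_bracket g \<Psi>)" "vanishes 1 x \<Psi>" by (simp_all add: vanishes_Suc \<Psi>_def)
      moreover have "smooth_on V \<Psi>" unfolding \<Psi>_def by (intro smooth_on_scaleR s_aff s\<delta>b assms)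
      moreover have "\<delta> y *\<^sub>R (\<phi> y ^ k * (c \<bullet> (y - x))) *\<^sub>R (S *v c) = \<phi> y ^ (k + 0) *\<^sub>R \<Psi> y" for k y
        unfolding \<Psi>_def scaleR_scaleR by (simp only: mult_ac add_0_right)
      moreover have "\<phi> y ^ 0 *\<^sub>R \<Psi> y = (c \<bullet> (y - x)) *\<^sub>R \<delta> y *\<^sub>R (S *v c)" for y
        unfolding \<Psi>_def by simp
      moreover have "S *v c \<noteq> 0" using Sc c0 by simp
      ultimately have "\<forall>k. (\<forall>j<k. v \<bullet> jet1 (ad g j (\<lambda>y. \<delta> y *\<^sub>R (\<phi> y ^ k * (c \<bullet> (y - x))) *\<^sub>R (S *v c))) x = 0) \<and>
        v \<bullet> jet1 (ad g k (\<lambda>y. \<delta> y *\<^sub>R (\<phi> y ^ k * (c \<bullet> (y - x))) *\<^sub>R (S *v c))) x \<noteq> 0"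
        by (intro main[of "S *v c" c 0 \<Psi> 1]) (simp_all add: mult_ac)
      then show ?thesis by blast
    qed
    then obtain c b where "\<forall>k. (\<forall>j<k. v \<bullet> jet1 (ad g j (\<lambda>y. \<delta> y *\<^sub>R (\<phi> y ^ k * (c \<bullet> (y - x))) *\<^sub>R b)) x = 0) \<and>
        v \<bullet> jet1 (ad g k (\<lambda>y. \<delta> y *\<^sub>R (\<phi> y ^ k * (c \<bullet> (y - x))) *\<^sub>R b)) x \<noteq> 0"
      by blast
    then show ?thesis
      by (intro exI[of _ c] exI[of _ "- (c \<bullet> x)"] exI[of _ b])
         (simp add: \<phi>_def inner_diff_right[of c])
  qed
qed

section \<open>Perturbation by polynomials\<close>

text \<open>\<open>None\<close> is the homogenising coordinate: each \<open>\<alpha> j\<close> selects one factor among \<open>1, y\<^sub>1, \<dots>, y\<^sub>n\<close>, so all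
  products of \<open>CARD('j)\<close> affine functions are combinations of these monomials.\<close>

definition monom_map :: "('j::finite \<Rightarrow> 'n option) \<Rightarrow> real^'n \<Rightarrow> real"
  where "monom_map \<alpha> y = (\<Prod>j\<in>UNIV. case \<alpha> j of None \<Rightarrow> 1 | Some i \<Rightarrow> y $ i)"

definition lin_comb :: "('c::finite \<Rightarrow> real^'n \<Rightarrow> real) \<Rightarrow> 'e::real_vector^'c \<Rightarrow> real^'n \<Rightarrow> 'e"
  where "lin_comb \<mu> \<theta> y = (\<Sum>c\<in>UNIV. \<mu> c y *\<^sub>R \<theta> $ c)"

lemma smooth_on_monom_map: "open V \<Longrightarrow> smooth_on V (monom_map \<alpha>)"
proof -
  assume V: "open V"
  have "smooth_on V (\<lambda>y. case \<alpha> j of None \<Rightarrow> 1 | Some i \<Rightarrow> y $ i)" for j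
    by (cases "\<alpha> j") (simp_all add: smooth_on_const smooth_on_linear bounded_linear_vec_nth)
  then show ?thesis
    unfolding monom_map_def[abs_def] by (intro smooth_on_prod V)
qed

lemma smooth_on_lin_comb:
  "open V \<Longrightarrow> (\<And>c. smooth_on V (\<mu> c)) \<Longrightarrow> smooth_on V (lin_comb \<mu> \<theta>)"
  unfolding lin_comb_def[abs_def] by (intro smooth_on_sum smooth_on_scaleR smooth_on_const)

text \<open>Distributivity expands the product over all choices of one summand per factor, and these
  choices are the index functions \<open>\<alpha>\<close>.\<close>

lemma affine_product_lin_comb:
  fixes C :: "'j::finite \<Rightarrow> real^'n" and b :: "'e::real_vector"
  shows "\<exists>\<theta> :: 'e^('j \<Rightarrow> 'n option). \<forall>y. lin_comb monom_map \<theta> y = (\<Prod>j\<in>UNIV. C j \<bullet> y + \<gamma> j) *\<^sub>R b"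
proof -
  define a where "a j k = (case k of None \<Rightarrow> \<gamma> j | Some i \<Rightarrow> C j $ i)" for j k
  have "C j \<bullet> y + \<gamma> j = (\<Sum>k\<in>UNIV. a j k * (case k of None \<Rightarrow> 1 | Some i \<Rightarrow> y $ i))" for j y
    by (simp add: UNIV_option_conv sum.reindex a_def inner_vec_def)
  then have "(\<Prod>j\<in>UNIV. C j \<bullet> y + \<gamma> j) = (\<Sum>\<alpha>\<in>UNIV. \<Prod>j\<in>UNIV. a j (\<alpha> j) * (case \<alpha> j of None \<Rightarrow> 1 | Some i \<Rightarrow> y $ i))"
    for y
    using prod_sum_PiE[of "UNIV :: 'j set" "\<lambda>_. UNIV :: 'n option set"
        "\<lambda>j k. a j k * (case k of None \<Rightarrow> 1 | Some i \<Rightarrow> y $ i)"] by (simp add: PiE_UNIV_domain)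
  then have "lin_comb monom_map (\<chi> \<alpha> :: 'j \<Rightarrow> 'n option. (\<Prod>j\<in>UNIV. a j (\<alpha> j)) *\<^sub>R b) y = (\<Prod>j\<in>UNIV. C j \<bullet> y + \<gamma> j) *\<^sub>R b" for y
    by (simp add: lin_comb_def monom_map_def prod.distrib scaleR_sum_left mult.commute)
  then show ?thesis by (intro exI allI)
qed

text \<open>Among the \<open>CARD('k) + 1\<close> available factors, \<open>None\<close> holds the
  affine one, \<open>k\<close> others equal \<open>g \<bullet> (y - x)\<close>, and the rest are
  padded with the constant 1.\<close>

lemma power_affine_lin_comb:
  fixes g c b :: "real^'n"
  assumes "k \<le> CARD('k)"
  shows "\<exists>\<theta> :: (real^'n)^('k::finite option \<Rightarrow> 'n option).
    \<forall>y. lin_comb monom_map \<theta> y = ((g \<bullet> (y - x)) ^ k * (c \<bullet> y + r)) *\<^sub>R b"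
proof -
  obtain J :: "'k set" where J: "card J = k"
    using assms obtain_subset_with_card_n by metis
  define C :: "'k option \<Rightarrow> real^'n" where "C j = (case j of None \<Rightarrow> c | Some i \<Rightarrow> if i \<in> J then g else 0)" for j
  define \<gamma> where "\<gamma> j = (case j of None \<Rightarrow> r | Some i \<Rightarrow> if i \<in> J then - (g \<bullet> x) else 1)" for j
  have "(\<Prod>i\<in>UNIV. C (Some i) \<bullet> y + \<gamma> (Some i)) = (g \<bullet> (y - x)) ^ k" for y
  proof -
    have "(\<Prod>i\<in>UNIV. C (Some i) \<bullet> y + \<gamma> (Some i)) = (\<Prod>i\<in>UNIV. if i \<in> J then g \<bullet> (y - x) else 1)"
      by (intro prod.cong) (auto simp: C_def \<gamma>_def inner_diff_right)
    also have "\<dots> = (\<Prod>i\<in>J. g \<bullet> (y - x))" by (simp add: prod.If_cases)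
    finally show ?thesis by (simp add: J)
  qed
  then have "(\<Prod>j\<in>UNIV. C j \<bullet> y + \<gamma> j) = (g \<bullet> (y - x)) ^ k * (c \<bullet> y + r)" for y
    by (simp add: UNIV_option_conv prod.reindex) (simp add: C_def \<gamma>_def mult.commute)
  then show ?thesis using affine_product_lin_comb[of C \<gamma> b] by simp
qed

section \<open>Affine dependence of the bracket jets on the perturbation\<close>

lemma ad_add:
  assumes "open V" "smooth_on V g" "smooth_on V u" "smooth_on V w" "x \<in> V"
  shows "ad g k (\<lambda>y. u y + w y) x = ad g k u x + ad g k w x"
  using assms(5)
proof (induction k arbitrary: x)
  case (Suc k)
  note diff = smooth_on_differentiable[OF _ Suc.prems]
  show ?case
    using lie_bracket_cong[OF assms(1) Suc.prems, of g g "ad g k (\<lambda>y. u y + w y)" "\<lambda>y. ad g k u y + ad g k w y"]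
      lie_bracket_add[OF diff[OF assms(2)] diff[OF smooth_on_ad[OF assms(1-3)]]
        diff[OF smooth_on_ad[OF assms(1,2,4)]], of k k] Suc.IH
    by simp
qed simp

lemma ad_scaleR:
  assumes "open V" "smooth_on V g" "smooth_on V u" "x \<in> V"
  shows "ad g k (\<lambda>y. c *\<^sub>R u y) x = c *\<^sub>R ad g k u x"
  using assms(4)
proof (induction k arbitrary: x)
  case (Suc k)
  note diff = smooth_on_differentiable[OF _ Suc.prems]
  have "dir_deriv g (\<lambda>y. c) x = 0" by (simp add: dir_deriv_def pd_const)
  then show ?case
    using lie_bracket_cong[OF assms(1) Suc.prems, of g g "ad g k (\<lambda>y. c *\<^sub>R u y)" "\<lambda>y. c *\<^sub>R ad g k u y"]
      lie_bracket_scaleR[OF diff[OF assms(2)] diff[OF smooth_on_const] diff[OF smooth_on_ad[OF assms(1-3)]], of c k]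
      Suc.IH
    by simp
qed simp

text \<open>Linearity of \<open>ad g k\<close> in the bracketed field makes the conditions affine in
  the polynomial coefficients, provided \<open>g\<close> itself stays fixed.\<close>

lemma jet1_ad_sum:
  assumes "open V" "smooth_on V g" "\<And>c. c \<in> C \<Longrightarrow> smooth_on V (u c)" "x \<in> V" "finite C"
  shows "jet1 (ad g k (\<lambda>y. \<Sum>c\<in>C. a c *\<^sub>R u c y)) x = (\<Sum>c\<in>C. a c *\<^sub>R jet1 (ad g k (u c)) x)"
  using assms(5,3)
proof (induction C rule: finite_induct)
  case (insert c C)
  note diff = smooth_on_differentiable[OF _ assms(4)]
  have s: "smooth_on V (u c)" "smooth_on V (\<lambda>y. a c *\<^sub>R u c y)" "smooth_on V (\<lambda>y. \<Sum>c\<in>C. a c *\<^sub>R u c y)"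
    by (auto intro!: smooth_on_sum[OF assms(1)] smooth_on_scaleR[OF assms(1) smooth_on_const] insert.prems)
  have "jet1 (ad g k (\<lambda>y. a c *\<^sub>R u c y + (\<Sum>c\<in>C. a c *\<^sub>R u c y))) x
      = jet1 (\<lambda>y. a c *\<^sub>R ad g k (u c) y + ad g k (\<lambda>y. \<Sum>c\<in>C. a c *\<^sub>R u c y) y) x"
    using ad_add[OF assms(1,2) s(2,3)] ad_scaleR[OF assms(1,2) s(1)]
    by (intro jet1_cong[OF assms(1) _ assms(4)]) simp
  also have "\<dots> = a c *\<^sub>R jet1 (ad g k (u c)) x + jet1 (ad g k (\<lambda>y. \<Sum>c\<in>C. a c *\<^sub>R u c y)) x"
    using diff[OF smooth_on_ad[OF assms(1,2) s(1)]] diff[OF smooth_on_ad[OF assms(1,2) s(3)]]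
    by (simp add: jet1_add jet1_scaleR)
  finally show ?case using insert by simp
next
  case empty
  have "ad g k (\<lambda>y. 0) y = 0 *\<^sub>R ad g k (\<lambda>y. 0) y" if "y \<in> V" for y
    using ad_scaleR[OF assms(1,2) smooth_on_const that, of k 0 0] by simp
  then have "jet1 (ad g k (\<lambda>y. 0)) x = jet1 (\<lambda>y. 0) x"
    by (intro jet1_cong[OF assms(1) _ assms(4)]) simp
  also have "\<dots> = 0"
    by (rule jet1_vanishes) (simp add: vanishes_def partials_const_0)
  finally show ?case by simp
qed

lemma differentiable_jet1:
  assumes "smooth_on V h" "x \<in> V"
  shows "jet1 h differentiable at x"
proof -
  have "(\<lambda>y. pd j h y $ c) differentiable at x" for j c
    using smooth_on_differentiable[OF smooth_on_pd[OF assms(1)] assms(2), of j]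
      bounded_linear.has_derivative[OF bounded_linear_vec_nth] unfolding differentiable_def by blast
  then have "(\<lambda>y. jacobian h (at y)) differentiable at x"
    by (intro differentiable_vecI) (simp add: jacobian_nth)
  then show ?thesis
    unfolding jet1_def using smooth_on_differentiable[OF assms]
    by (auto simp: differentiable_def intro: has_derivative_Pair)
qed

text \<open>Let \<open>a\<close> be a nonzero vector orthogonal to the range, and \<open>k\<close>
  the index of largest rank \<open>e k\<close> among its nonzero entries. For the parameter
  belonging to \<open>k\<close>, entries of lower rank vanish in \<open>A \<theta>\<close> and
  entries of higher rank vanish in \<open>a\<close>, so a single nonzero product is left.\<close>

lemma surj_triangular:
  fixes A :: "'e::real_vector \<Rightarrow> real^'k" and e :: "'k \<Rightarrow> nat"
  assumes "linear A" "inj e"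
    and "\<And>k. \<exists>\<theta>. (\<forall>j. e j < e k \<longrightarrow> A \<theta> $ j = 0) \<and> A \<theta> $ k \<noteq> 0"
  shows "surj A"
proof (rule ccontr)
  assume "\<not> surj A"
  moreover have "span (range A) = range A"
    using linear_subspace_image[OF assms(1) subspace_UNIV] by (simp add: span_eq_iff)
  ultimately obtain a where a': "a \<noteq> 0" "span (range A) \<subseteq> {z. a \<bullet> z = 0}"
    using span_not_univ_subset_hyperplane[of "range A"] by metis
  then have a: "a \<noteq> 0" "a \<bullet> A \<theta> = 0" for \<theta> using span_base[of "A \<theta>" "range A"] by auto
  define J where "J = {j. a $ j \<noteq> 0}"
  have "J \<noteq> {}" using a(1) by (auto simp: J_def vec_eq_iff)
  then have "Max (e ` J) \<in> e ` J" by (intro Max_in) simp_all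
  then obtain k where k: "k \<in> J" "e k = Max (e ` J)" by auto
  have k_max: "e j \<le> e k" if "j \<in> J" for j
    unfolding k(2) using that by (intro Max_ge) simp_all
  obtain \<theta> where \<theta>: "\<And>j. e j < e k \<Longrightarrow> A \<theta> $ j = 0" "A \<theta> $ k \<noteq> 0"
    using assms(3) by blast
  have "a $ j * A \<theta> $ j = 0" if "j \<noteq> k" for j
  proof (cases "j \<in> J")
    case True
    then have "e j < e k" using k_max[OF True] that assms(2) by (meson injD le_neq_implies_less)
    then show ?thesis using \<theta>(1) by simp
  qed (simp add: J_def)
  then have "(\<Sum>j\<in>UNIV - {k}. a $ j * A \<theta> $ j) = 0" by (intro sum.neutral) blast
  then have "a \<bullet> A \<theta> = a $ k * A \<theta> $ k"
    unfolding inner_vec_def by (subst sum.remove[of _ k]) simp_all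
  then show False using a(2)[of \<theta>] k(1) \<theta>(2) by (simp add: J_def)
qed

lemma negligible_non_spanning:
  fixes V :: "(real^'n) set" and w g :: "real^'n \<Rightarrow> real^'n"
  assumes "open V" "smooth_on V g" "smooth_on V w" "smooth_on V \<delta>"
    and "\<And>x. x \<in> V \<Longrightarrow> g x \<noteq> 0 \<Longrightarrow> \<delta> x \<noteq> 0"
    and card: "2 * CARD('n) + CARD('n) * CARD('n) < CARD('k::finite)"
  shows "negligible {\<theta> :: (real^'n)^('k option \<Rightarrow> 'n option). \<exists>x\<in>V. g x \<noteq> 0 \<and>
    span (bracket_jets g (\<lambda>y. w y + \<delta> y *\<^sub>R lin_comb monom_map \<theta> y) CARD('k) x) \<noteq> UNIV}"
proof -
  obtain e :: "'k \<Rightarrow> nat" where e: "bij_betw e UNIV {1..CARD('k)}"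
    using finite_same_card_bij[of "UNIV :: 'k set" "{1..CARD('k)}"] by auto
  have "inj e" using e by (simp add: bij_betw_def)
  have e_le: "e k \<le> CARD('k)" for k using e by (auto simp: bij_betw_def)
  \<comment> \<open>The covector is only required to be nonzero. Not normalising it costs one more
    bracket but keeps \<open>U\<close> open in a Euclidean space.\<close>
  define U where "U = {\<xi> :: (real^'n) \<times> ((real^'n) \<times> (real^'n^'n)). fst \<xi> \<in> V \<and> g (fst \<xi>) \<noteq> 0 \<and> snd \<xi> \<noteq> 0}"
  define u :: "(real^'n)^('k option \<Rightarrow> 'n option) \<Rightarrow> real^'n \<Rightarrow> real^'n"
    where "u \<theta> = (\<lambda>y. \<delta> y *\<^sub>R lin_comb monom_map \<theta> y)" for \<theta>
  have su: "smooth_on V (u \<theta>)" for \<theta>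
    unfolding u_def by (intro smooth_on_scaleR smooth_on_lin_comb smooth_on_monom_map assms)
  \<comment> \<open>Expansion in a basis makes \<open>A \<xi>\<close> linear for every
    \<open>\<xi>\<close>, also for points outside \<open>V\<close>, where nothing is known about the
    brackets; on \<open>V\<close> it agrees with the direct formula.\<close>
  define A where "A \<xi> \<theta> = (\<chi> k. \<Sum>b\<in>Basis. (\<theta> \<bullet> b) * (snd \<xi> \<bullet> jet1 (ad g (e k) (u b)) (fst \<xi>)))"
    for \<xi> :: "(real^'n) \<times> ((real^'n) \<times> (real^'n^'n))" and \<theta>
  define B where "B \<xi> = (\<chi> k. snd \<xi> \<bullet> jet1 (ad g (e k) w) (fst \<xi>))"
    for \<xi> :: "(real^'n) \<times> ((real^'n) \<times> (real^'n^'n))"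
  have u_sum: "u \<theta> = (\<lambda>y. \<Sum>b\<in>Basis. (\<theta> \<bullet> b) *\<^sub>R u b y)" for \<theta>
  proof
    fix y
    have "linear (\<lambda>\<theta>. u \<theta> y)"
      unfolding u_def lin_comb_def
      by (rule linearI) (simp_all add: scaleR_right_distrib sum.distrib scaleR_sum_right mult_ac)
    then show "u \<theta> y = (\<Sum>b\<in>Basis. (\<theta> \<bullet> b) *\<^sub>R u b y)"
      using linear_sum[of "\<lambda>\<theta>. u \<theta> y" "\<lambda>b. (\<theta> \<bullet> b) *\<^sub>R b" Basis] linear_cmul[of "\<lambda>\<theta>. u \<theta> y"]
      by (simp add: euclidean_representation)
  qed
  have A_nth: "A \<xi> \<theta> $ k = snd \<xi> \<bullet> jet1 (ad g (e k) (u \<theta>)) (fst \<xi>)" if "fst \<xi> \<in> V" for \<xi> \<theta> k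
    using jet1_ad_sum[where u = u and C = Basis and a = "\<lambda>b. \<theta> \<bullet> b" and k = "e k",
        OF assms(1,2) su that finite_Basis]
    unfolding A_def u_sum[of \<theta>] by (simp add: inner_sum_right)
  have lin: "linear (A \<xi>)" for \<xi>
    unfolding A_def
    by (rule linearI) (simp_all add: vec_eq_iff inner_add_left sum.distrib algebra_simps sum_distrib_left)
  have d_inner: "(\<lambda>\<xi>. snd \<xi> \<bullet> jet1 (ad g k h) (fst \<xi>)) differentiable at \<xi>"
    if "fst \<xi> \<in> V" "smooth_on V h"
    for h k and \<xi> :: "(real^'n) \<times> ((real^'n) \<times> (real^'n^'n))"
  proof -
    have "fst differentiable at \<xi>" "snd differentiable at \<xi>"
      by (simp_all add: bounded_linear_imp_differentiable bounded_linear_fst bounded_linear_snd)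
    moreover have "(\<lambda>\<xi>. jet1 (ad g k h) (fst \<xi>)) differentiable at \<xi>"
      using differentiable_jet1[OF smooth_on_ad[OF assms(1,2) that(2)] that(1), of k]
        differentiable_chain_at[OF calculation(1)] by (simp add: o_def)
    ultimately show ?thesis by simp
  qed
  have "negligible {\<theta>. \<exists>\<xi>\<in>U. A \<xi> \<theta> + B \<xi> = 0}"
  proof (rule negligible_zero_parameters)
    show "DIM((real^'n) \<times> ((real^'n) \<times> (real^'n^'n))) < CARD('k)" using card by simp
    show "linear (A \<xi>)" for \<xi> by (rule lin)
    have "open (V \<inter> g -` (- {0}))"
      using smooth_on_continuous[OF assms(2)] assms(1) by (intro continuous_open_preimage) auto
    then have "open ((V \<inter> g -` (- {0})) \<times> (- {0 :: (real^'n) \<times> (real^'n^'n)}))"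
      by (intro open_Times) auto
    then show "open U" unfolding U_def by (rule back_subst[where P = "open"]) auto
    show "(\<lambda>\<xi>. A \<xi> \<theta>) differentiable at \<xi>" if "\<xi> \<in> U" for \<xi> \<theta>
      unfolding A_def using that
      by (intro differentiable_vecI) (simp add: U_def differentiable_sum' d_inner su)
    show "B differentiable at \<xi>" if "\<xi> \<in> U" for \<xi>
      unfolding B_def[abs_def] using that
      by (intro differentiable_vecI) (simp add: U_def d_inner assms)
    show "surj (A \<xi>)" if "\<xi> \<in> U" for \<xi>
    proof (rule surj_triangular[OF lin \<open>inj e\<close>])
      fix k
      obtain x v where \<xi>: "\<xi> = (x, v)" by (cases \<xi>)
      then have x: "x \<in> V" "g x \<noteq> 0" "v \<noteq> 0" "\<delta> x \<noteq> 0" using that assms(5) by (auto simp: U_def)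
      obtain c r b where sep:
        "\<forall>k. (\<forall>j<k. v \<bullet> jet1 (ad g j (\<lambda>y. \<delta> y *\<^sub>R ((g x \<bullet> (y - x)) ^ k * (c \<bullet> y + r)) *\<^sub>R b)) x = 0) \<and>
          v \<bullet> jet1 (ad g k (\<lambda>y. \<delta> y *\<^sub>R ((g x \<bullet> (y - x)) ^ k * (c \<bullet> y + r)) *\<^sub>R b)) x \<noteq> 0"
        using exists_separating_perturbation[OF assms(1) x(1) assms(2,4) x(2,4,3)] by blast
      obtain \<theta> :: "(real^'n)^('k option \<Rightarrow> 'n option)"
        where \<theta>: "\<forall>y. lin_comb monom_map \<theta> y = ((g x \<bullet> (y - x)) ^ e k * (c \<bullet> y + r)) *\<^sub>R b"
        using power_affine_lin_comb[OF e_le] by blast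
      have "u \<theta> = (\<lambda>y. \<delta> y *\<^sub>R ((g x \<bullet> (y - x)) ^ e k * (c \<bullet> y + r)) *\<^sub>R b)"
        by (simp add: u_def \<theta>)
      then have "(\<forall>j. e j < e k \<longrightarrow> A \<xi> \<theta> $ j = 0) \<and> A \<xi> \<theta> $ k \<noteq> 0"
        using sep x(1) by (simp add: A_nth \<xi>)
      then show "\<exists>\<theta>. (\<forall>j. e j < e k \<longrightarrow> A \<xi> \<theta> $ j = 0) \<and> A \<xi> \<theta> $ k \<noteq> 0" by blast
    qed
  qed
  moreover have "\<exists>\<xi>\<in>U. A \<xi> \<theta> + B \<xi> = 0"
    if x: "x \<in> V" "g x \<noteq> 0" and ns: "span (bracket_jets g (\<lambda>y. w y + u \<theta> y) CARD('k) x) \<noteq> UNIV" for x \<theta>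
  proof -
    from span_not_univ_subset_hyperplane[OF ns] obtain v where v: "v \<noteq> 0"
      "span (bracket_jets g (\<lambda>y. w y + u \<theta> y) CARD('k) x) \<subseteq> {z. v \<bullet> z = 0}" by blast
    have "(A (x, v) \<theta> + B (x, v)) $ k = 0" for k
    proof -
      note diff = smooth_on_differentiable[OF smooth_on_ad[OF assms(1,2)] x(1)]
      have "jet1 (ad g (e k) (\<lambda>y. w y + u \<theta> y)) x = jet1 (\<lambda>y. ad g (e k) w y + ad g (e k) (u \<theta>) y) x"
        by (rule jet1_cong[OF assms(1) ad_add[OF assms(1-3) su] x(1)])
      also have "\<dots> = jet1 (ad g (e k) w) x + jet1 (ad g (e k) (u \<theta>)) x"
        by (rule jet1_add[OF diff[OF assms(3)] diff[OF su]])
      finally have "(A (x, v) \<theta> + B (x, v)) $ k = v \<bullet> jet1 (ad g (e k) (\<lambda>y. w y + u \<theta> y)) x"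
        using x(1) by (simp add: A_nth B_def inner_add_right)
      also have "\<dots> = 0"
      proof -
        have "e k \<in> {1..CARD('k)}" using e by (auto simp: bij_betw_def)
        then have "jet1 (ad g (e k) (\<lambda>y. w y + u \<theta> y)) x \<in> bracket_jets g (\<lambda>y. w y + u \<theta> y) CARD('k) x"
          unfolding bracket_jets_def by (rule imageI)
        from subsetD[OF v(2) span_base[OF this]] show ?thesis by simp
      qed
      finally show ?thesis .
    qed
    then have "A (x, v) \<theta> + B (x, v) = 0" by (simp add: vec_eq_iff)
    moreover have "(x, v) \<in> U" using x v(1) by (simp add: U_def)
    ultimately show ?thesis by blast
  qed
  ultimately show ?thesis
    unfolding u_def by (elim negligible_subset) blast
qed

section \<open>Smooth scaling functions\<close>

text \<open>The powers of \<open>inverse t\<close> in front of the usual flat function make the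
  family closed under differentiation, so one induction over all \<open>m\<close> gives
  smoothness.\<close>

definition flat_exp :: "nat \<Rightarrow> real \<Rightarrow> real"
  where "flat_exp m t = (if t \<le> 0 then 0 else inverse t ^ m * exp (- inverse t))"

lemma flat_exp_tendsto_0: "(flat_exp m \<longlongrightarrow> 0) (at_right 0)"
proof -
  have "((\<lambda>t. inverse t ^ m / exp (inverse t)) \<longlongrightarrow> (0::real)) (at_right 0)"
    using filterlim_compose[OF tendsto_power_div_exp_0[of m] filterlim_inverse_at_top_right] .
  moreover have "\<forall>\<^sub>F t in at_right 0. inverse t ^ m / exp (inverse t) = flat_exp m t"
    using eventually_at_right_less[of "0::real"]
    by eventually_elim (simp add: flat_exp_def exp_minus divide_inverse)
  ultimately show ?thesis by (rule Lim_transform_eventually)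
qed

lemma has_real_derivative_flat_exp:
  "(flat_exp m has_real_derivative - real m * flat_exp (m + 1) t + flat_exp (m + 2) t) (at t)"
proof -
  consider "t < 0" | "t > 0" | "t = 0" by linarith
  then show ?thesis
  proof cases
    case 1
    have "((\<lambda>_. 0) has_real_derivative 0) (at t)" by simp
    then have "(flat_exp m has_real_derivative 0) (at t)"
      by (rule has_field_derivative_transform_within_open[of _ _ _ "{..<0}"])
         (use 1 in \<open>auto simp: flat_exp_def\<close>)
    then show ?thesis using 1 by (simp add: flat_exp_def)
  next
    case 2
    define s where "s = inverse t"
    have inv: "(inverse has_real_derivative - (s * s)) (at t)"
      using DERIV_inverse[of t] 2 by (simp add: s_def)
    have D: "((\<lambda>t. inverse t ^ m * exp (- inverse t)) has_real_derivative
        real m * (- (s * s) * s ^ (m - Suc 0)) * exp (- s) + exp (- s) * (- (- (s * s))) * s ^ m) (at t)"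
      unfolding s_def
      by (intro DERIV_mult DERIV_power DERIV_fun_exp DERIV_minus inv[unfolded s_def])
    have E: "real m * (- (s * s) * s ^ (m - Suc 0)) * exp (- s) + exp (- s) * (- (- (s * s))) * s ^ m
        = - real m * (s ^ (m + 1) * exp (- s)) + s ^ (m + 2) * exp (- s)"
      by (cases m) (simp_all add: algebra_simps)
    have "((\<lambda>t. inverse t ^ m * exp (- inverse t)) has_real_derivative
        - real m * (inverse t ^ (m + 1) * exp (- inverse t)) + inverse t ^ (m + 2) * exp (- inverse t)) (at t)"
      by (rule DERIV_cong[OF D E, unfolded s_def])
    then have "(flat_exp m has_real_derivative
        - real m * (inverse t ^ (m + 1) * exp (- inverse t)) + inverse t ^ (m + 2) * exp (- inverse t)) (at t)"
      by (rule has_field_derivative_transform_within_open[of _ _ _ "{0<..}"])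
         (use 2 in \<open>auto simp: flat_exp_def\<close>)
    then show ?thesis using 2 by (simp add: flat_exp_def)
  next
    case 3
    \<comment> \<open>To the right of 0 the difference quotient is the family member of the next
      index, which tends to 0.\<close>
    have "((\<lambda>h. flat_exp m h / h) \<longlongrightarrow> 0) (at_right 0)"
    proof (rule Lim_transform_eventually[OF flat_exp_tendsto_0[of "Suc m"]])
      show "\<forall>\<^sub>F h in at_right 0. flat_exp (Suc m) h = flat_exp m h / h"
        using eventually_at_right_less[of "0::real"]
        by eventually_elim (simp add: flat_exp_def divide_inverse)
    qed
    moreover have "((\<lambda>h. flat_exp m h / h) \<longlongrightarrow> 0) (at_left 0)"
    proof (rule Lim_transform_eventually[OF tendsto_const])
      show "\<forall>\<^sub>F h in at_left 0. 0 = flat_exp m h / h"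
        by (auto simp: eventually_at_filter flat_exp_def intro!: always_eventually)
    qed
    ultimately have "((\<lambda>h. flat_exp m h / h) \<longlongrightarrow> 0) (at 0)"
      using filterlim_at_split by blast
    then show ?thesis using 3 by (simp add: has_field_derivative_iff flat_exp_def)
  qed
qed

lemma smooth_on_flat_exp:
  fixes q :: "real^'n \<Rightarrow> real"
  assumes "open V" "smooth_on V q"
  shows "smooth_on V (\<lambda>y. flat_exp m (q y))"
proof -
  have deriv: "((\<lambda>y. flat_exp m (q y)) has_derivative
      (\<lambda>h. (- real m * flat_exp (m + 1) (q y) + flat_exp (m + 2) (q y)) * frechet_derivative q (at y) h)) (at y)"
    if "y \<in> V" for m y
    using has_derivative_compose[OF differentiableD[OF smooth_on_differentiable[OF assms(2) that]]
        has_real_derivative_flat_exp[of m "q y", unfolded has_field_derivative_def]] .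
  have "ck_on k V (\<lambda>y. flat_exp m (q y))" for k
  proof (induction k arbitrary: m)
    case 0
    show ?case unfolding ck_on_0 using deriv differentiable_def by blast
  next
    case (Suc k)
    have "ck_on k V (pd i (\<lambda>y. flat_exp m (q y)))" for i
    proof (rule ck_on_cong[OF assms(1)])
      show "ck_on k V (\<lambda>y. (- real m * flat_exp (m + 1) (q y) + flat_exp (m + 2) (q y)) * pd i q y)"
        using smooth_on_pd[OF assms(2), of i]
        by (intro ck_on_bilinear[OF assms(1) bounded_bilinear_mult] ck_on_add[OF assms(1)] ck_on_const Suc.IH)
           (simp add: smooth_on_ck)
    qed (simp add: pd_eq[OF deriv])
    then show ?case unfolding ck_on_Suc using deriv differentiable_def by blast
  qed
  then show ?thesis by (simp add: smooth_on_ck)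
qed

lemma exists_bump:
  fixes a :: "real^'n"
  assumes "r > 0"
  shows "\<exists>\<beta>. smooth_on UNIV \<beta> \<and> (\<forall>y. \<beta> y \<ge> 0) \<and> (\<forall>y\<in>ball a r. \<beta> y > 0) \<and> (\<forall>y. y \<notin> ball a r \<longrightarrow> \<beta> y = (0::real))"
proof -
  define q where "q = (\<lambda>y. r\<^sup>2 - (y - a) \<bullet> (y - a))"
  have "smooth_on UNIV (\<lambda>y. y - a)"
    by (rule smooth_on_diff[OF open_UNIV smooth_on_linear[OF bounded_linear_ident] smooth_on_const])
  then have "smooth_on UNIV q"
    unfolding q_def by (intro smooth_on_diff[OF open_UNIV smooth_on_const] smooth_on_inner[OF open_UNIV])
  then have "smooth_on UNIV (\<lambda>y. flat_exp 0 (q y))" by (intro smooth_on_flat_exp open_UNIV)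
  moreover have "q y > 0 \<longleftrightarrow> y \<in> ball a r" for y
    using assms power_less_imp_less_base[of "norm (y - a)" 2 r] power_strict_mono[of "norm (y - a)" r 2]
    by (auto simp: q_def power2_norm_eq_inner[symmetric] dist_norm norm_minus_commute)
  ultimately show ?thesis
    by (intro exI[of _ "\<lambda>y. flat_exp 0 (q y)"]) (force simp: flat_exp_def)
qed

lemma partials_bounded:
  fixes h :: "real^'n \<Rightarrow> 'b::real_normed_vector"
  assumes "smooth_on UNIV h" "\<And>y. y \<notin> cball a r \<Longrightarrow> h y = 0"
  shows partials_outside: "y \<notin> cball a r \<Longrightarrow> partials is h y = 0"
    and "\<exists>M. \<forall>y. norm (partials is h y) \<le> M"
proof -
  show out: "partials is h y = 0" if "y \<notin> cball a r" for y
  proof -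
    have "partials is h y = partials is (\<lambda>_. 0) y"
      by (rule partials_cong[of "- cball a r"]) (use that assms(2) in \<open>auto intro: open_Compl\<close>)
    then show ?thesis by (simp add: partials_const_0)
  qed
  have "compact (partials is h ` cball a r)"
    by (rule compact_continuous_image[OF continuous_on_subset[OF
          smooth_on_continuous[OF smooth_on_partials[OF assms(1)]] subset_UNIV] compact_cball])
  then obtain M where "\<forall>z\<in>partials is h ` cball a r. norm z \<le> M"
    using compact_imp_bounded bounded_iff by blast
  then have "norm (partials is h y) \<le> max M 0" for y
    using out[of y] by (cases "y \<in> cball a r") (auto simp: le_max_iff_disj)
  then show "\<exists>M. \<forall>y. norm (partials is h y) \<le> M" by blast
qed

lemma geometric_tail:
  fixes a :: "nat \<Rightarrow> real"
  assumes "\<And>k. k \<ge> N \<Longrightarrow> \<bar>a k\<bar> \<le> (1/2)^k"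
  shows "summable a" and "n \<ge> N \<Longrightarrow> \<bar>(\<Sum>k<n. a k) - suminf a\<bar> \<le> 2 * (1/2)^n"
proof -
  have g: "summable (\<lambda>k. (1/2::real)^k)" by (simp add: summable_geometric)
  show s: "summable a"
    using assms by (intro summable_comparison_test[OF _ g]) auto
  assume "n \<ge> N"
  have "suminf a = (\<Sum>k. a (k + n)) + (\<Sum>k<n. a k)" by (rule suminf_split_initial_segment[OF s])
  then have "\<bar>(\<Sum>k<n. a k) - suminf a\<bar> = \<bar>\<Sum>k. a (k + n)\<bar>" by simp
  also have "\<dots> \<le> (\<Sum>k. (1/2)^n * (1/2)^k)"
  proof (rule norm_suminf_le[where f = "\<lambda>k. a (k + n)", unfolded real_norm_def])
    show "\<bar>a (k + n)\<bar> \<le> (1/2)^n * (1/2)^k" for k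
      using assms[of "k + n"] \<open>n \<ge> N\<close> by (simp add: power_add mult.commute)
    show "summable (\<lambda>k. (1/2::real)^n * (1/2)^k)" by (intro summable_mult g)
  qed
  also have "\<dots> = 2 * (1/2)^n" using suminf_mult[OF g, of "(1/2)^n"] suminf_geometric[of "1/2::real"] by simp
  finally show "\<bar>(\<Sum>k<n. a k) - suminf a\<bar> \<le> 2 * (1/2)^n" .
qed

text \<open>The threshold \<open>N\<close> may depend on the list of derivatives. This allows the
  k-th term to be controlled only up to an order growing with \<open>k\<close>, while every
  differentiated series still converges uniformly.\<close>

lemma smooth_series:
  fixes u :: "nat \<Rightarrow> real^'n \<Rightarrow> real"
  assumes smooth: "\<And>k. smooth_on UNIV (u k)"
    and bound: "\<And>is. \<exists>N. \<forall>k\<ge>N. \<forall>y. \<bar>partials is (u k) y\<bar> \<le> (1/2)^k"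
  shows "smooth_on UNIV (\<lambda>y. \<Sum>k. u k y)"
    and "partials is (\<lambda>y. \<Sum>k. u k y) y = (\<Sum>k. partials is (u k) y)"
    and "summable (\<lambda>k. partials is (u k) y)"
proof -
  define S where "S is y = (\<Sum>k. partials is (u k) y)" for "is" y
  have sum: "summable (\<lambda>k. partials is (u k) y)" for "is" y
    using bound[of "is"] geometric_tail(1) by metis
  have deriv: "(S is has_derivative (\<lambda>h. \<Sum>i\<in>UNIV. h $ i * S (i # is) y)) (at y)" for "is" y
  proof -
    have "\<forall>i. \<exists>N. \<forall>k\<ge>N. \<forall>y. \<bar>partials (i # is) (u k) y\<bar> \<le> (1/2)^k" using bound by blast
    from choice[OF this] obtain N where N: "\<And>i k y. k \<ge> N i \<Longrightarrow> \<bar>partials (i # is) (u k) y\<bar> \<le> (1/2)^k"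
      by blast
    define d where "d k y h = (\<Sum>i\<in>UNIV. h $ i * partials (i # is) (u k) y)" for k y and h :: "real^'n"
    have d: "(partials is (u k) has_derivative d k y) (at y)" for k y
    proof -
      have diff: "partials is (u k) differentiable at y"
        using smooth_on_differentiable[OF smooth_on_partials[OF smooth]] by blast
      have "frechet_derivative (partials is (u k)) (at y) = d k y"
      proof
        show "frechet_derivative (partials is (u k)) (at y) h = d k y h" for h
          using frechet_pd[OF diff, of h] by (simp only: d_def partials.simps real_scaleR_def)
      qed
      then show ?thesis using differentiableD[OF diff] by simp
    qed
    have "\<exists>g. \<forall>x\<in>UNIV. (\<lambda>k. partials is (u k) x) sums g x \<and>
        (g has_derivative (\<lambda>h. \<Sum>i\<in>UNIV. h $ i * S (i # is) x)) (at x within UNIV)"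
    proof (rule has_derivative_series[where f' = d])
      show "(partials is (u k) has_derivative d k x) (at x within UNIV)" for k x by (rule d)
      show "(\<lambda>k. partials is (u k) y) sums S is y" unfolding S_def by (rule summable_sums[OF sum])
      fix e :: real assume "e > 0"
      \<comment> \<open>One geometric tail, of size at most \<open>2 * (1/2)^n\<close>, for each
        coordinate direction.\<close>
      define C where "C = real CARD('n) * 2"
      have "(\<lambda>n. C * (1/2)^n) \<longlonglongrightarrow> 0"
        by (intro tendsto_mult_right_zero LIMSEQ_power_zero) simp
      then have "\<forall>\<^sub>F n in sequentially. C * (1/2)^n < e"
        using \<open>e > 0\<close> by (rule order_tendstoD)
      moreover have "\<forall>\<^sub>F n in sequentially. \<forall>i\<in>UNIV. N i \<le> n"
        by (intro eventually_ball_finite ballI eventually_ge_at_top finite_class.finite_UNIV)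
      ultimately show "\<forall>\<^sub>F n in sequentially. \<forall>x\<in>UNIV. \<forall>h.
          norm ((\<Sum>k<n. d k x h) - (\<Sum>i\<in>UNIV. h $ i * S (i # is) x)) \<le> e * norm h"
      proof eventually_elim
        case (elim n)
        show ?case
        proof (intro ballI allI)
          fix x :: "real^'n" and h :: "real^'n"
          have "(\<Sum>k<n. d k x h) = (\<Sum>i\<in>UNIV. h $ i * (\<Sum>k<n. partials (i # is) (u k) x))"
            unfolding d_def by (subst sum.swap) (simp only: sum_distrib_left)
          then have "(\<Sum>k<n. d k x h) - (\<Sum>i\<in>UNIV. h $ i * S (i # is) x)
              = (\<Sum>i\<in>UNIV. h $ i * ((\<Sum>k<n. partials (i # is) (u k) x) - S (i # is) x))"
            by (simp only: sum_subtractf right_diff_distrib)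
          also have "norm \<dots> \<le> (\<Sum>i\<in>(UNIV::'n set). norm h * (2 * (1/2)^n))"
          proof (rule sum_norm_le)
            fix i
            have "\<bar>(\<Sum>k<n. partials (i # is) (u k) x) - S (i # is) x\<bar> \<le> 2 * (1/2)^n"
              unfolding S_def using elim N by (intro geometric_tail(2)[of "N i"]) auto
            then show "norm (h $ i * ((\<Sum>k<n. partials (i # is) (u k) x) - S (i # is) x)) \<le> norm h * (2 * (1/2)^n)"
              unfolding real_norm_def abs_mult by (intro mult_mono component_le_norm_cart) auto
          qed
          also have "\<dots> = C * (1/2)^n * norm h" by (simp add: C_def)
          also have "\<dots> \<le> e * norm h" using elim by (intro mult_right_mono) auto
          finally show "norm ((\<Sum>k<n. d k x h) - (\<Sum>i\<in>UNIV. h $ i * S (i # is) x)) \<le> e * norm h" .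
        qed
      qed
    qed simp_all
    then obtain g where g: "\<And>x. (\<lambda>k. partials is (u k) x) sums g x"
      "\<And>x. (g has_derivative (\<lambda>h. \<Sum>i\<in>UNIV. h $ i * S (i # is) x)) (at x)" by blast
    have "g = S is"
      by (rule ext) (simp only: S_def sums_unique[OF g(1)])
    then show ?thesis using g(2) by simp
  qed
  have S: "partials is (\<lambda>y. \<Sum>k. u k y) = S is" for "is"
  proof (induction "is")
    case (Cons i "is")
    have "pd i (S is) y = S (i # is) y" for y
    proof -
      have "pd i (S is) y = (\<Sum>j\<in>UNIV. axis i 1 $ j * S (j # is) y)" by (rule pd_eq[OF deriv])
      also have "\<dots> = (\<Sum>j\<in>UNIV. if j = i then S (j # is) y else 0)"
        by (intro sum.cong) (auto simp: axis_def)
      finally show ?thesis by simp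
    qed
    then show ?case using Cons by simp
  qed (simp add: S_def[abs_def])
  show "partials is (\<lambda>y. \<Sum>k. u k y) y = (\<Sum>k. partials is (u k) y)" by (simp add: S S_def)
  show "smooth_on UNIV (\<lambda>y. \<Sum>k. u k y)"
    unfolding smooth_on_def S using deriv differentiable_def by blast
  show "summable (\<lambda>k. partials is (u k) y)" by (rule sum)
qed

lemma countable_ball_cover:
  fixes V :: "(real^'n) set"
  assumes "V0 \<subseteq> V" "open V0" "loc_pos V \<eta>" "V0 \<noteq> {}"
  shows "\<exists>(a :: nat \<Rightarrow> real^'n) r e. V0 = (\<Union>k. ball (a k) (r k)) \<and>
    (\<forall>k. 0 < r k \<and> 0 < e k \<and> cball (a k) (r k) \<subseteq> V0 \<and> (\<forall>y\<in>cball (a k) (r k). e k \<le> \<eta> y))"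
proof -
  have "\<exists>r e. 0 < r \<and> 0 < e \<and> cball x r \<subseteq> V0 \<and> (\<forall>y\<in>cball x r. e \<le> \<eta> y)" if "x \<in> V0" for x
  proof -
    obtain r e where r: "r > 0" "e > 0" "\<forall>y\<in>ball x r. e \<le> \<eta> y"
      using assms(1,3) \<open>x \<in> V0\<close> unfolding loc_pos_def by blast
    obtain s where s: "s > 0" "cball x s \<subseteq> V0"
      using assms(2) \<open>x \<in> V0\<close> open_contains_cball by blast
    have "cball x (min s (r/2)) \<subseteq> cball x s \<inter> ball x r" using r(1) by auto
    then show ?thesis
      using r s by (intro exI[of _ "min s (r/2)"] exI[of _ e] conjI) auto
  qed
  then have "\<forall>x. \<exists>r e. x \<in> V0 \<longrightarrow> 0 < r \<and> 0 < e \<and> cball x r \<subseteq> V0 \<and> (\<forall>y\<in>cball x r. e \<le> \<eta> y)"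
    by blast
  from choice[OF this] obtain R where "\<forall>x. \<exists>e. x \<in> V0 \<longrightarrow> 0 < R x \<and> 0 < e \<and> cball x (R x) \<subseteq> V0 \<and>
      (\<forall>y\<in>cball x (R x). e \<le> \<eta> y)" by blast
  from choice[OF this] obtain E where RE: "\<And>x. x \<in> V0 \<Longrightarrow> 0 < R x \<and> 0 < E x \<and> cball x (R x) \<subseteq> V0 \<and>
      (\<forall>y\<in>cball x (R x). E x \<le> \<eta> y)" by blast
  have opn: "open S" if "S \<in> (\<lambda>x. ball x (R x)) ` V0" for S using that by auto
  obtain \<F> where \<F>: "\<F> \<subseteq> (\<lambda>x. ball x (R x)) ` V0" "countable \<F>"
    "\<Union>\<F> = \<Union>((\<lambda>x. ball x (R x)) ` V0)"
    by (rule Lindelof[OF opn])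
  obtain X where X: "X \<subseteq> V0" "countable X" "\<F> = (\<lambda>x. ball x (R x)) ` X"
    using iffD1[OF countable_subset_image conjI[OF \<F>(2,1)]] by blast
  have cover: "V0 = (\<Union>x\<in>X. ball x (R x))"
  proof -
    have "ball x (R x) \<subseteq> V0" if "x \<in> V0" for x
      using RE[OF that] ball_subset_cball[of x "R x"] by (meson order_trans)
    moreover have "x \<in> ball x (R x)" if "x \<in> V0" for x using RE[OF that] by simp
    ultimately have "(\<Union>x\<in>V0. ball x (R x)) = V0" by blast
    then show ?thesis using \<F>(3) unfolding X(3) by simp
  qed
  then have "X \<noteq> {}" using assms(4) by blast
  then have rng: "range (from_nat_into X) = X" using X(2) by (rule range_from_nat_into)
  have inX: "from_nat_into X k \<in> V0" for k using rng X(1) by blast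
  have UN_eq: "(\<Union>k. ball (from_nat_into X k) (R (from_nat_into X k))) = (\<Union>x\<in>range (from_nat_into X). ball x (R x))"
    by (simp only: image_image)
  have "V0 = (\<Union>k. ball (from_nat_into X k) (R (from_nat_into X k)))"
    by (rule trans[OF cover]) (simp only: UN_eq rng)
  moreover have "\<forall>k. 0 < R (from_nat_into X k) \<and> 0 < E (from_nat_into X k) \<and>
      cball (from_nat_into X k) (R (from_nat_into X k)) \<subseteq> V0 \<and>
      (\<forall>y\<in>cball (from_nat_into X k) (R (from_nat_into X k)). E (from_nat_into X k) \<le> \<eta> y)"
    by (intro allI RE inX)
  ultimately show ?thesis
    by (intro exI[of _ "from_nat_into X"] exI[of _ "\<lambda>k. R (from_nat_into X k)"]
        exI[of _ "\<lambda>k. E (from_nat_into X k)"] conjI)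
qed

text \<open>\<open>\<delta>\<close> is a weighted sum of bumps on balls that exhaust
  \<open>V0\<close>; convergence comes from the weights, not from local finiteness of the cover.
  Each bump is supported in a closed ball inside \<open>V0\<close>, which gives flatness off
  \<open>V0\<close>. Bounding the products with every \<open>\<mu> c\<close> directly accounts for
  monomials that are unbounded on \<open>V\<close>.\<close>

lemma exists_small_scale:
  fixes V :: "(real^'n) set" and \<mu> :: "'c::finite \<Rightarrow> real^'n \<Rightarrow> real"
  assumes "V0 \<subseteq> V" "open V0" "loc_pos V \<eta>" and sm: "\<And>c. smooth_on UNIV (\<mu> c)" and "\<mu> c0 = (\<lambda>_. 1)"
  shows "\<exists>\<delta>. smooth_on UNIV \<delta> \<and> (\<forall>y\<in>V0. \<delta> y > 0) \<and>
    (\<forall>y c is. y \<notin> V0 \<longrightarrow> partials is (\<lambda>y. \<delta> y * \<mu> c y) y = 0) \<and>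
    (\<forall>y\<in>V. \<forall>c is. length is \<le> L \<longrightarrow> \<bar>partials is (\<lambda>y. \<delta> y * \<mu> c y) y\<bar> < \<eta> y)"
proof (cases "V0 = {}")
  case True
  then show ?thesis
    using loc_pos_pos[OF assms(3)]
    by (intro exI[of _ "\<lambda>_. 0"]) (simp add: smooth_on_const partials_const_0)
next
  case False
  obtain a :: "nat \<Rightarrow> real^'n" and r e where cover: "V0 = (\<Union>k. ball (a k) (r k))"
    and re: "\<And>k. 0 < r k" "\<And>k. 0 < e k" "\<And>k. cball (a k) (r k) \<subseteq> V0"
      "\<And>k y. y \<in> cball (a k) (r k) \<Longrightarrow> e k \<le> \<eta> y"
    using countable_ball_cover[OF assms(1-3) False] by blast
  have "\<forall>k. \<exists>\<beta>. smooth_on UNIV \<beta> \<and> (\<forall>y. \<beta> y \<ge> 0) \<and> (\<forall>y\<in>ball (a k) (r k). \<beta> y > 0) \<and>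
      (\<forall>y. y \<notin> ball (a k) (r k) \<longrightarrow> \<beta> y = (0::real))"
    using exists_bump re(1) by blast
  from choice[OF this] obtain \<beta> where \<beta>: "\<And>k. smooth_on UNIV (\<beta> k)" "\<And>k y. \<beta> k y \<ge> (0::real)"
    "\<And>k y. y \<in> ball (a k) (r k) \<Longrightarrow> \<beta> k y > 0" "\<And>k y. y \<notin> ball (a k) (r k) \<Longrightarrow> \<beta> k y = 0" by blast
  define h where "h k c = (\<lambda>y. \<beta> k y * \<mu> c y)" for k c
  have sh: "smooth_on UNIV (h k c)" for k c
    unfolding h_def by (intro smooth_on_mult \<beta> sm open_UNIV)
  have h0: "h k c y = 0" if "y \<notin> cball (a k) (r k)" for k c y
    using that \<beta>(4)[of y k] ball_subset_cball by (auto simp: h_def)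
  have h_out: "partials is (h k c) y = 0" if "y \<notin> cball (a k) (r k)" for "is" k c y
    by (rule partials_outside[OF sh h0 that])
  have "\<exists>M>0. \<forall>is c y. length is \<le> max L k \<longrightarrow> \<bar>partials is (h k c) y\<bar> \<le> M" for k
  proof -
    have "\<forall>p. \<exists>M. \<forall>y. norm (partials (fst p) (h k (snd p)) y) \<le> M"
      using partials_bounded[OF sh h0] by blast
    from choice[OF this] obtain M where M: "\<And>is c y. \<bar>partials is (h k c) y\<bar> \<le> M (is, c)"
      by (metis fst_conv snd_conv real_norm_def)
    define F where "F = {is :: 'n list. set is \<subseteq> UNIV \<and> length is \<le> max L k} \<times> (UNIV :: 'c set)"
    have "finite F" unfolding F_def by (intro finite_cartesian_product finite_lists_length_le) simp_all
    then have "M p \<le> (\<Sum>p\<in>F. \<bar>M p\<bar>)" if "p \<in> F" for p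
      using member_le_sum[OF that, of "\<lambda>p. \<bar>M p\<bar>"] abs_ge_self[of "M p"] by simp
    then have le: "M (is, c) \<le> (\<Sum>p\<in>F. \<bar>M p\<bar>)" if "length is \<le> max L k" for "is" c
      using that by (simp add: F_def)
    have "\<bar>partials is (h k c) y\<bar> \<le> 1 + (\<Sum>p\<in>F. \<bar>M p\<bar>)" if "length is \<le> max L k" for "is" c y
      using order_trans[OF M[of "is" c y] le[OF that]] by simp
    then show ?thesis by (intro exI[of _ "1 + (\<Sum>p\<in>F. \<bar>M p\<bar>)"] conjI) (auto intro: add_pos_nonneg sum_nonneg)
  qed
  then have "\<forall>k. \<exists>M>0. \<forall>is c y. length is \<le> max L k \<longrightarrow> \<bar>partials is (h k c) y\<bar> \<le> M" by blast
  from choice[OF this] obtain M where M: "\<And>k. M k > 0"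
    "\<And>k is c y. length is \<le> max L k \<Longrightarrow> \<bar>partials is (h k c) y\<bar> \<le> M k" by blast
  \<comment> \<open>\<open>M k\<close> normalises the derivatives of order up to
    \<open>max L k\<close>: order \<open>L\<close> for the tolerance, order \<open>k\<close> for
    smoothness of the sum. In the minimum, 1 serves convergence and \<open>e k\<close> lies below
    \<open>\<eta>\<close> on the ball. Since the geometric weights sum to 2, the divisor 4 leaves a
    total of \<open>\<eta> / 2\<close>.\<close>
  define s where "s k = (1/2)^k * (min 1 (e k) / 4) / M k" for k
  have s_pos: "s k > 0" for k using M(1)[of k] re(2)[of k] by (simp add: s_def)
  define u where "u c k = (\<lambda>y. s k *\<^sub>R h k c y)" for c k
  have su: "smooth_on UNIV (u c k)" for c k
    unfolding u_def by (intro smooth_on_scaleR smooth_on_const sh open_UNIV)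
  have pu: "partials is (u c k) y = s k * partials is (h k c) y" for "is" c k y
    unfolding u_def
    using partials_bounded_linear[OF open_UNIV bounded_linear_scaleR_right sh, of y "is" "s k" k c] by simp
  have bound: "\<bar>partials is (u c k) y\<bar> \<le> (1/2)^k * (min 1 (e k) / 4)" if "length is \<le> max L k" for "is" c k y
  proof -
    have "\<bar>partials is (u c k) y\<bar> = s k * \<bar>partials is (h k c) y\<bar>"
      using s_pos[of k] by (simp add: pu abs_mult)
    also have "\<dots> \<le> s k * M k" using M(2)[OF that] s_pos[of k] by (intro mult_left_mono) auto
    also have "\<dots> = (1/2)^k * (min 1 (e k) / 4)" using M(1)[of k] by (simp add: s_def)
    finally show ?thesis .
  qed
  have ex_bound: "\<exists>N. \<forall>k\<ge>N. \<forall>y. \<bar>partials is (u c k) y\<bar> \<le> (1/2)^k" for "is" c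
  proof (intro exI[of _ "length is"] allI impI)
    fix k y assume "length is \<le> k"
    then have "\<bar>partials is (u c k) y\<bar> \<le> (1/2)^k * (min 1 (e k) / 4)" by (intro bound) simp
    also have "\<dots> \<le> (1/2)^k * 1" using re(2)[of k] by (intro mult_left_mono) auto
    finally show "\<bar>partials is (u c k) y\<bar> \<le> (1/2)^k" by simp
  qed
  have ser1: "smooth_on UNIV (\<lambda>y. \<Sum>k. u c k y)" for c
    by (rule smooth_series(1)[OF su ex_bound])
  have ser2: "partials is (\<lambda>y. \<Sum>k. u c k y) y = (\<Sum>k. partials is (u c k) y)" for "is" c y
    by (rule smooth_series(2)[OF su ex_bound])
  define \<delta> where "\<delta> = (\<lambda>y. \<Sum>k. s k * \<beta> k y)"
  have u_c0: "u c0 k = (\<lambda>y. s k * \<beta> k y)" for k by (simp add: u_def h_def assms(5))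
  have summ: "summable (\<lambda>k. s k * \<beta> k y)" for y
    using smooth_series(3)[where u = "u c0" and y = y, OF su ex_bound, of "[]"] by (simp add: u_c0)
  have \<delta>\<mu>: "(\<lambda>y. \<delta> y * \<mu> c y) = (\<lambda>y. \<Sum>k. u c k y)" for c
    by (simp add: \<delta>_def suminf_mult2[OF summ] u_def h_def mult.assoc)
  show ?thesis
  proof (intro exI[of _ \<delta>] conjI ballI allI impI)
    show "smooth_on UNIV \<delta>" using ser1[of c0] by (simp add: u_c0 \<delta>_def)
    show "\<delta> y > 0" if y: "y \<in> V0" for y
    proof -
      obtain k where "y \<in> ball (a k) (r k)" using y unfolding cover by blast
      then have "s k * \<beta> k y > 0" using s_pos \<beta>(3) by simp
      then show ?thesis
        unfolding \<delta>_def using s_pos \<beta>(2) by (intro suminf_pos2[OF summ]) (simp_all add: less_imp_le)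
    qed
    show "partials is (\<lambda>y. \<delta> y * \<mu> c y) y = 0" if "y \<notin> V0" for y c "is"
    proof -
      have "partials is (h k c) y = 0" for k using re(3)[of k] that by (intro h_out) blast
      then show ?thesis unfolding \<delta>\<mu> ser2 pu by simp
    qed
    show "\<bar>partials is (\<lambda>y. \<delta> y * \<mu> c y) y\<bar> < \<eta> y" if y: "y \<in> V" and l: "length is \<le> L" for y c "is"
    proof -
      have \<eta>: "\<eta> y > 0" using loc_pos_pos[OF assms(3) y] .
      have le: "norm (partials is (u c k) y) \<le> (1/2)^k * (\<eta> y / 4)" for k
      proof (cases "y \<in> cball (a k) (r k)")
        case True
        have "\<bar>partials is (u c k) y\<bar> \<le> (1/2)^k * (min 1 (e k) / 4)" using l by (intro bound) simp
        also have "\<dots> \<le> (1/2)^k * (\<eta> y / 4)" using re(4)[OF True] by (intro mult_left_mono) auto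
        finally show ?thesis by simp
      next
        case False
        then show ?thesis using \<eta> by (simp add: pu h_out)
      qed
      have g: "summable (\<lambda>k. (1/2)^k * (\<eta> y / 4))"
        by (intro summable_mult2 summable_geometric) simp
      have "\<bar>\<Sum>k. partials is (u c k) y\<bar> \<le> (\<Sum>k. (1/2)^k * (\<eta> y / 4))"
        using norm_suminf_le[OF le g] by simp
      also have "\<dots> = 2 * (\<eta> y / 4)"
        using suminf_mult2[OF summable_geometric[of "1/2::real"], of "\<eta> y / 4"] suminf_geometric[of "1/2::real"]
        by simp
      finally show ?thesis using \<eta> unfolding \<delta>\<mu> ser2 by simp
    qed
  qed
qed

section \<open>Dimension count and density\<close>

text \<open>The basis is indexed by sets \<open>{r, c}\<close> of one or two elements, so that
  mirrored entries share an index. The basis matrices have disjoint supports and are therefore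
  orthogonal.\<close>

lemma dim_symmetric_matrices:
  "dim {M :: real^'n^'n. transpose M = M} = (CARD('n) * (CARD('n) + 1)) div 2"
proof -
  define P where "P = {p :: 'n set. card p = 1} \<union> {p. card p = 2}"
  define m :: "'n set \<Rightarrow> real^'n^'n" where "m p = (\<chi> r c. if {r, c} = p then 1 else 0)" for p
  have pair_P: "{r, c} \<in> P" for r c by (cases "r = c") (auto simp: P_def)
  have P_pair: "\<exists>r c. p = {r, c}" if "p \<in> P" for p
  proof (cases "card p = 1")
    case True
    then obtain r where "p = {r}" by (auto simp: card_1_singleton_iff)
    then have "p = {r, r}" by simp
    then show ?thesis by blast
  next
    case False
    then have "card p = 2" using that by (simp add: P_def)
    then show ?thesis by (auto simp: card_2_iff)
  qed
  have m_diag: "m p \<noteq> 0" if p: "p \<in> P" for p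
  proof -
    obtain r c where "p = {r, c}" using P_pair[OF p] by blast
    then have "m p $ r $ c = 1" by (simp add: m_def)
    then show ?thesis by auto
  qed
  have orth: "m p \<bullet> m q = 0" if "p \<noteq> q" for p q
  proof -
    have "m p $ r $ c * m q $ r $ c = 0" for r c
      using that by (cases "{r, c} = p") (simp_all add: m_def)
    then have "(\<Sum>r\<in>UNIV. \<Sum>c\<in>UNIV. m p $ r $ c * m q $ r $ c) = 0" by (intro sum.neutral ballI)
    then show ?thesis by (simp add: inner_vec_def)
  qed
  have inj: "inj_on m P"
  proof (rule inj_onI, rule ccontr)
    fix p q assume "p \<in> P" "m p = m q" "p \<noteq> q"
    then have "m p \<bullet> m p = 0" using orth[of p q] by simp
    then show False using m_diag[OF \<open>p \<in> P\<close>] by simp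
  qed
  have "dim {M :: real^'n^'n. transpose M = M} = card (m ` P)"
  proof (rule dim_unique)
    show "m ` P \<subseteq> {M. transpose M = M}"
      by (auto simp: m_def transpose_def vec_eq_iff insert_commute)
    have "orthogonal (m p) (m q)" if "m p \<noteq> m q" for p q
      using orth[of p q] that by (cases "p = q") (simp_all add: orthogonal_def)
    then have "pairwise orthogonal (m ` P)" unfolding pairwise_def by blast
    moreover have "0 \<notin> m ` P" using m_diag by force
    ultimately show "independent (m ` P)" by (rule pairwise_orthogonal_independent)
    show "{M. transpose M = M} \<subseteq> span (m ` P)"
    proof
      fix M :: "real^'n^'n" assume "M \<in> {M. transpose M = M}"
      then have sym: "M $ r $ c = M $ c $ r" for r c
        by (metis (mono_tags, lifting) mem_Collect_eq transpose_def vec_lambda_beta)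
      \<comment> \<open>The choice is well defined because \<open>M\<close> is symmetric: both
        orderings of the set give the same entry.\<close>
      define v where "v p = (SOME t. \<exists>r c. p = {r, c} \<and> t = M $ r $ c)" for p
      have v: "v {r, c} = M $ r $ c" for r c
        unfolding v_def by (rule some_equality) (auto simp: doubleton_eq_iff sym)
      have "(\<Sum>p\<in>P. v p *\<^sub>R m p) $ r $ c = M $ r $ c" for r c
      proof -
        have "(\<Sum>p\<in>P. v p *\<^sub>R m p) $ r $ c = (\<Sum>p\<in>P. if {r, c} = p then v p else 0)"
          unfolding m_def by (simp add: if_distrib cong: if_cong)
        also have "\<dots> = v {r, c}" using pair_P by (simp add: P_def)
        finally show ?thesis by (simp add: v)
      qed
      then have "M = (\<Sum>p\<in>P. v p *\<^sub>R m p)" by (simp add: vec_eq_iff)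
      then show "M \<in> span (m ` P)" by (simp only:) (intro span_sum span_scale span_base imageI)
    qed
  qed (rule refl)
  also have "\<dots> = card P" by (rule card_image[OF inj])
  also have "\<dots> = card {p :: 'n set. card p = 1} + card {p :: 'n set. card p = 2}"
    unfolding P_def by (rule card_Un_disjoint) auto
  also have "\<dots> = CARD('n) + (CARD('n) choose 2)"
    using n_subsets[of "UNIV :: 'n set" 1] n_subsets[of "UNIV :: 'n set" 2] by simp
  also have "\<dots> = (CARD('n) * (CARD('n) + 1)) div 2"
  proof -
    have "CARD('n) * (CARD('n) + 1) = CARD('n) * (CARD('n) - 1) + CARD('n) * 2"
      by (cases "CARD('n)") (simp_all add: algebra_simps)
    then show ?thesis by (simp add: choose_two)
  qed
  finally show ?thesis .
qed

text \<open>Symmetrisation is linear and maps onto all pairs with symmetric second component, a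
  symmetric matrix being the image of its half. It therefore carries a spanning set of 1-jets to a
  spanning set of that space.\<close>

lemma dim_symmetrized_jets:
  fixes H :: "(real^'n \<Rightarrow> real^'n) set"
  assumes "span J = UNIV" "J \<subseteq> (\<lambda>h. jet1 h x) ` H"
  shows "dim {(h x, jacobian h (at x) + transpose (jacobian h (at x))) | h. h \<in> H}
    = CARD('n) + (CARD('n) * (CARD('n) + 1)) div 2"
proof -
  define L where "L z = (fst z, snd z + transpose (snd z))" for z :: "(real^'n) \<times> (real^'n^'n)"
  define S where "S = {(h x, jacobian h (at x) + transpose (jacobian h (at x))) | h. h \<in> H}"
  define Y where "Y = {M :: real^'n^'n. transpose M = M}"
  have lin: "linear L"
    unfolding L_def by (rule linearI) (simp_all add: transpose_def vec_eq_iff prod_eq_iff algebra_simps)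
  have sub: "subspace Y"
    unfolding Y_def subspace_def by (simp add: transpose_def vec_eq_iff)
  have S: "S = L ` (\<lambda>h. jet1 h x) ` H"
    by (simp add: S_def L_def jet1_def image_image setcompr_eq_image)
  have L_in: "L z \<in> UNIV \<times> Y" for z
    by (simp add: L_def Y_def transpose_def vec_eq_iff add.commute)
  have range_L: "range L = UNIV \<times> Y"
  proof (rule antisym)
    show "range L \<subseteq> UNIV \<times> Y" using L_in by blast
    show "UNIV \<times> Y \<subseteq> range L"
    proof
      fix z :: "(real^'n) \<times> (real^'n^'n)" assume "z \<in> UNIV \<times> Y"
      then have "transpose (snd z) = snd z" by (auto simp: Y_def)
      then have "transpose ((1/2) *\<^sub>R snd z) = (1/2) *\<^sub>R snd z"
        by (simp add: transpose_def vec_eq_iff)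
      moreover have "(1/2) *\<^sub>R snd z + (1/2) *\<^sub>R snd z = snd z"
        by (simp add: scaleR_2[symmetric] flip: scaleR_left_distrib)
      ultimately have "z = L (fst z, (1/2) *\<^sub>R snd z)" by (simp add: L_def)
      then show "z \<in> range L" by blast
    qed
  qed
  have "S \<subseteq> UNIV \<times> Y" unfolding S using L_in by blast
  then have "span S \<subseteq> UNIV \<times> Y" by (intro span_minimal subspace_Times sub subspace_UNIV)
  moreover have "UNIV \<times> Y \<subseteq> span S"
  proof -
    have "range L = span (L ` J)"
      unfolding assms(1)[symmetric] by (rule linear_span_image[OF lin, symmetric])
    also have "\<dots> \<subseteq> span S" unfolding S using assms(2) by (intro span_mono image_mono)
    finally show ?thesis by (simp add: range_L)
  qed
  ultimately have "span S = UNIV \<times> Y" by (rule antisym)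
  then have "dim S = dim ((UNIV :: (real^'n) set) \<times> Y)" by (metis dim_span)
  also have "\<dots> = CARD('n) + (CARD('n) * (CARD('n) + 1)) div 2"
    using dim_symmetric_matrices[where 'n = 'n] by (simp add: dim_Times sub Y_def[symmetric])
  finally show ?thesis unfolding S_def .
qed

lemma nested_bracket_Cons: "hs \<noteq> [] \<Longrightarrow> nested_bracket (h # hs) = lie_bracket h (nested_bracket hs)"
  by (cases hs) simp_all

lemma ad_eq_nested_bracket: "ad g k w = nested_bracket (replicate k g @ [w])"
  by (induction k) (simp_all add: nested_bracket_Cons)

lemma ad_derived_brackets:
  assumes "g \<in> F" "w \<in> F" "k \<ge> 1"
  shows "ad g k w \<in> derived_brackets F"
  unfolding derived_brackets_def using assms
  by (intro CollectI exI[of _ "replicate k g @ [w]"]) (auto simp: ad_eq_nested_bracket)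

lemma derived_brackets_subset: "derived_brackets F \<subseteq> zero_time_ideal F" "derived_brackets F \<subseteq> Lie F"
proof -
  show "derived_brackets F \<subseteq> zero_time_ideal F"
    unfolding zero_time_ideal_def by (rule order_trans[OF Un_upper2 span_superset])
  have "derived_brackets F \<subseteq> {nested_bracket hs | hs. length hs \<ge> 1 \<and> set hs \<subseteq> F}"
    unfolding derived_brackets_def by (auto intro: order_trans[of 1 2])
  then show "derived_brackets F \<subseteq> Lie F"
    unfolding Lie_def by (rule order_trans[OF _ span_superset])
qed

lemma drift_control_family: "drift f \<in> control_family f"
  unfolding control_family_def by (rule range_eqI[of _ _ 0]) (simp add: drift_def)

lemma shifted_control_family: "shifted i f \<in> control_family f"
  unfolding control_family_def
proof (rule range_eqI[of _ _ "axis i 1"])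
  have "(\<Sum>j\<in>UNIV. axis i 1 $ j *\<^sub>R column (Some j) (f x)) = (\<Sum>j\<in>UNIV. if j = i then column (Some j) (f x) else 0)"
    for x by (intro sum.cong) (auto simp: axis_def)
  then show "shifted i f = (\<lambda>x. column None (f x) + (\<Sum>j\<in>UNIV. axis i 1 $ j *\<^sub>R column (Some j) (f x)))"
    by (simp add: shifted_def)
qed

lemma spanning_imp_dim:
  fixes f :: "real^'n \<Rightarrow> real^('u::finite) option^'n"
  assumes "spanning i K f x" "derived_brackets (control_family f) \<subseteq> H"
  shows "dim {(h x, jacobian h (at x) + transpose (jacobian h (at x))) | h. h \<in> H}
    = CARD('n) + (CARD('n) * (CARD('n) + 1)) div 2"
proof (rule dim_symmetrized_jets)
  show "span (bracket_jets (drift f) (shifted i f) K x \<union> bracket_jets (shifted i f) (drift f) K x) = UNIV"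
    using assms(1) by (simp add: spanning_def)
  have "ad (drift f) k (shifted i f) \<in> H" "ad (shifted i f) k (drift f) \<in> H" if "k \<ge> 1" for k
    using assms(2) ad_derived_brackets[OF drift_control_family shifted_control_family that]
      ad_derived_brackets[OF shifted_control_family drift_control_family that] by blast+
  then show "bracket_jets (drift f) (shifted i f) K x \<union> bracket_jets (shifted i f) (drift f) K x
      \<subseteq> (\<lambda>h. jet1 h x) ` H"
    unfolding bracket_jets_def by auto
qed

text \<open>This turns flatness of a perturbation at one point into invariance of the bracket jets
  at that point, even if the fields change nearby.\<close>

lemma is_dpoly_eq:
  fixes H :: "(real^'n \<Rightarrow> 'b::euclidean_space) \<Rightarrow> real^'n \<Rightarrow> 'c::euclidean_space"
  assumes "is_dpoly H" "open V" "smooth_on V f" "smooth_on V f'" "x \<in> V"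
    and "\<And>is. partials is f x = partials is f' x"
  shows "H f x = H f' x"
proof -
  obtain l Q where Q: "\<forall>V f x. open V \<longrightarrow> smooth_on V f \<longrightarrow> x \<in> V \<longrightarrow> H f x = Q (snd (jet l f x))"
    using is_dpoly_jet[OF assms(1)] unfolding eventually_sequentially by blast
  have "jet l f x = jet l f' x" by (simp add: jet_def assms(6) cong: if_cong)
  then show ?thesis using Q assms(2-5) by simp
qed

section \<open>Perturbations inside a Whitney neighbourhood\<close>

lemma exists_small_not_negligible:
  fixes S :: "'e::euclidean_space set"
  assumes "negligible S"
  shows "\<exists>\<theta>. norm \<theta> \<le> 1 \<and> \<theta> \<notin> S"
proof (rule ccontr)
  assume "\<not> ?thesis"
  then have "ball 0 1 \<subseteq> S" by auto
  then have "negligible (ball (0::'e) 1)" using assms negligible_subset by blast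
  then show False using open_not_negligible[of "ball (0::'e) 1"] by simp
qed

text \<open>One \<open>\<delta>\<close> serves all \<open>\<theta>\<close> in the unit ball, so that
  \<open>\<theta>\<close> can later be chosen outside a null set defined in terms of
  \<open>\<delta>\<close>. The map \<open>E\<close> selects which columns of \<open>f\<close>
  receive the perturbing field.\<close>

lemma exists_perturbation_family:
  fixes f :: "real^'n \<Rightarrow> 'b::euclidean_space" and E :: "'e::euclidean_space \<Rightarrow> 'b"
    and \<mu> :: "'c::finite \<Rightarrow> real^'n \<Rightarrow> real"
  assumes "open V" and f: "f \<in> smooth_maps V" and T: "openin (whitney_topology V) T" "f \<in> T"
    and "V0 \<subseteq> V" "open V0" "bounded_linear E" and sm: "\<And>c. smooth_on UNIV (\<mu> c)" and "\<mu> c0 = (\<lambda>_. 1)"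
  shows "\<exists>\<delta>. smooth_on UNIV \<delta> \<and> (\<forall>y\<in>V0. \<delta> y > 0) \<and>
    (\<forall>\<theta>. norm \<theta> \<le> 1 \<longrightarrow> (\<exists>f'\<in>T. f' \<in> smooth_maps V \<and>
      (\<forall>y\<in>V. f' y = f y + E (\<delta> y *\<^sub>R lin_comb \<mu> \<theta> y)) \<and>
      (\<forall>y\<in>V - V0. \<forall>is. partials is f' y = partials is f y)))"
proof -
  obtain L \<eta> where \<eta>: "loc_pos V \<eta>"
    and nbhd: "\<And>h. h \<in> smooth_maps V \<Longrightarrow>
      (\<And>x is. x \<in> V \<Longrightarrow> length is \<le> L \<Longrightarrow> norm (partials is h x - partials is f x) < \<eta> x) \<Longrightarrow> h \<in> T"
    by (rule whitney_nbhd[OF assms(1) f T]) blast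
  obtain B where B: "B > 0" "\<And>v. norm (E v) \<le> norm v * B"
    using bounded_linear.pos_bounded[OF assms(7)] by blast
  \<comment> \<open>Each of the \<open>CARD('c)\<close> terms may use \<open>\<eta> / C\<close>
    times the bound \<open>B\<close> of \<open>E\<close>; the factor 2 leaves a total of
    \<open>\<eta> / 2\<close>, strictly below the tolerance.\<close>
  define C where "C = 2 * real CARD('c) * B"
  have "C > 0" using B(1) by (simp add: C_def)
  then have "loc_pos V (\<lambda>x. \<eta> x * (1 / C))" by (intro loc_pos_cmult \<eta>) simp
  from exists_small_scale[where \<mu> = \<mu> and L = L, OF assms(5,6) this sm assms(9)]
  obtain \<delta> where \<delta>: "smooth_on UNIV \<delta>" "\<forall>y\<in>V0. \<delta> y > 0"
    and \<delta>0: "\<forall>y c is. y \<notin> V0 \<longrightarrow> partials is (\<lambda>y. \<delta> y * \<mu> c y) y = 0"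
    and small: "\<forall>y\<in>V. \<forall>c is. length is \<le> L \<longrightarrow> \<bar>partials is (\<lambda>y. \<delta> y * \<mu> c y) y\<bar> < \<eta> y * (1 / C)"
    by blast
  have f_smooth: "smooth_on V f" using f by (simp add: smooth_maps_def)
  have "\<exists>f'\<in>T. f' \<in> smooth_maps V \<and> (\<forall>y\<in>V. f' y = f y + E (\<delta> y *\<^sub>R lin_comb \<mu> \<theta> y)) \<and>
      (\<forall>y\<in>V - V0. \<forall>is. partials is f' y = partials is f y)" if \<theta>: "norm \<theta> \<le> 1" for \<theta>
  proof -
    define G where "G y = (\<Sum>c\<in>UNIV. (\<delta> y * \<mu> c y) *\<^sub>R E (\<theta> $ c))" for y
    have G: "E (\<delta> y *\<^sub>R lin_comb \<mu> \<theta> y) = G y" for y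
      unfolding G_def lin_comb_def
      by (simp add: linear_sum[OF bounded_linear.linear[OF assms(7)]] scaleR_sum_right
          linear_cmul[OF bounded_linear.linear[OF assms(7)]])
    have s\<delta>\<mu>: "smooth_on UNIV (\<lambda>y. \<delta> y * \<mu> c y)" for c
      by (intro smooth_on_mult \<delta>(1) sm open_UNIV)
    have sterm: "smooth_on UNIV (\<lambda>y. (\<delta> y * \<mu> c y) *\<^sub>R E (\<theta> $ c))" for c
      by (intro smooth_on_scaleR s\<delta>\<mu> smooth_on_const open_UNIV)
    have sG: "smooth_on V G"
      unfolding G_def[abs_def]
      by (rule smooth_on_subset[OF smooth_on_sum[OF open_UNIV sterm] subset_UNIV])
    have pG: "partials is G y = (\<Sum>c\<in>UNIV. partials is (\<lambda>y. \<delta> y * \<mu> c y) y *\<^sub>R E (\<theta> $ c))" for "is" y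
      unfolding G_def[abs_def] partials_sum[OF open_UNIV sterm UNIV_I]
      by (intro sum.cong refl partials_bounded_linear[OF open_UNIV bounded_linear_scaleR_left s\<delta>\<mu> UNIV_I])
    define f' where "f' = restrict (\<lambda>y. f y + G y) V"
    have pf': "partials is f' y = partials is f y + partials is G y" if y: "y \<in> V" for "is" y
    proof -
      have "partials is f' y = partials is (\<lambda>y. f y + G y) y"
        by (rule partials_cong[OF assms(1) _ y]) (simp add: f'_def)
      then show ?thesis by (simp add: partials_add[OF assms(1) f_smooth sG y])
    qed
    have "smooth_on V f'"
      by (rule smooth_on_cong[OF assms(1) _ smooth_on_add[OF assms(1) f_smooth sG]]) (simp add: f'_def)
    then have f'_smooth: "f' \<in> smooth_maps V" by (simp add: smooth_maps_def f'_def)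
    moreover have "f' \<in> T"
    proof (rule nbhd[OF f'_smooth])
      fix x and "is" :: "'n list" assume x: "x \<in> V" and l: "length is \<le> L"
      have "norm (partials is f' x - partials is f x) \<le> (\<Sum>c\<in>(UNIV :: 'c set). \<eta> x * (1 / C) * B)"
        unfolding pf'[OF x] pG add_diff_cancel_left'
      proof (rule sum_norm_le)
        fix c
        have "norm (E (\<theta> $ c)) \<le> norm (\<theta> $ c) * B" by (rule B(2))
        also have "\<dots> \<le> 1 * B"
          using Finite_Cartesian_Product.norm_nth_le[of \<theta> c] \<theta> B(1) by (intro mult_right_mono) auto
        finally show "norm (partials is (\<lambda>y. \<delta> y * \<mu> c y) x *\<^sub>R E (\<theta> $ c)) \<le> \<eta> x * (1 / C) * B"
          unfolding norm_scaleR using small x l loc_pos_pos[OF \<eta> x] \<open>C > 0\<close>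
          by (intro mult_mono) (auto intro: less_imp_le)
      qed
      also have "\<dots> = \<eta> x / 2" using B(1) by (simp add: C_def)
      also have "\<dots> < \<eta> x" using loc_pos_pos[OF \<eta> x] by simp
      finally show "norm (partials is f' x - partials is f x) < \<eta> x" .
    qed
    moreover have "\<forall>y\<in>V. f' y = f y + E (\<delta> y *\<^sub>R lin_comb \<mu> \<theta> y)" by (simp add: f'_def G)
    moreover have "partials is f' y = partials is f y" if "y \<in> V - V0" for y "is"
      using that \<delta>0 by (simp add: pf' pG)
    ultimately show ?thesis by blast
  qed
  then show ?thesis using \<delta> by blast
qed

text \<open>Adding \<open>to_drift i v\<close> moves the drift by \<open>v\<close> and leaves \<open>shifted i\<close> unchanged; \<open>to_control i v\<close> does the opposite.\<close>

definition to_drift :: "'u \<Rightarrow> real^'n \<Rightarrow> real^('u::finite) option^'n"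
  where "to_drift i v = (\<chi> r c. if c = None then v $ r else if c = Some i then - v $ r else 0)"

definition to_control :: "'u \<Rightarrow> real^'n \<Rightarrow> real^('u::finite) option^'n"
  where "to_control i v = (\<chi> r c. if c = Some i then v $ r else 0)"

lemma bounded_linear_to_drift: "bounded_linear (to_drift i)"
  unfolding linear_conv_bounded_linear[symmetric] to_drift_def
  by (rule linearI) (simp_all add: vec_eq_iff)

lemma bounded_linear_to_control: "bounded_linear (to_control i)"
  unfolding linear_conv_bounded_linear[symmetric] to_control_def
  by (rule linearI) (simp_all add: vec_eq_iff)

lemma drift_perturbed:
  "f' y = f y + (to_drift i v + to_control i w) \<Longrightarrow> drift f' y = drift f y + v"
  by (simp add: drift_def column_def to_drift_def to_control_def vec_eq_iff)

lemma shifted_perturbed: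
  "f' y = f y + (to_drift i v + to_control i w) \<Longrightarrow> shifted i f' y = shifted i f y + w"
  by (simp add: shifted_def column_def to_drift_def to_control_def vec_eq_iff)

lemma to_drift_0 [simp]: "to_drift i 0 = 0" and to_control_0 [simp]: "to_control i 0 = 0"
  by (simp_all add: to_drift_def to_control_def vec_eq_iff)

lemma bracket_jets_cong:
  assumes "open V" "\<And>y. y \<in> V \<Longrightarrow> g y = g' y" "\<And>y. y \<in> V \<Longrightarrow> w y = w' y" "x \<in> V"
  shows "bracket_jets g w K x = bracket_jets g' w' K x"
  unfolding bracket_jets_def
  by (intro image_cong refl jet1_cong[OF assms(1) _ assms(4)] ad_cong[OF assms(1-3)])

lemma open_nonzero_set:
  fixes g :: "real^'n \<Rightarrow> 'b::real_normed_vector"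
  assumes "open V" "smooth_on V g"
  shows "open {x \<in> V. g x \<noteq> 0}"
proof -
  have "open (V \<inter> g -` (- {0}))"
    using smooth_on_continuous[OF assms(2)] assms(1) by (intro continuous_open_preimage) auto
  moreover have "V \<inter> g -` (- {0}) = {x \<in> V. g x \<noteq> 0}" by auto
  ultimately show ?thesis by simp
qed

text \<open>For each \<open>x\<close> exactly one constant perturbation, \<open>Z x\<close>, makes
  both fields vanish at \<open>x\<close>. The bad constants are thus a differentiable image of an
  n-dimensional set in a 2n-dimensional space, hence null.\<close>

lemma exists_no_common_zero:
  fixes f :: "real^'n \<Rightarrow> real^('u::finite) option^'n"
  assumes "open V" and f: "f \<in> smooth_maps V" and T: "openin (whitney_topology V) T" "f \<in> T"
  shows "\<exists>f'\<in>T. f' \<in> smooth_maps V \<and> (\<forall>x\<in>V. drift f' x \<noteq> 0 \<or> shifted i f' x \<noteq> 0)"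
proof -
  define E where "E z = to_drift i (fst z) + to_control i (snd z)" for z :: "(real^'n) \<times> (real^'n)"
  define \<mu> where "\<mu> = (\<lambda>(c :: unit) (y :: real^'n). 1 :: real)"
  have "bounded_linear E"
    unfolding E_def[abs_def]
    by (intro bounded_linear_add bounded_linear_compose[OF bounded_linear_to_drift bounded_linear_fst]
        bounded_linear_compose[OF bounded_linear_to_control bounded_linear_snd])
  moreover have "smooth_on UNIV (\<mu> c)" for c unfolding \<mu>_def by (rule smooth_on_const)
  moreover have "\<mu> () = (\<lambda>_. 1)" by (simp add: \<mu>_def)
  ultimately obtain \<delta> where \<delta>: "smooth_on UNIV \<delta>" "\<forall>y\<in>V. \<delta> y > 0"
    and pert: "\<forall>\<theta>. norm \<theta> \<le> 1 \<longrightarrow> (\<exists>f'\<in>T. f' \<in> smooth_maps V \<and>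
      (\<forall>y\<in>V. f' y = f y + E (\<delta> y *\<^sub>R lin_comb \<mu> \<theta> y)) \<and>
      (\<forall>y\<in>V - V. \<forall>is. partials is f' y = partials is f y))"
    using exists_perturbation_family[OF assms(1) f T order_refl assms(1), of E \<mu> "()"] by blast
  have sf: "smooth_on V f" using f by (simp add: smooth_maps_def)
  define Z where "Z x = (\<chi> (c :: unit). ((- 1 / \<delta> x) *\<^sub>R drift f x, (- 1 / \<delta> x) *\<^sub>R shifted i f x))" for x
  have "Z differentiable_on V"
    unfolding differentiable_on_def
  proof
    fix x assume x: "x \<in> V"
    have d: "drift f differentiable (at x within V)" "shifted i f differentiable (at x within V)"
      "\<delta> differentiable (at x within V)"
      using smooth_on_differentiable[OF smooth_on_drift[OF assms(1) sf] x]
        smooth_on_differentiable[OF smooth_on_shifted[OF assms(1) sf] x]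
        smooth_on_differentiable[OF \<delta>(1) UNIV_I] differentiable_at_withinI by blast+
    have "\<delta> x \<noteq> 0" using \<delta>(2) x by force
    then have q: "(\<lambda>x. - 1 / \<delta> x) differentiable (at x within V)"
      by (intro differentiable_divide differentiable_const d)
    have "(\<lambda>x. ((- 1 / \<delta> x) *\<^sub>R drift f x, (- 1 / \<delta> x) *\<^sub>R shifted i f x)) differentiable (at x within V)"
      using differentiable_scaleR[OF q d(1)] differentiable_scaleR[OF q d(2)] has_derivative_Pair
      unfolding differentiable_def by blast
    then show "Z differentiable at x within V"
      unfolding Z_def[abs_def] by (intro differentiable_vecI) simp
  qed
  then have "negligible (Z ` V)"
    by (intro negligible_differentiable_image_lowdim) simp_all
  then obtain \<theta> where \<theta>: "norm \<theta> \<le> 1" "\<theta> \<notin> Z ` V"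
    using exists_small_not_negligible by blast
  then obtain f' where f': "f' \<in> T" "f' \<in> smooth_maps V"
    "\<forall>y\<in>V. f' y = f y + E (\<delta> y *\<^sub>R lin_comb \<mu> \<theta> y)" using pert by blast
  have "drift f' x \<noteq> 0 \<or> shifted i f' x \<noteq> 0" if x: "x \<in> V" for x
  proof (rule ccontr)
    assume zero: "\<not> ?thesis"
    have eq: "f' x = f x + (to_drift i (\<delta> x *\<^sub>R fst (\<theta> $ ())) + to_control i (\<delta> x *\<^sub>R snd (\<theta> $ ())))"
      using f'(3) x by (simp add: E_def lin_comb_def \<mu>_def UNIV_unit)
    have "drift f x + \<delta> x *\<^sub>R fst (\<theta> $ ()) = 0" "shifted i f x + \<delta> x *\<^sub>R snd (\<theta> $ ()) = 0"
      using zero drift_perturbed[of f' x f i, OF eq] shifted_perturbed[of f' x f i, OF eq] by auto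
    then have "drift f x = - (\<delta> x *\<^sub>R fst (\<theta> $ ()))" "shifted i f x = - (\<delta> x *\<^sub>R snd (\<theta> $ ()))"
      by (simp_all add: eq_neg_iff_add_eq_0)
    moreover have "\<delta> x \<noteq> 0" using \<delta>(2) x by force
    ultimately have "\<theta> = Z x" by (simp add: Z_def vec_eq_iff prod_eq_iff)
    then show False using \<theta>(2) x by blast
  qed
  then show ?thesis using f' by blast
qed

text \<open>\<open>G\<close> and \<open>W\<close> stand for the two fields in either order, with
  \<open>E\<close> moving \<open>W\<close> alone, so that the lemma can be applied a second time
  with the roles exchanged. Preservation of all partials at the zeros of \<open>G\<close> is what
  the second application must not destroy.\<close>

lemma exists_spanning_perturbation:
  fixes f :: "real^'n \<Rightarrow> real^('u::finite) option^'n" and G W :: "(real^'n \<Rightarrow> real^'u option^'n) \<Rightarrow> real^'n \<Rightarrow> real^'n"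
  assumes "open V" and f: "f \<in> smooth_maps V" and T: "openin (whitney_topology V) T" "f \<in> T"
    and "bounded_linear E" and smooth: "smooth_on V (G f)" "smooth_on V (W f)"
    and GW: "\<And>f' y v. f' y = f y + E v \<Longrightarrow> G f' y = G f y \<and> W f' y = W f y + v"
    and card: "2 * CARD('n) + CARD('n) * CARD('n) < CARD('k::finite)"
  shows "\<exists>f'\<in>T. f' \<in> smooth_maps V \<and> (\<forall>x\<in>V. G f' x = G f x) \<and>
    (\<forall>x\<in>V. G f x \<noteq> 0 \<longrightarrow> span (bracket_jets (G f') (W f') CARD('k) x) = UNIV) \<and>
    (\<forall>x\<in>V. G f x = 0 \<longrightarrow> (\<forall>is. partials is f' x = partials is f x))"
proof -
  define V0 where "V0 = {x \<in> V. G f x \<noteq> 0}"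
  have V0: "V0 \<subseteq> V" "open V0" unfolding V0_def using open_nonzero_set[OF assms(1) smooth(1)] by auto
  define \<mu> :: "('k option \<Rightarrow> 'n option) \<Rightarrow> real^'n \<Rightarrow> real" where "\<mu> = monom_map"
  have "smooth_on UNIV (\<mu> c)" for c unfolding \<mu>_def by (rule smooth_on_monom_map[OF open_UNIV])
  moreover have "\<mu> (\<lambda>_. None) = (\<lambda>_. 1)" by (simp add: \<mu>_def monom_map_def fun_eq_iff)
  ultimately obtain \<delta> where \<delta>: "smooth_on UNIV \<delta>" "\<forall>y\<in>V0. \<delta> y > 0"
    and pert: "\<forall>\<theta>. norm \<theta> \<le> 1 \<longrightarrow> (\<exists>f'\<in>T. f' \<in> smooth_maps V \<and>
      (\<forall>y\<in>V. f' y = f y + E (\<delta> y *\<^sub>R lin_comb \<mu> \<theta> y)) \<and>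
      (\<forall>y\<in>V - V0. \<forall>is. partials is f' y = partials is f y))"
    using exists_perturbation_family[OF assms(1) f T V0 assms(5), of \<mu> "\<lambda>_. None"] by blast
  have "negligible {\<theta> :: (real^'n)^('k option \<Rightarrow> 'n option). \<exists>x\<in>V. G f x \<noteq> 0 \<and>
    span (bracket_jets (G f) (\<lambda>y. W f y + \<delta> y *\<^sub>R lin_comb monom_map \<theta> y) CARD('k) x) \<noteq> UNIV}"
  proof (rule negligible_non_spanning[OF assms(1) smooth _ _ card])
    show "smooth_on V \<delta>" by (rule smooth_on_subset[OF \<delta>(1) subset_UNIV])
    show "\<delta> x \<noteq> 0" if "x \<in> V" "G f x \<noteq> 0" for x using \<delta>(2) that by (force simp: V0_def)
  qed
  from exists_small_not_negligible[OF this] obtain \<theta> :: "(real^'n)^('k option \<Rightarrow> 'n option)"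
    where \<theta>: "norm \<theta> \<le> 1"
      "\<forall>x\<in>V. G f x \<noteq> 0 \<longrightarrow>
        span (bracket_jets (G f) (\<lambda>y. W f y + \<delta> y *\<^sub>R lin_comb monom_map \<theta> y) CARD('k) x) = UNIV"
    by blast
  obtain f' where f': "f' \<in> T" "f' \<in> smooth_maps V"
    "\<forall>y\<in>V. f' y = f y + E (\<delta> y *\<^sub>R lin_comb \<mu> \<theta> y)"
    "\<forall>y\<in>V - V0. \<forall>is. partials is f' y = partials is f y"
    using pert \<theta>(1) by blast
  have eq: "G f' y = G f y" "W f' y = W f y + \<delta> y *\<^sub>R lin_comb monom_map \<theta> y" if "y \<in> V" for y
    using GW[of f' y "\<delta> y *\<^sub>R lin_comb \<mu> \<theta> y"] f'(3) that by (simp_all add: \<mu>_def)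
  have "span (bracket_jets (G f') (W f') CARD('k) x) = UNIV" if x: "x \<in> V" "G f x \<noteq> 0" for x
    using \<theta>(2) x bracket_jets_cong[OF assms(1) eq x(1)] by simp
  then show ?thesis using f' eq(1) by (intro bexI[of _ f']) (auto simp: V0_def)
qed

lemma exists_spanning:
  fixes f :: "real^'n \<Rightarrow> real^('u::finite) option^'n"
  assumes "open V" and f: "f \<in> smooth_maps V" and T: "openin (whitney_topology V) T" "f \<in> T"
    and card: "2 * CARD('n) + CARD('n) * CARD('n) < CARD('k::finite)"
  shows "\<exists>f'\<in>T. f' \<in> smooth_maps V \<and> (\<forall>x\<in>V. spanning i CARD('k) f' x)"
proof -
  have sm: "smooth_on V (drift h)" "smooth_on V (shifted i h)" if "h \<in> smooth_maps V"
    for h :: "real^'n \<Rightarrow> real^'u option^'n"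
    using that by (simp_all add: smooth_maps_def smooth_on_drift smooth_on_shifted assms(1))
  obtain f1 where f1: "f1 \<in> T" "f1 \<in> smooth_maps V" "\<And>x. x \<in> V \<Longrightarrow> drift f1 x \<noteq> 0 \<or> shifted i f1 x \<noteq> 0"
    using exists_no_common_zero[OF assms(1-4)] by blast
  have pert1: "drift f' y = drift f1 y \<and> shifted i f' y = shifted i f1 y + v"
    if "f' y = f1 y + to_control i v" for f' y v
    using drift_perturbed[of f' y f1 i 0 v] shifted_perturbed[of f' y f1 i 0 v] that by simp
  obtain f2 where f2: "f2 \<in> T" "f2 \<in> smooth_maps V" "\<forall>x\<in>V. drift f2 x = drift f1 x"
    "\<forall>x\<in>V. drift f1 x \<noteq> 0 \<longrightarrow> span (bracket_jets (drift f2) (shifted i f2) CARD('k) x) = UNIV"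
    "\<forall>x\<in>V. drift f1 x = 0 \<longrightarrow> (\<forall>is. partials is f2 x = partials is f1 x)"
    using exists_spanning_perturbation[where G = drift and W = "shifted i", OF assms(1) f1(2) T(1) f1(1)
        bounded_linear_to_control sm[OF f1(2)] pert1 card] by blast
  have pert2: "shifted i f' y = shifted i f2 y \<and> drift f' y = drift f2 y + v"
    if "f' y = f2 y + to_drift i v" for f' y v
    using drift_perturbed[of f' y f2 i v 0] shifted_perturbed[of f' y f2 i v 0] that by simp
  obtain f3 where f3: "f3 \<in> T" "f3 \<in> smooth_maps V"
    "\<forall>x\<in>V. shifted i f2 x \<noteq> 0 \<longrightarrow> span (bracket_jets (shifted i f3) (drift f3) CARD('k) x) = UNIV"
    "\<forall>x\<in>V. shifted i f2 x = 0 \<longrightarrow> (\<forall>is. partials is f3 x = partials is f2 x)"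
    using exists_spanning_perturbation[where W = drift and G = "shifted i", OF assms(1) f2(2) T(1) f2(1)
        bounded_linear_to_drift sm(2,1)[OF f2(2)] pert2 card] by blast
  have "spanning i CARD('k) f3 x" if x: "x \<in> V" for x
  proof (cases "shifted i f2 x = 0")
    case False
    then have "span (bracket_jets (shifted i f3) (drift f3) CARD('k) x) = UNIV" using f3(3) x by blast
    then show ?thesis
      unfolding spanning_def using span_mono[OF Un_upper2] by (metis top.extremum_uniqueI)
  next
    case True
    \<comment> \<open>At a zero of \<open>drift f1\<close> the maps \<open>f2\<close> and
      \<open>f1\<close> agree, so a zero of \<open>shifted i f2\<close> there would be a common zero
      of both fields of \<open>f1\<close>.\<close>
    have nz: "drift f1 x \<noteq> 0"
    proof
      assume "drift f1 x = 0"
      then have "partials [] f2 x = partials [] f1 x" using f2(5) x by blast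
      then have "shifted i f2 x = shifted i f1 x" by (simp add: shifted_def)
      then show False using True f1(3)[OF x] \<open>drift f1 x = 0\<close> by simp
    qed
    have p: "partials is f3 x = partials is f2 x" for "is" using f3(4) True x by blast
    have s: "smooth_on V f3" "smooth_on V f2" using f2(2) f3(2) by (simp_all add: smooth_maps_def)
    \<comment> \<open>The drifts of \<open>f3\<close> and \<open>f2\<close> may differ near
      \<open>x\<close>, but equality of all partials at \<open>x\<close> already determines these
      jets.\<close>
    have "jet1 (ad (drift f3) k (shifted i f3)) x = jet1 (ad (drift f2) k (shifted i f2)) x" for k
      using is_dpoly_eq[OF is_dpoly_jet1[OF is_dpoly_ad[OF is_dpoly_drift is_dpoly_shifted
              smooth_on_drift smooth_on_shifted] smooth_on_ad[OF _ smooth_on_drift smooth_on_shifted]]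
          assms(1) s x p] .
    then have "bracket_jets (drift f3) (shifted i f3) CARD('k) x = bracket_jets (drift f2) (shifted i f2) CARD('k) x"
      by (simp add: bracket_jets_def)
    then have "span (bracket_jets (drift f3) (shifted i f3) CARD('k) x) = UNIV" using f2(4) nz x by simp
    then show ?thesis
      unfolding spanning_def using span_mono[OF Un_upper1] by (metis top.extremum_uniqueI)
  qed
  then show ?thesis using f3(1,2) by blast
qed

theorem theorem3p1:
  fixes V :: "(real^'n) set"
  assumes "open V"
  shows "(\<exists>O_Acc :: (real^'n \<Rightarrow> real^('u::finite) option^'n) set.
            openin (whitney_topology V) O_Acc \<and>
            (whitney_topology V) closure_of O_Acc = smooth_maps V \<and>
            (\<forall>f\<in>O_Acc. \<forall>m\<in>V.
               dim {(h m, jacobian h (at m) + transpose (jacobian h (at m))) | h.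
                      h \<in> Lie (control_family f)}
               = CARD('n) + (CARD('n) * (CARD('n) + 1)) div 2)) \<and>
         (\<exists>O_Acc_plus :: (real^'n \<Rightarrow> real^('u::finite) option^'n) set.
            openin (whitney_topology V) O_Acc_plus \<and>
            (whitney_topology V) closure_of O_Acc_plus = smooth_maps V \<and>
            (\<forall>f\<in>O_Acc_plus. \<forall>m\<in>V.
               dim {(h m, jacobian h (at m) + transpose (jacobian h (at m))) | h.
                      h \<in> zero_time_ideal (control_family f)}
               = CARD('n) + (CARD('n) * (CARD('n) + 1)) div 2))"
proof -
  fix i :: 'u
  \<comment> \<open>The type has \<open>2n + n^2 + 1\<close> elements: one more than the dimension
    of the space of points and covectors.\<close>
  define K where "K = CARD(('n + 'n + 'n \<times> 'n) option)"
  define S where "S = {f \<in> smooth_maps V. \<forall>x\<in>V. spanning i K f x}"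
  have card: "2 * CARD('n) + CARD('n) * CARD('n) < CARD(('n + 'n + 'n \<times> 'n) option)"
    by simp
  have "openin (whitney_topology V) S"
    unfolding S_def K_def by (rule openin_whitney_spanning[OF assms])
  moreover have "(whitney_topology V) closure_of S = smooth_maps V"
  proof
    show "(whitney_topology V) closure_of S \<subseteq> smooth_maps V"
      using closure_of_subset_topspace[of "whitney_topology V" S] by (simp add: topspace_whitney_topology)
    show "smooth_maps V \<subseteq> (whitney_topology V) closure_of S"
    proof
      fix f :: "real^'n \<Rightarrow> real^'u option^'n" assume f: "f \<in> smooth_maps V"
      have "\<exists>f'. f' \<in> S \<and> f' \<in> T" if "f \<in> T" "openin (whitney_topology V) T" for T
        using exists_spanning[OF assms f that(2,1) card, of i] unfolding S_def K_def by blast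
      then show "f \<in> (whitney_topology V) closure_of S"
        using f by (simp add: in_closure_of topspace_whitney_topology)
    qed
  qed
  moreover have "dim {(h m, jacobian h (at m) + transpose (jacobian h (at m))) | h.
      h \<in> zero_time_ideal (control_family f)} = CARD('n) + (CARD('n) * (CARD('n) + 1)) div 2"
    "dim {(h m, jacobian h (at m) + transpose (jacobian h (at m))) | h.
      h \<in> Lie (control_family f)} = CARD('n) + (CARD('n) * (CARD('n) + 1)) div 2"
    if "f \<in> S" "m \<in> V" for f m
    using that spanning_imp_dim[OF _ derived_brackets_subset(1)] spanning_imp_dim[OF _ derived_brackets_subset(2)]
    unfolding S_def by blast+
  ultimately show ?thesis by blast
qed

end
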